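(* Let $M$ be a separable $C^\ell$ Finsler manifold in the sense of Neeb-Upmeier ($\ell\in\{1,2,\dots\}\cup\{\infty\}$) and let $1\le k\le\ell$. The following conditions are equivalent: (1) $M$ is $C^k$-uniformly bumpable. (2) There is a constant $C_2\ge1$ (which only depends on $M$) such that for every Lipschitz function $f:G\to\mathbb{R}$ defined on an open subset $G$ of $M$ and every $\varepsilon>0$ there exists a Lipschitz and $C^k$-smooth function $g:M\to\mathbb{R}$ such that $|f(x)-g(x)|<\varepsilon$ for every $x\in G$, $\|dg(x)\|_x\le C_2\operatorname{Lip}(f)$ for all $x\in M$, and thus $\operatorname{Lip}(g)\le C_2\operatorname{Lip}(f)$.
   Context: Let $M$ be a paracompact $C^\ell$ Banach manifold ($\ell\ge1$) modeled on a real Banach space $(X,\|\cdot\|)$, with tangent bundle $TM$, and let $\|\cdot\|_M:TM\to[0,\infty)$ be a continuous map; write $\|\cdot\|_x$ for its restriction to $T_xM$. $(M,\|\cdot\|_M)$ is a $C^\ell$ Finsler manifold in the sense of Neeb-Upmeier if: (P1) for every $x\in M$, $\|\cdot\|_x$ is a norm on $T_xM$ such that for every chart $\varphi:U\to X$ with $x\in U$, the norm $v\in X\mapsto\|d\varphi^{-1}(\varphi(x))(v)\|_x$ is equivalent to $\|\cdot\|$ on $X$; and (NU1) for every $x_0\in M$ there are a chart $\varphi:U\to X$ with $x_0\in U$ and $K_{x_0}\ge1$ such that $\frac1{K_{x_0}}\|v\|_x\le\|d\varphi(x)(v)\|\le K_{x_0}\|v\|_x$ for every $x\in U$, $v\in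 T_xM$. The Finsler metric $d_M(p,q)$ is the infimum of the lengths $\int_a^b\|c'(t)\|_{c(t)}\,dt$ of piecewise $C^1$ paths $c:[a,b]\to M$ joining $p$ to $q$ (with value $+\infty$ if $p,q$ lie in different connected components). Lipschitz constants of functions defined on subsets of $M$ are with respect to $d_M$: $\operatorname{Lip}(f)$ is the least $L\ge0$ with $|f(p)-f(q)|\le L\,d_M(p,q)$ for all $p,q$ in the domain with $d_M(p,q)<\infty$. For a differentiable $g:M\to\mathbb{R}$, $\|dg(p)\|_p=\sup\{|dg(p)(v)|: v\in T_pM,\ \|v\|_p\le1\}$. $M$ is $C^k$-uniformly bumpable ($k\le\ell$) if there are $R>1$ and $r>0$ such that for every $p\in M$ and $\delta\in(0,r)$ there exists a $C^k$-smooth function $b:M\to[0,1]$ with $b(p)=1$, $b(q)=0$ whenever $d_M(p,q)\ge\delta$, and $\sup_{q\in M}\|db(q)\|_q\le R/\delta$. *)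

theory Defs
  imports "HOL-Analysis.Analysis" "HOL-Library.Extended_Nat"
begin

section \<open>Maps of class \<open>C\<^sup>k\<close> between Banach spaces\<close>

text \<open>
  The iterated Frechet derivative \<open>D\<^sup>n f x\<close> lives in \<open>L(X, L(X, \<dots>, L(X, Y)))\<close>, whose type depends
  on \<open>n\<close>. We use the isometric identification of this space with the bounded \<open>n\<close>-linear maps
  \<open>X\<^sup>n \<rightarrow> Y\<close>, and write those as functions on lists of length \<open>n\<close> (values on lists of another
  length are irrelevant).
\<close>

definition bounded_multilinear ::
    "nat \<Rightarrow> ('a::real_normed_vector list \<Rightarrow> 'b::real_normed_vector) \<Rightarrow> bool" where
  "bounded_multilinear n T \<longleftrightarrow>
     (\<forall>vs i. length vs = n \<and> i < n \<longrightarrow> linear (\<lambda>v. T (vs[i := v]))) \<and>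
     (\<exists>K. \<forall>vs. length vs = n \<longrightarrow> norm (T vs) \<le> K * prod_list (map norm vs))"

definition multilinear_norm ::
    "nat \<Rightarrow> ('a::real_normed_vector list \<Rightarrow> 'b::real_normed_vector) \<Rightarrow> real" where
  "multilinear_norm n T = Sup {norm (T vs) | vs. length vs = n \<and> (\<forall>v\<in>set vs. norm v \<le> 1)}"

text \<open>
  \<open>D n x\<close> is the \<open>n\<close>-th derivative of \<open>f\<close> at \<open>x\<close>: \<open>D (n + 1)\<close> is the Frechet derivative of \<open>D n\<close>
  with respect to the operator norm, \<open>D (n + 1) x (h # vs)\<close> being the derivative in direction \<open>h\<close>
  evaluated at \<open>vs\<close>. Only meant for open \<open>S\<close>. For \<open>k = \<infinity>\<close> all derivatives are required to exist.
\<close>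

definition Ck_on ::
    "enat \<Rightarrow> 'a::real_normed_vector set \<Rightarrow> ('a \<Rightarrow> 'b::real_normed_vector) \<Rightarrow> bool" where
  "Ck_on k S f \<longleftrightarrow>
     (\<exists>D :: nat \<Rightarrow> 'a \<Rightarrow> 'a list \<Rightarrow> 'b.
        (\<forall>x\<in>S. D 0 x [] = f x) \<and>
        (\<forall>n. enat n \<le> k \<longrightarrow> (\<forall>x\<in>S. bounded_multilinear n (D n x))) \<and>
        (\<forall>n. enat n < k \<longrightarrow> (\<forall>x\<in>S.
           ((\<lambda>h. multilinear_norm n (\<lambda>vs. D n (x + h) vs - D n x vs - D (Suc n) x (h # vs)) / norm h)
              \<longlongrightarrow> 0) (at 0))) \<and>
        (\<forall>n. enat n \<le> k \<longrightarrow> (\<forall>x\<in>S.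
           ((\<lambda>y. multilinear_norm n (\<lambda>vs. D n y vs - D n x vs)) \<longlongrightarrow> 0) (at x))))"


section \<open>Paracompact \<open>C\<^sup>\<ell>\<close> Banach manifolds\<close>

text \<open>
  A chart is a pair of its domain \<open>U\<close> and the map \<open>\<phi>\<close>; the values of \<open>\<phi>\<close> outside \<open>U\<close> are irrelevant.
\<close>

type_synonym ('m, 'x) chart = "'m set \<times> ('m \<Rightarrow> 'x)"

abbreviation chart_dom :: "('m, 'x) chart \<Rightarrow> 'm set" where
  "chart_dom \<kappa> \<equiv> fst \<kappa>"

abbreviation chart_map :: "('m, 'x) chart \<Rightarrow> 'm \<Rightarrow> 'x" where
  "chart_map \<kappa> \<equiv> snd \<kappa>"

abbreviation chart_inv :: "('m, 'x) chart \<Rightarrow> 'x \<Rightarrow> 'm" where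
  "chart_inv \<kappa> \<equiv> inv_into (chart_dom \<kappa>) (chart_map \<kappa>)"

definition is_chart :: "('m::topological_space, 'x::real_normed_vector) chart \<Rightarrow> bool" where
  "is_chart \<kappa> \<longleftrightarrow>
     open (chart_dom \<kappa>) \<and> open (chart_map \<kappa> ` chart_dom \<kappa>) \<and>
     homeomorphism (chart_dom \<kappa>) (chart_map \<kappa> ` chart_dom \<kappa>) (chart_map \<kappa>) (chart_inv \<kappa>)"

definition compatible_charts ::
    "enat \<Rightarrow> ('m, 'x::real_normed_vector) chart \<Rightarrow> ('m, 'x) chart \<Rightarrow> bool" where
  "compatible_charts l \<kappa> \<kappa>' \<longleftrightarrow>
     Ck_on l (chart_map \<kappa> ` (chart_dom \<kappa> \<inter> chart_dom \<kappa>')) (chart_map \<kappa>' \<circ> chart_inv \<kappa>) \<and>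
     Ck_on l (chart_map \<kappa>' ` (chart_dom \<kappa> \<inter> chart_dom \<kappa>')) (chart_map \<kappa> \<circ> chart_inv \<kappa>')"

text \<open>The type class \<open>t2_space\<close> supplies the Hausdorff part of paracompactness.\<close>

definition paracompact_type :: "'m::t2_space itself \<Rightarrow> bool" where
  "paracompact_type _ \<longleftrightarrow>
     (\<forall>\<C> :: 'm set set. (\<forall>U\<in>\<C>. open U) \<and> \<Union>\<C> = UNIV \<longrightarrow>
        (\<exists>\<D>. (\<forall>V\<in>\<D>. open V \<and> (\<exists>U\<in>\<C>. V \<subseteq> U)) \<and> \<Union>\<D> = UNIV \<and> locally_finite_in euclidean \<D>))"

text \<open>The differentiable structure is given by its maximal atlas \<open>A\<close>.\<close>

definition banach_manifold :: "enat \<Rightarrow> ('m::t2_space, 'x::banach) chart set \<Rightarrow> bool" where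
  "banach_manifold l A \<longleftrightarrow>
     paracompact_type TYPE('m) \<and>
     (\<forall>\<kappa>\<in>A. is_chart \<kappa>) \<and>
     (\<Union>\<kappa>\<in>A. chart_dom \<kappa>) = UNIV \<and>
     (\<forall>\<kappa>\<in>A. \<forall>\<kappa>'\<in>A. compatible_charts l \<kappa> \<kappa>') \<and>
     (\<forall>\<kappa>. is_chart \<kappa> \<and> (\<forall>\<kappa>'\<in>A. compatible_charts l \<kappa> \<kappa>') \<longrightarrow> \<kappa> \<in> A)"

definition Ck_map :: "('m, 'x::banach) chart set \<Rightarrow> enat \<Rightarrow> ('m \<Rightarrow> real) \<Rightarrow> bool" where
  "Ck_map A k g \<longleftrightarrow> (\<forall>\<kappa>\<in>A. Ck_on k (chart_map \<kappa> ` chart_dom \<kappa>) (g \<circ> chart_inv \<kappa>))"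


section \<open>The tangent bundle\<close>

text \<open>
  A tangent vector at \<open>x\<close> is an equivalence class of pairs \<open>(\<kappa>, v)\<close> of a chart \<open>\<kappa>\<close> around \<open>x\<close> and a
  vector \<open>v\<close> of the model space, under \<open>(\<kappa>, v) \<sim> (\<kappa>', D (\<kappa>' \<circ> \<kappa>\<^sup>-\<^sup>1) (\<kappa> x) v)\<close>.
\<close>

type_synonym ('m, 'x) tangent_vector = "(('m, 'x) chart \<times> 'x) set"

text \<open>
  \<open>tangent_vec A x \<kappa> v\<close> is the class of \<open>(\<kappa>, v)\<close>, that is \<open>d\<kappa>\<^sup>-\<^sup>1 (\<kappa> x) (v)\<close>.
\<close>

definition tangent_vec ::
    "('m, 'x::banach) chart set \<Rightarrow> 'm \<Rightarrow> ('m, 'x) chart \<Rightarrow> 'x \<Rightarrow> ('m, 'x) tangent_vector" where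
  "tangent_vec A x \<kappa> v =
     {(\<kappa>', w). \<kappa>' \<in> A \<and> x \<in> chart_dom \<kappa>' \<and>
        w = frechet_derivative (chart_map \<kappa>' \<circ> chart_inv \<kappa>) (at (chart_map \<kappa> x)) v}"

definition tangent_space ::
    "('m, 'x::banach) chart set \<Rightarrow> 'm \<Rightarrow> ('m, 'x) tangent_vector set" where
  "tangent_space A x = {tangent_vec A x \<kappa> v | \<kappa> v. \<kappa> \<in> A \<and> x \<in> chart_dom \<kappa>}"

definition tangent_zero :: "('m, 'x::banach) chart set \<Rightarrow> 'm \<Rightarrow> ('m, 'x) tangent_vector" where
  "tangent_zero A x = {(\<kappa>, 0) | \<kappa>. \<kappa> \<in> A \<and> x \<in> chart_dom \<kappa>}"

definition tangent_add ::
    "('m, 'x::banach) tangent_vector \<Rightarrow> ('m, 'x) tangent_vector \<Rightarrow> ('m, 'x) tangent_vector" where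
  "tangent_add \<tau> \<sigma> = {(\<kappa>, v + w) | \<kappa> v w. (\<kappa>, v) \<in> \<tau> \<and> (\<kappa>, w) \<in> \<sigma>}"

definition tangent_scale ::
    "real \<Rightarrow> ('m, 'x::banach) tangent_vector \<Rightarrow> ('m, 'x) tangent_vector" where
  "tangent_scale a \<tau> = {(\<kappa>, a *\<^sub>R v) | \<kappa> v. (\<kappa>, v) \<in> \<tau>}"

text \<open>\<open>chart_diff \<kappa> \<tau>\<close> is \<open>d\<kappa> (x) (\<tau>)\<close> for \<open>\<tau>\<close> tangent at \<open>x\<close>.\<close>

definition chart_diff :: "('m, 'x::banach) chart \<Rightarrow> ('m, 'x) tangent_vector \<Rightarrow> 'x" where
  "chart_diff \<kappa> \<tau> = (THE v. (\<kappa>, v) \<in> \<tau>)"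

text \<open>
  The bundle charts \<open>(x, \<tau>) \<mapsto> (\<kappa> x, d\<kappa> (x) (\<tau>))\<close> are to be homeomorphisms onto the open sets
  \<open>\<kappa>(U) \<times> X\<close>. A tangent vector carries no base point, so elements of the bundle are pairs.
\<close>

definition tangent_bundle ::
    "('m, 'x::banach) chart set \<Rightarrow> ('m \<times> ('m, 'x) tangent_vector) topology" where
  "tangent_bundle A = topology_generated_by
     {(\<lambda>(y, v). (chart_inv \<kappa> y, tangent_vec A (chart_inv \<kappa> y) \<kappa> v)) ` W | \<kappa> W.
        \<kappa> \<in> A \<and> open W \<and> W \<subseteq> (chart_map \<kappa> ` chart_dom \<kappa>) \<times> UNIV}"

text \<open>
  The differential \<open>dg(p) : T\<^sub>pM \<rightarrow> \<real>\<close>; the value does not depend on the representative of \<open>\<tau>\<close>.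
\<close>

definition differential ::
    "('m \<Rightarrow> real) \<Rightarrow> 'm \<Rightarrow> ('m, 'x::banach) tangent_vector \<Rightarrow> real" where
  "differential g p \<tau> =
     (THE r. \<forall>(\<kappa>, v)\<in>\<tau>. r = frechet_derivative (g \<circ> chart_inv \<kappa>) (at (chart_map \<kappa> p)) v)"


section \<open>Finsler manifolds in the sense of Neeb-Upmeier\<close>

text \<open>\<open>N x \<tau>\<close> stands for the value at \<open>\<tau> \<in> T\<^sub>xM\<close> of the given map on the tangent bundle.\<close>

type_synonym ('m, 'x) finsler_structure = "'m \<Rightarrow> ('m, 'x) tangent_vector \<Rightarrow> real"

definition norm_on_tangent_space ::
    "('m, 'x::banach) chart set \<Rightarrow> ('m, 'x) finsler_structure \<Rightarrow> 'm \<Rightarrow> bool" where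
  "norm_on_tangent_space A N x \<longleftrightarrow>
     (\<forall>\<tau>\<in>tangent_space A x. 0 \<le> N x \<tau> \<and> (N x \<tau> = 0 \<longleftrightarrow> \<tau> = tangent_zero A x)) \<and>
     (\<forall>\<tau>\<in>tangent_space A x. \<forall>a. N x (tangent_scale a \<tau>) = \<bar>a\<bar> * N x \<tau>) \<and>
     (\<forall>\<tau>\<in>tangent_space A x. \<forall>\<sigma>\<in>tangent_space A x. N x (tangent_add \<tau> \<sigma>) \<le> N x \<tau> + N x \<sigma>)"

definition equivalent_to_norm :: "('x::real_normed_vector \<Rightarrow> real) \<Rightarrow> bool" where
  "equivalent_to_norm p \<longleftrightarrow> (\<exists>c>0. \<exists>C>0. \<forall>v. c * norm v \<le> p v \<and> p v \<le> C * norm v)"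

definition finsler_P1 ::
    "('m, 'x::banach) chart set \<Rightarrow> ('m, 'x) finsler_structure \<Rightarrow> bool" where
  "finsler_P1 A N \<longleftrightarrow>
     (\<forall>x. norm_on_tangent_space A N x \<and>
        (\<forall>\<kappa>\<in>A. x \<in> chart_dom \<kappa> \<longrightarrow> equivalent_to_norm (\<lambda>v. N x (tangent_vec A x \<kappa> v))))"

definition finsler_NU1 ::
    "('m, 'x::banach) chart set \<Rightarrow> ('m, 'x) finsler_structure \<Rightarrow> bool" where
  "finsler_NU1 A N \<longleftrightarrow>
     (\<forall>x0. \<exists>\<kappa>\<in>A. x0 \<in> chart_dom \<kappa> \<and>
        (\<exists>K\<ge>1. \<forall>x\<in>chart_dom \<kappa>. \<forall>\<tau>\<in>tangent_space A x.
           1 / K * N x \<tau> \<le> norm (chart_diff \<kappa> \<tau>) \<and> norm (chart_diff \<kappa> \<tau>) \<le> K * N x \<tau>))"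

definition NU_finsler_manifold ::
    "enat \<Rightarrow> ('m::t2_space, 'x::banach) chart set \<Rightarrow> ('m, 'x) finsler_structure \<Rightarrow> bool" where
  "NU_finsler_manifold l A N \<longleftrightarrow>
     banach_manifold l A \<and>
     continuous_map (tangent_bundle A) euclideanreal (\<lambda>(x, \<tau>). N x \<tau>) \<and>
     finsler_P1 A N \<and> finsler_NU1 A N"


section \<open>The Finsler metric\<close>

text \<open>
  Continuously differentiable curves on an interval \<open>I\<close>, with one-sided derivatives at endpoints.
\<close>

definition C1_curve_on ::
    "('m::topological_space, 'x::banach) chart set \<Rightarrow> real set \<Rightarrow> (real \<Rightarrow> 'm) \<Rightarrow> bool" where
  "C1_curve_on A I c \<longleftrightarrow>
     continuous_on I c \<and>
     (\<forall>\<kappa>\<in>A. \<exists>D. continuous_on (I \<inter> c -` chart_dom \<kappa>) D \<and>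
        (\<forall>t\<in>I \<inter> c -` chart_dom \<kappa>. ((chart_map \<kappa> \<circ> c) has_vector_derivative D t) (at t within I)))"

definition piecewise_C1_path ::
    "('m::topological_space, 'x::banach) chart set \<Rightarrow> real \<Rightarrow> real \<Rightarrow> (real \<Rightarrow> 'm) \<Rightarrow> bool" where
  "piecewise_C1_path A a b c \<longleftrightarrow>
     a < b \<and> continuous_on {a..b} c \<and>
     (\<exists>n t. t 0 = a \<and> t n = b \<and>
        (\<forall>i<n. t i < t (Suc i) \<and> C1_curve_on A {t i..t (Suc i)} c))"

text \<open>
  The tangent vector \<open>c'(t)\<close>. At the finitely many points of \<open>[a, b]\<close> where a piecewise \<open>C\<^sup>1\<close> path
  has no two-sided derivative this set is arbitrary, which does not affect the integral below.
\<close>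

definition velocity ::
    "('m, 'x::banach) chart set \<Rightarrow> (real \<Rightarrow> 'm) \<Rightarrow> real \<Rightarrow> ('m, 'x) tangent_vector" where
  "velocity A c t =
     {(\<kappa>, v). \<kappa> \<in> A \<and> c t \<in> chart_dom \<kappa> \<and> v = vector_derivative (chart_map \<kappa> \<circ> c) (at t)}"

definition path_length ::
    "('m, 'x::banach) chart set \<Rightarrow> ('m, 'x) finsler_structure \<Rightarrow> real \<Rightarrow> real \<Rightarrow> (real \<Rightarrow> 'm) \<Rightarrow> real"
  where
  "path_length A N a b c = integral {a..b} (\<lambda>t. N (c t) (velocity A c t))"

text \<open>The infimum over the empty set is \<open>\<infinity>\<close>: points in different components are at distance \<open>\<infinity>\<close>.\<close>

definition finsler_dist ::
    "('m::topological_space, 'x::banach) chart set \<Rightarrow> ('m, 'x) finsler_structure \<Rightarrow> 'm \<Rightarrow> 'm \<Rightarrow> ennreal"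
  where
  "finsler_dist A N p q =
     Inf {ennreal (path_length A N a b c) | a b c. piecewise_C1_path A a b c \<and> c a = p \<and> c b = q}"

definition is_Lipschitz_const ::
    "('m::topological_space, 'x::banach) chart set \<Rightarrow> ('m, 'x) finsler_structure \<Rightarrow>
       'm set \<Rightarrow> ('m \<Rightarrow> real) \<Rightarrow> real \<Rightarrow> bool" where
  "is_Lipschitz_const A N G f L \<longleftrightarrow>
     0 \<le> L \<and>
     (\<forall>p\<in>G. \<forall>q\<in>G. finsler_dist A N p q < \<infinity> \<longrightarrow> \<bar>f p - f q\<bar> \<le> L * enn2real (finsler_dist A N p q))"

definition Lipschitz_map ::
    "('m::topological_space, 'x::banach) chart set \<Rightarrow> ('m, 'x) finsler_structure \<Rightarrow>
       'm set \<Rightarrow> ('m \<Rightarrow> real) \<Rightarrow> bool" where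
  "Lipschitz_map A N G f \<longleftrightarrow> (\<exists>L. is_Lipschitz_const A N G f L)"

definition Lip ::
    "('m::topological_space, 'x::banach) chart set \<Rightarrow> ('m, 'x) finsler_structure \<Rightarrow>
       'm set \<Rightarrow> ('m \<Rightarrow> real) \<Rightarrow> real" where
  "Lip A N G f = (LEAST L. is_Lipschitz_const A N G f L)"

definition differential_norm ::
    "('m, 'x::banach) chart set \<Rightarrow> ('m, 'x) finsler_structure \<Rightarrow> ('m \<Rightarrow> real) \<Rightarrow> 'm \<Rightarrow> real" where
  "differential_norm A N g p =
     Sup {\<bar>differential g p \<tau>\<bar> | \<tau>. \<tau> \<in> tangent_space A p \<and> N p \<tau> \<le> 1}"


section \<open>Uniform bumpability\<close>

definition uniformly_bumpable ::
    "('m::topological_space, 'x::banach) chart set \<Rightarrow> ('m, 'x) finsler_structure \<Rightarrow> enat \<Rightarrow> bool" where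
  "uniformly_bumpable A N k \<longleftrightarrow>
     (\<exists>R>1. \<exists>r>0. \<forall>p. \<forall>\<delta>. 0 < \<delta> \<and> \<delta> < r \<longrightarrow>
        (\<exists>b. Ck_map A k b \<and> range b \<subseteq> {0..1} \<and> b p = 1 \<and>
             (\<forall>q. ennreal \<delta> \<le> finsler_dist A N p q \<longrightarrow> b q = 0) \<and>
             (\<forall>q. differential_norm A N b q \<le> R / \<delta>)))"

end

theory Submission
  imports Defs
begin

text \<open>
  Approximation from bumps: extend \<open>f\<close> to an \<open>L\<close>-Lipschitz function \<open>F\<close> on \<open>M\<close> and cut its range into
  layers of height \<open>H\<close>. It suffices to have, for every \<open>j\<close>, a smooth function with values in \<open>[0, 1]\<close>
  that vanishes on \<open>{F \<le> j H}\<close>, is \<open>1\<close> on \<open>{F \<ge> (j + 1) H}\<close> and has slope \<open>O(L / H)\<close>: the sum of these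
  functions, multiplied by \<open>H\<close>, is within \<open>H\<close> of \<open>F\<close>, and near each point at most two of them are not
  constant. The two sets have distance at least \<open>H / L\<close>, so bumps \<open>b\<^sub>n\<close> of radius \<open>H / (2 L)\<close> centred at a dense
  sequence separate them. A plain supremum of bumps is not smooth, a partition of unity built from them has no
  uniform slope bound; but a smooth maximum keeps the slope of its arguments. If \<open>s\<^sub>n\<close> is the smooth
  maximum of the first \<open>n\<close> bumps and \<open>\<tau>\<close> a smooth step, the functions \<open>b\<^sub>n (1 - \<tau>(s\<^sub>n))\<close> have the same
  slope up to a constant, their supremum is bounded below, and they are locally finite because \<open>\<tau>(s\<^sub>n)\<close>
  eventually is \<open>1\<close>. The smooth maximum of those whose centre is far from \<open>{F \<le> j H}\<close> does the job after
  a final truncation.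

  Bumps from approximation: truncate a smooth approximation of \<open>max 0 (\<delta> - d(p, \<cdot>))\<close>.
\<close>

section \<open>A smooth step and a smooth ramp\<close>

text \<open>The obstacle is that the constant must not depend on \<epsilon>. The layer height
  \<open>H\<close> enters the slope twice and cancels: a layer function has slope
  \<open>O(1 / \<delta>)\<close> with \<open>\<delta> = H / (2 * L)\<close>, and the sum is scaled
  by \<open>H\<close>. What remains, \<open>32 * K * (1 + 4 * K) * R * L\<close>, consists of
  \<open>R\<close> from the bumps, \<open>1 + 4 * K\<close> from cutting them off by a smooth step
  of slope at most \<open>K\<close>, \<open>8 * K\<close> from the final truncation, 2 for the two
  active layers and 2 for the radius. Taking \<open>H\<close> at most \<open>L * r\<close> keeps the
  radius admissible. The losses of the smooth maximum fit the thresholds: every point is so close to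
  some centre that its bump exceeds 3/4, so the maximum eventually exceeds 5/8 and the cutoff is
  complete. Where the maximum first passes 1/4, the newest bump exceeds 1/4 and is still uncut, so
  the second maximum is at least 1/8, which the truncation raises to 1. Separability puts the
  centres into a sequence, so that every stage is a finite maximum.\<close>

fun times_diff :: "nat \<Rightarrow> (real \<Rightarrow> real) \<Rightarrow> bool" where
  "times_diff 0 f = True"
| "times_diff (Suc n) f = (\<exists>f'. (\<forall>t. (f has_real_derivative f' t) (at t)) \<and> times_diff n f')"

definition smooth_real :: "(real \<Rightarrow> real) \<Rightarrow> bool" where
  "smooth_real f \<longleftrightarrow> (\<forall>n. times_diff n f)"

lemma times_diff_SucD: "times_diff (Suc n) f \<Longrightarrow> times_diff n f"
  by (induction n arbitrary: f) (simp, metis times_diff.simps(2))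

lemma times_diff_const: "times_diff n (\<lambda>_. c)"
proof (induction n arbitrary: c)
  case (Suc n)
  have "\<forall>t. ((\<lambda>_. c) has_real_derivative 0) (at t)" by simp
  then show ?case using Suc[of 0] by (auto intro!: exI[of _ "\<lambda>_. 0"])
qed simp

lemma times_diff_add: "times_diff n f \<Longrightarrow> times_diff n g \<Longrightarrow> times_diff n (\<lambda>t. f t + g t)"
proof (induction n arbitrary: f g)
  case (Suc n)
  then obtain f' g' where
    "\<forall>t. (f has_real_derivative f' t) (at t)" "times_diff n f'"
    "\<forall>t. (g has_real_derivative g' t) (at t)" "times_diff n g'" by auto
  then show ?case using Suc.IH[of f' g']
    by (auto intro!: exI[of _ "\<lambda>t. f' t + g' t"] derivative_intros)
qed simp

lemma times_diff_mult: "times_diff n f \<Longrightarrow> times_diff n g \<Longrightarrow> times_diff n (\<lambda>t. f t * g t)"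
proof (induction n arbitrary: f g)
  case (Suc n)
  then obtain f' g' where d:
    "\<forall>t. (f has_real_derivative f' t) (at t)" "times_diff n f'"
    "\<forall>t. (g has_real_derivative g' t) (at t)" "times_diff n g'" by auto
  have "times_diff n (\<lambda>t. f' t * g t + f t * g' t)"
    using Suc d times_diff_SucD by (intro times_diff_add Suc.IH) blast+
  moreover have "\<forall>t. ((\<lambda>t. f t * g t) has_real_derivative (f' t * g t + f t * g' t)) (at t)"
    using d by (auto intro!: derivative_eq_intros)
  ultimately show ?case by auto
qed simp

lemma times_diff_inverse:
  "times_diff n g \<Longrightarrow> (\<And>t. g t \<noteq> 0) \<Longrightarrow> times_diff n (\<lambda>t. inverse (g t))"
proof (induction n)
  case (Suc n)
  then obtain g' where d: "\<forall>t. (g has_real_derivative g' t) (at t)" "times_diff n g'" by auto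
  have i: "times_diff n (\<lambda>t. inverse (g t))" using Suc times_diff_SucD by blast
  have "times_diff n (\<lambda>t. (-1) * (g' t * (inverse (g t) * inverse (g t))))"
    by (intro times_diff_mult d i times_diff_const)
  moreover have "((\<lambda>t. inverse (g t)) has_real_derivative (-1) * (g' t * (inverse (g t) * inverse (g t)))) (at t)" for t
    using DERIV_inverse'[of g "g' t" t] d Suc.prems(2) by (simp add: algebra_simps)
  ultimately show ?case
    by (auto simp only: times_diff.simps intro!: exI[of _ "\<lambda>t. (-1) * (g' t * (inverse (g t) * inverse (g t)))"])
qed simp

lemma times_diff_affine: "times_diff n f \<Longrightarrow> times_diff n (\<lambda>t. f (a * t + b))"
proof (induction n arbitrary: f)
  case (Suc n)
  then obtain f' where d: "\<And>t. (f has_real_derivative f' t) (at t)" "times_diff n f'" by auto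
  have "times_diff n (\<lambda>t. f' (a * t + b) * a)"
    by (rule times_diff_mult[OF Suc.IH[OF d(2)] times_diff_const])
  moreover have "((\<lambda>t. f (a * t + b)) has_real_derivative f' (a * t + b) * a) (at t)" for t
    by (rule DERIV_chain'[OF _ d(1)]) (auto intro!: derivative_eq_intros)
  ultimately show ?case
    by (auto simp only: times_diff.simps intro!: exI[of _ "\<lambda>t. f' (a * t + b) * a"])
qed simp

lemma smooth_real_affine: "smooth_real f \<Longrightarrow> smooth_real (\<lambda>t. f (a * t + b))"
  unfolding smooth_real_def using times_diff_affine by blast

lemma smooth_real_deriv:
  assumes "smooth_real f" and "\<And>t. (f has_real_derivative f' t) (at t)"
  shows "smooth_real f'"
proof -
  have "times_diff n f'" for n
  proof -
    obtain g where g: "\<forall>t. (f has_real_derivative g t) (at t)" "times_diff n g"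
      using assms(1) times_diff.simps(2) unfolding smooth_real_def by blast
    have "g = f'" using g(1) assms(2) DERIV_unique by blast
    then show ?thesis using g by simp
  qed
  then show ?thesis by (simp add: smooth_real_def)
qed

lemma smooth_real_antideriv:
  assumes "smooth_real f'" and "\<And>t. (f has_real_derivative f' t) (at t)"
  shows "smooth_real f"
  unfolding smooth_real_def
proof
  fix n show "times_diff n f"
    using assms by (cases n) (auto simp: smooth_real_def)
qed

text \<open>The functions \<open>exp (- 1 / t) / t ^ n\<close>, extended by 0. Derivatives are
  combinations of members of the same family, which is why the power is a parameter.\<close>

definition exp_flat :: "nat \<Rightarrow> real \<Rightarrow> real" where
  "exp_flat n t = (if t \<le> 0 then 0 else inverse t ^ n * exp (- inverse t))"

text \<open>Only the origin is delicate: from the right the difference quotient is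
  \<open>s ^ Suc n * exp (- s)\<close> with \<open>s = inverse t\<close>, which tends to 0 as
  \<open>s\<close> grows. Both terms of the claimed derivative vanish there.\<close>

lemma exp_flat_deriv:
  "(exp_flat n has_real_derivative (- real n) * exp_flat (Suc n) t + exp_flat (Suc (Suc n)) t) (at t)"
proof -
  consider "t < 0" | "t > 0" | "t = 0" by linarith
  then show ?thesis
  proof cases
    case 1
    have "((\<lambda>_. 0) has_real_derivative 0) (at t)" by simp
    then have "(exp_flat n has_real_derivative 0) (at t)"
      by (rule has_field_derivative_transform_within_open[of _ _ _ "{..<0}"]) (use 1 in \<open>auto simp: exp_flat_def\<close>)
    then show ?thesis using 1 by (simp add: exp_flat_def)
  next
    case 2
    have "((\<lambda>t. inverse t ^ n * exp (- inverse t)) has_real_derivative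
       (- real n) * exp_flat (Suc n) t + exp_flat (Suc (Suc n)) t) (at t)"
    proof -
      have i: "(inverse has_real_derivative - (inverse t * inverse t)) (at t)"
        using DERIV_inverse[of t] 2 by (simp add: power2_eq_square)
      have e: "((\<lambda>t. exp (- inverse t)) has_real_derivative exp (- inverse t) * (inverse t * inverse t)) (at t)"
        using DERIV_chain'[OF DERIV_minus[OF i] DERIV_exp] by simp
      have p: "((\<lambda>t. inverse t ^ n) has_real_derivative - real n * inverse t ^ Suc n) (at t)"
        using DERIV_power[OF i, of n] by (cases n) (simp_all add: algebra_simps)
      show ?thesis using DERIV_mult[OF p e] 2 by (simp add: exp_flat_def algebra_simps)
    qed
    then show ?thesis
      by (rule has_field_derivative_transform_within_open[of _ _ _ "{0<..}"]) (use 2 in \<open>auto simp: exp_flat_def\<close>)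
  next
    case 3
    have lim: "((\<lambda>s. s ^ Suc n * exp (- s)) \<longlongrightarrow> (0::real)) at_top"
      using tendsto_power_div_exp_0[of "Suc n"] by (simp add: exp_minus divide_inverse)
    have "((\<lambda>y. (exp_flat n y - exp_flat n 0) / (y - 0)) \<longlongrightarrow> 0) (at 0)"
    proof -
      have "((\<lambda>y. (exp_flat n y - exp_flat n 0) / (y - 0)) \<longlongrightarrow> 0) (at_left 0)"
        by (rule tendsto_eventually) (auto simp: exp_flat_def eventually_at_filter)
      moreover have "((\<lambda>y. inverse y ^ Suc n * exp (- inverse y)) \<longlongrightarrow> (0::real)) (at_right 0)"
        by (rule filterlim_compose[OF lim filterlim_inverse_at_top_right])
      then have "((\<lambda>y. (exp_flat n y - exp_flat n 0) / (y - 0)) \<longlongrightarrow> 0) (at_right 0)"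
        by (rule Lim_transform_eventually)
          (auto simp: exp_flat_def eventually_at_filter divide_inverse intro!: always_eventually)
      ultimately show "((\<lambda>y. (exp_flat n y - exp_flat n 0) / (y - 0)) \<longlongrightarrow> 0) (at 0)"
        by (rule filterlim_split_at)
    qed
    then show ?thesis using 3 by (simp add: has_field_derivative_iff exp_flat_def)
  qed
qed

lemma times_diff_exp_flat: "times_diff m (exp_flat n)"
proof (induction m arbitrary: n)
  case (Suc m)
  have "times_diff m (\<lambda>t. (- real n) * exp_flat (Suc n) t + exp_flat (Suc (Suc n)) t)"
    by (intro times_diff_add times_diff_mult times_diff_const Suc)
  then show ?case using exp_flat_deriv
    by (auto simp only: times_diff.simps intro!: exI[of _ "\<lambda>t. (- real n) * exp_flat (Suc n) t + exp_flat (Suc (Suc n)) t"])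
qed simp

text \<open>The quotient \<open>e t / (e t + e (1 - t))\<close> with \<open>e = exp_flat 0\<close>;
  its denominator is positive because \<open>t\<close> or \<open>1 - t\<close> is. The derivative
  vanishes outside \<open>[0, 1]\<close> and is bounded on that interval by compactness.\<close>

lemma smooth_step_exists:
  obtains st st' :: "real \<Rightarrow> real" and K where
    "smooth_real st" "\<And>t. (st has_real_derivative st' t) (at t)" "\<And>t. \<bar>st' t\<bar> \<le> K"
    "\<And>t. t \<le> 0 \<Longrightarrow> st t = 0" "\<And>t. 1 \<le> t \<Longrightarrow> st t = 1" "\<And>t. 0 \<le> st t" "\<And>t. st t \<le> 1" "1 \<le> K"
proof -
  define e where "e = exp_flat 0"
  define st where "st t = e t * inverse (e t + e (1 - t))" for t
  have epos: "e t \<ge> 0" "t > 0 \<Longrightarrow> e t > 0" "t \<le> 0 \<Longrightarrow> e t = 0" for t by (auto simp: e_def exp_flat_def)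
  have nz: "e t + e (1 - t) > 0" for t
    using epos[of t] epos[of "1 - t"] by (cases "t > 0") (auto simp: add_pos_nonneg)
  have ed: "times_diff n e" for n unfolding e_def by (rule times_diff_exp_flat)
  have "times_diff n (\<lambda>t. e (1 - t))" for n
    using times_diff_affine[OF ed, of n "-1" 1] by simp
  then have "times_diff n st" for n unfolding st_def
    using nz[THEN less_imp_neq] by (intro times_diff_mult times_diff_inverse times_diff_add ed) metis+
  then have sm: "smooth_real st" by (simp add: smooth_real_def)
  then have "times_diff (Suc (Suc 0)) st" unfolding smooth_real_def by blast
  then obtain st' where d: "\<And>t. (st has_real_derivative st' t) (at t)" and c': "times_diff (Suc 0) st'"
    unfolding times_diff.simps by metis
  have "isCont st' t" for t using c' DERIV_isCont by auto
  then have "compact (st' ` {0..1})"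
    by (intro compact_continuous_image continuous_at_imp_continuous_on) auto
  then obtain K where K: "\<And>t. t \<in> {0..1} \<Longrightarrow> \<bar>st' t\<bar> \<le> K"
    using compact_imp_bounded bounded_iff by (metis image_eqI real_norm_def)
  have z: "st t = 0" if "t \<le> 0" for t using that epos by (simp add: st_def)
  have o: "st t = 1" if "1 \<le> t" for t
    using that epos(3)[of "1-t"] epos(2)[of t] by (simp add: st_def)
  have out: "st' t = 0" if "t < 0 \<or> t > 1" for t
    using that
  proof
    assume "t < 0"
    have "((\<lambda>_. 0) has_real_derivative 0) (at t)" by simp
    then have "(st has_real_derivative 0) (at t)"
      by (rule has_field_derivative_transform_within_open[of _ _ _ "{..<0}"]) (use \<open>t < 0\<close> z in auto)
    then show ?thesis using d DERIV_unique by blast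
  next
    assume "t > 1"
    have "((\<lambda>_. 1) has_real_derivative 0) (at t)" by simp
    then have "(st has_real_derivative 0) (at t)"
      by (rule has_field_derivative_transform_within_open[of _ _ _ "{1<..}"]) (use \<open>t > 1\<close> o in auto)
    then show ?thesis using d DERIV_unique by blast
  qed
  have b: "0 \<le> st t" "st t \<le> 1" for t
    using epos(1)[of t] epos(1)[of "1 - t"] nz[of t] by (auto simp: st_def field_simps)
  \<comment> \<open>A bound of at least 1 guarantees later that the constants built from it are at
    least 1.\<close>
  have "\<bar>st' t\<bar> \<le> max K 1" for t
    using K[of t] out[of t] by (cases "t < 0 \<or> t > 1") auto
  then show ?thesis using that[OF sm d _ z o b, of "max K 1"] by simp
qed

text \<open>The primitive of a step compressed to \<open>[0, 1/8]\<close>. Its slope is a value of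
  the step, hence in \<open>[0, 1]\<close>, and equals 1 from 1/8 on, so the ramp never falls more
  than 1/8 behind the identity.\<close>

lemma smooth_ramp_exists:
  obtains \<sigma> \<sigma>' :: "real \<Rightarrow> real" where
    "smooth_real \<sigma>" "\<And>t. (\<sigma> has_real_derivative \<sigma>' t) (at t)" "\<And>t. 0 \<le> \<sigma>' t" "\<And>t. \<sigma>' t \<le> 1"
    "\<And>t. t \<le> 0 \<Longrightarrow> \<sigma> t = 0" "\<And>t. t - 1 / 8 \<le> \<sigma> t" "\<And>t. 0 \<le> \<sigma> t" "\<And>t. \<sigma> t \<le> max t 0"
proof -
  obtain st st' :: "real \<Rightarrow> real" and K where st:
    "smooth_real st" "\<And>t. (st has_real_derivative st' t) (at t)"
    "\<And>t. t \<le> 0 \<Longrightarrow> st t = 0" "\<And>t. 1 \<le> t \<Longrightarrow> st t = 1" "\<And>t. 0 \<le> st t" "\<And>t. st t \<le> 1"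
    using smooth_step_exists by metis
  define s where "s t = st (8 * t + 0)" for t
  have sm: "smooth_real s" unfolding s_def[abs_def] by (rule smooth_real_affine[OF st(1)])
  have cont: "continuous_on T s" for T
  proof -
    have "continuous_on UNIV st" using DERIV_isCont[OF st(2)] by (simp add: continuous_at_imp_continuous_on)
    then show ?thesis unfolding s_def by (rule continuous_on_compose2) (auto intro!: continuous_intros)
  qed
  \<comment> \<open>Starting at -1 makes 0 an interior point, where the derivative is two-sided;
    negative arguments contribute nothing to the integral.\<close>
  define \<sigma> where "\<sigma> t = integral {-1..t} s" for t
  have z: "\<sigma> t = 0" if "t \<le> 0" for t
  proof -
    have "integral {-1..t} s = integral {-1..t} (\<lambda>_. 0)"
      by (rule integral_cong) (use that st(3) in \<open>auto simp: s_def\<close>)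
    then show ?thesis by (simp add: \<sigma>_def)
  qed
  have d: "(\<sigma> has_real_derivative s t) (at t)" for t
  proof (cases "t < 0")
    case True
    have "((\<lambda>_. 0) has_real_derivative 0) (at t)" by simp
    then have "(\<sigma> has_real_derivative 0) (at t)"
      by (rule has_field_derivative_transform_within_open[of _ _ _ "{..<0}"]) (use True z in auto)
    then show ?thesis using True st(3) by (simp add: s_def)
  next
    case False
    have "((\<lambda>u. integral {-1..u} s) has_real_derivative s t) (at t within {-1..t+1})"
      by (rule integral_has_real_derivative[OF cont]) (use False in auto)
    then show ?thesis using False by (simp add: \<sigma>_def[abs_def] at_within_Icc_at)
  qed
  have b: "0 \<le> s t" "s t \<le> 1" for t using st by (auto simp: s_def)
  have p: "0 \<le> \<sigma> t" for t unfolding \<sigma>_def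
    by (rule integral_nonneg[OF integrable_continuous_real[OF cont]]) (use b in auto)
  have m: "\<sigma> t \<le> max t 0" for t
  proof (cases "t \<le> 0")
    case False
    have "t - \<sigma> t \<ge> 0 - \<sigma> 0"
      by (rule DERIV_nonneg_imp_nondecreasing[of 0 t "\<lambda>t. t - \<sigma> t"])
        (use False d b in \<open>auto intro!: exI derivative_eq_intros\<close>)
    then show ?thesis using z[of 0] by simp
  qed (simp add: z)
  have g: "t - 1/8 \<le> \<sigma> t" for t
  proof (cases "t \<le> 1/8")
    case True then show ?thesis using p[of t] by linarith
  next
    case False
    have "\<sigma> t - t \<ge> \<sigma> (1/8) - 1/8"
    proof (rule DERIV_nonneg_imp_nondecreasing[of "1/8" t "\<lambda>t. \<sigma> t - t"])
      fix x :: real assume "1/8 \<le> x"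
      then have "s x = 1" by (simp add: s_def st(4))
      then have "((\<lambda>t. \<sigma> t - t) has_real_derivative 0) (at x)"
        using d[of x] by (auto intro!: derivative_eq_intros)
      then show "\<exists>y. ((\<lambda>t. \<sigma> t - t) has_real_derivative y) (at x) \<and> 0 \<le> y" by blast
    qed (use False in auto)
    then show ?thesis using p[of "1/8"] by linarith
  qed
  show ?thesis
    by (rule that[of \<sigma> s, OF smooth_real_antideriv[OF sm d] d b z g p m])
qed

section \<open>Calculus of \<open>C\<^sup>k\<close> maps\<close>

text \<open>
  \<open>unif_Ck j S I w F\<close> says that \<open>F\<close> is of class \<open>C\<^sup>j\<close> as a map from \<open>S\<close> to the bounded functions on \<open>I\<close>
  with weight \<open>w\<close>. The derivative is a map of the same kind: its value in direction \<open>h\<close> at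
  the index \<open>i\<close> is stored at the index \<open>h # i\<close> with weight \<open>norm h * w i\<close>. So derivatives of all orders have
  the same type, and products and reindexings can be treated by induction on \<open>j\<close>.
\<close>

definition cons_set :: "'a list set \<Rightarrow> 'a list set" where
  "cons_set I = {h # i | h i. i \<in> I}"

definition cons_weight :: "('a::real_normed_vector list \<Rightarrow> real) \<Rightarrow> 'a list \<Rightarrow> real" where
  "cons_weight w l = norm (hd l) * w (tl l)"

definition unif_cont_at ::
    "'a list set \<Rightarrow> ('a list \<Rightarrow> real) \<Rightarrow> ('a::real_normed_vector \<Rightarrow> 'a list \<Rightarrow> 'b::real_normed_vector) \<Rightarrow> 'a \<Rightarrow> bool"
  where
  "unif_cont_at I w F x \<longleftrightarrow>
     (\<exists>K\<ge>0. \<forall>i\<in>I. norm (F x i) \<le> K * w i) \<and>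
     (\<forall>e>0. \<forall>\<^sub>F y in nhds x. \<forall>i\<in>I. norm (F y i - F x i) \<le> e * w i)"

definition unif_deriv_at ::
    "'a list set \<Rightarrow> ('a list \<Rightarrow> real) \<Rightarrow> ('a::real_normed_vector \<Rightarrow> 'a list \<Rightarrow> 'b::real_normed_vector) \<Rightarrow>
      ('a \<Rightarrow> 'a list \<Rightarrow> 'b) \<Rightarrow> 'a \<Rightarrow> bool"
  where
  "unif_deriv_at I w F F' x \<longleftrightarrow>
     (\<forall>i\<in>I. linear (\<lambda>h. F' x (h # i))) \<and>
     (\<forall>e>0. \<forall>\<^sub>F h in nhds 0. \<forall>i\<in>I. norm (F (x + h) i - F x i - F' x (h # i)) \<le> e * (norm h * w i))"

fun unif_Ck ::
    "nat \<Rightarrow> 'a set \<Rightarrow> 'a list set \<Rightarrow> ('a list \<Rightarrow> real) \<Rightarrow>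
      ('a::real_normed_vector \<Rightarrow> 'a list \<Rightarrow> 'b::real_normed_vector) \<Rightarrow> bool"
  where
  "unif_Ck 0 S I w F = (\<forall>x\<in>S. unif_cont_at I w F x)"
| "unif_Ck (Suc j) S I w F =
     ((\<forall>x\<in>S. unif_cont_at I w F x) \<and>
      (\<exists>F'. (\<forall>x\<in>S. unif_deriv_at I w F F' x) \<and> unif_Ck j S (cons_set I) (cons_weight w) F'))"

lemma unif_Ck_cont: "unif_Ck j S I w F \<Longrightarrow> x \<in> S \<Longrightarrow> unif_cont_at I w F x"
  by (cases j) auto

lemma unif_Ck_SucD: "unif_Ck (Suc j) S I w F \<Longrightarrow> unif_Ck j S I w F"
proof (induction j arbitrary: I w F)
  case (Suc j)
  then obtain F' where "\<forall>x\<in>S. unif_deriv_at I w F F' x" "unif_Ck (Suc j) S (cons_set I) (cons_weight w) F'"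
    by (metis unif_Ck.simps(2))
  with Suc show ?case by (metis unif_Ck.simps(2))
qed simp

lemma unif_Ck_subset: "unif_Ck j S I w F \<Longrightarrow> T \<subseteq> S \<Longrightarrow> unif_Ck j T I w F"
proof (induction j arbitrary: I w F)
  case (Suc j)
  then obtain F' where "\<forall>x\<in>S. unif_deriv_at I w F F' x" "unif_Ck j S (cons_set I) (cons_weight w) F'"
    by (metis unif_Ck.simps(2))
  with Suc show ?case by (auto intro!: exI[of _ F'])
qed auto

lemma eventually_nhds_shift:
  fixes x :: "'a::real_normed_vector"
  assumes "\<forall>\<^sub>F y in nhds x. P y"
  shows "\<forall>\<^sub>F h in nhds 0. P (x + h)"
  using assms unfolding eventually_nhds_metric by (metis add_diff_cancel_left' diff_zero dist_norm)

lemma unif_cont_at_cong: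
  assumes "unif_cont_at I w F x" "open S" "x \<in> S" "\<And>x i. x \<in> S \<Longrightarrow> i \<in> I \<Longrightarrow> F x i = G x i"
    "\<And>i. i \<in> I \<Longrightarrow> w i = v i"
  shows "unif_cont_at I v G x"
  unfolding unif_cont_at_def
proof (intro conjI allI impI)
  show "\<exists>K\<ge>0. \<forall>i\<in>I. norm (G x i) \<le> K * v i"
    using assms unfolding unif_cont_at_def by auto
  fix e :: real assume "e > 0"
  then have "\<forall>\<^sub>F y in nhds x. \<forall>i\<in>I. norm (F y i - F x i) \<le> e * w i"
    using assms(1) unfolding unif_cont_at_def by blast
  moreover have "\<forall>\<^sub>F y in nhds x. y \<in> S" using assms(2,3) by (rule eventually_nhds_in_open)
  ultimately show "\<forall>\<^sub>F y in nhds x. \<forall>i\<in>I. norm (G y i - G x i) \<le> e * v i"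
    by eventually_elim (use assms in auto)
qed

lemma unif_deriv_at_cong:
  assumes "unif_deriv_at I w F F' x" "open S" "x \<in> S" "\<And>x i. x \<in> S \<Longrightarrow> i \<in> I \<Longrightarrow> F x i = G x i"
    "\<And>i. i \<in> I \<Longrightarrow> w i = v i" "\<And>h i. i \<in> I \<Longrightarrow> F' x (h # i) = G' x (h # i)"
  shows "unif_deriv_at I v G G' x"
  unfolding unif_deriv_at_def
proof (intro conjI allI impI ballI)
  show "linear (\<lambda>h. G' x (h # i))" if "i \<in> I" for i
    using assms that unfolding unif_deriv_at_def by auto
  fix e :: real assume "e > 0"
  then have "\<forall>\<^sub>F h in nhds 0. \<forall>i\<in>I. norm (F (x + h) i - F x i - F' x (h # i)) \<le> e * (norm h * w i)"
    using assms(1) unfolding unif_deriv_at_def by blast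
  moreover have "\<forall>\<^sub>F h in nhds 0. x + h \<in> S"
    by (rule eventually_nhds_shift[OF eventually_nhds_in_open[OF assms(2,3)]])
  ultimately show "\<forall>\<^sub>F h in nhds 0. \<forall>i\<in>I. norm (G (x + h) i - G x i - G' x (h # i)) \<le> e * (norm h * v i)"
    by eventually_elim (use assms in auto)
qed

lemma unif_Ck_cong:
  assumes "unif_Ck j S I w F" "open S" "\<And>x i. x \<in> S \<Longrightarrow> i \<in> I \<Longrightarrow> F x i = G x i"
    "\<And>i. i \<in> I \<Longrightarrow> w i = v i"
  shows "unif_Ck j S I v G"
  using assms
proof (induction j arbitrary: I w v F G)
  case 0
  then show ?case using unif_cont_at_cong[of I w F _ S G v] by simp
next
  case (Suc j)
  then obtain F' where d: "\<forall>x\<in>S. unif_deriv_at I w F F' x" and F': "unif_Ck j S (cons_set I) (cons_weight w) F'"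
    by (metis unif_Ck.simps(2))
  have "unif_Ck j S (cons_set I) (cons_weight v) F'"
    by (rule Suc.IH[OF F' Suc.prems(2)]) (auto simp: cons_set_def cons_weight_def Suc.prems(4))
  moreover have "unif_deriv_at I v G F' x" if "x \<in> S" for x
    using unif_deriv_at_cong[OF d[rule_format, OF that] Suc.prems(2) that] Suc.prems by blast
  moreover have "unif_cont_at I v G x" if "x \<in> S" for x
    using unif_cont_at_cong[OF unif_Ck_cont[OF Suc.prems(1) that] Suc.prems(2) that] Suc.prems by blast
  ultimately show ?case by auto
qed

text \<open>Pullback along a map of indices; the derivative keeps the direction at the head of the
  list and pulls back the tail. It serves to move an undifferentiated factor to the index set of a
  derivative, and to fix a direction.\<close>

lemma unif_Ck_reindex:
  assumes "unif_Ck j S I w F" "\<And>i. i \<in> J \<Longrightarrow> \<rho> i \<in> I"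
  shows "unif_Ck j S J (\<lambda>i. w (\<rho> i)) (\<lambda>x i. F x (\<rho> i))"
  using assms
proof (induction j arbitrary: I J w F \<rho>)
  have c: "unif_cont_at J (\<lambda>i. w (\<rho> i)) (\<lambda>x i. F x (\<rho> i)) x"
    if "unif_cont_at I w F x" "\<And>i. i \<in> J \<Longrightarrow> \<rho> i \<in> I" for I J w \<rho> x and F :: "'a \<Rightarrow> 'a list \<Rightarrow> 'b"
    unfolding unif_cont_at_def
  proof (intro conjI allI impI)
    show "\<exists>K\<ge>0. \<forall>i\<in>J. norm (F x (\<rho> i)) \<le> K * w (\<rho> i)"
      using that unfolding unif_cont_at_def by blast
    fix e :: real assume "e > 0"
    then have "\<forall>\<^sub>F y in nhds x. \<forall>i\<in>I. norm (F y i - F x i) \<le> e * w i"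
      using that(1) unfolding unif_cont_at_def by blast
    then show "\<forall>\<^sub>F y in nhds x. \<forall>i\<in>J. norm (F y (\<rho> i) - F x (\<rho> i)) \<le> e * w (\<rho> i)"
      by eventually_elim (use that(2) in blast)
  qed
  {
    case 0 then show ?case using c[of I w F _ J \<rho>] by simp
  next
    case (Suc j)
    then obtain F' where d: "\<forall>x\<in>S. unif_deriv_at I w F F' x" and F': "unif_Ck j S (cons_set I) (cons_weight w) F'"
      by (metis unif_Ck.simps(2))
    have "unif_Ck j S (cons_set J) (\<lambda>l. cons_weight w (hd l # \<rho> (tl l))) (\<lambda>x l. F' x (hd l # \<rho> (tl l)))"
      by (rule Suc.IH[OF F']) (auto simp: cons_set_def Suc.prems)
    moreover have "(\<lambda>l. cons_weight w (hd l # \<rho> (tl l))) = cons_weight (\<lambda>i. w (\<rho> i))"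
      by (auto simp: cons_weight_def)
    moreover have "unif_deriv_at J (\<lambda>i. w (\<rho> i)) (\<lambda>x i. F x (\<rho> i)) (\<lambda>x l. F' x (hd l # \<rho> (tl l))) x" if "x \<in> S" for x
      unfolding unif_deriv_at_def list.sel
    proof (intro conjI allI impI ballI)
      show "linear (\<lambda>h. F' x (h # \<rho> i))" if "i \<in> J" for i
        using d Suc.prems(2)[OF that] \<open>x \<in> S\<close> unfolding unif_deriv_at_def by blast
      fix e :: real assume "e > 0"
      then have "\<forall>\<^sub>F h in nhds 0. \<forall>i\<in>I. norm (F (x + h) i - F x i - F' x (h # i)) \<le> e * (norm h * w i)"
        using d that unfolding unif_deriv_at_def by blast
      then show "\<forall>\<^sub>F h in nhds 0. \<forall>i\<in>J. norm (F (x + h) (\<rho> i) - F x (\<rho> i) - F' x (h # \<rho> i)) \<le> e * (norm h * w (\<rho> i))"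
        by eventually_elim (use Suc.prems(2) in blast)
    qed
    moreover have "unif_cont_at J (\<lambda>i. w (\<rho> i)) (\<lambda>x i. F x (\<rho> i)) x" if "x \<in> S" for x
      using c[OF unif_Ck_cont[OF Suc.prems(1) that]] Suc.prems(2) by blast
    ultimately show ?case by (auto intro!: exI[of _ "\<lambda>x l. F' x (hd l # \<rho> (tl l))"])
  }
qed

lemma unif_Ck_add:
  assumes "unif_Ck j S I w F" "unif_Ck j S I w G"
  shows "unif_Ck j S I w (\<lambda>x i. F x i + G x i)"
  using assms
proof (induction j arbitrary: I w F G)
  have c: "unif_cont_at I w (\<lambda>x i. F x i + G x i) x"
    if FG: "unif_cont_at I w F x" "unif_cont_at I w G x" for I w x and F G :: "'a \<Rightarrow> 'a list \<Rightarrow> 'b"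
    unfolding unif_cont_at_def
  proof (intro conjI allI impI)
    obtain K where "K \<ge> 0" "\<forall>i\<in>I. norm (F x i) \<le> K * w i"
      using FG(1) unfolding unif_cont_at_def by blast
    moreover obtain K' where "K' \<ge> 0" "\<forall>i\<in>I. norm (G x i) \<le> K' * w i"
      using FG(2) unfolding unif_cont_at_def by blast
    ultimately have "norm (F x i + G x i) \<le> (K + K') * w i" if "i \<in> I" for i
      unfolding distrib_right using that by (intro norm_triangle_le add_mono) blast+
    then have "\<forall>i\<in>I. norm (F x i + G x i) \<le> (K + K') * w i" "K + K' \<ge> 0"
      using \<open>K \<ge> 0\<close> \<open>K' \<ge> 0\<close> by auto
    then show "\<exists>K\<ge>0. \<forall>i\<in>I. norm (F x i + G x i) \<le> K * w i" by blast
    fix e :: real assume "e > 0"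
    then have "\<forall>\<^sub>F y in nhds x. \<forall>i\<in>I. norm (F y i - F x i) \<le> e/2 * w i"
      "\<forall>\<^sub>F y in nhds x. \<forall>i\<in>I. norm (G y i - G x i) \<le> e/2 * w i"
      using FG half_gt_zero[OF \<open>e > 0\<close>] unfolding unif_cont_at_def by blast+
    then show "\<forall>\<^sub>F y in nhds x. \<forall>i\<in>I. norm (F y i + G y i - (F x i + G x i)) \<le> e * w i"
    proof eventually_elim
      case (elim y)
      show ?case
      proof
        fix i assume "i \<in> I"
        have "norm ((F y i - F x i) + (G y i - G x i)) \<le> e/2 * w i + e/2 * w i"
          using elim \<open>i \<in> I\<close> by (intro norm_triangle_le add_mono) auto
        then show "norm (F y i + G y i - (F x i + G x i)) \<le> e * w i" by (simp add: algebra_simps)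
      qed
    qed
  qed
  {
    case 0 then show ?case using c by simp
  next
    case (Suc j)
    then obtain F' G' where d: "\<forall>x\<in>S. unif_deriv_at I w F F' x" "unif_Ck j S (cons_set I) (cons_weight w) F'"
      "\<forall>x\<in>S. unif_deriv_at I w G G' x" "unif_Ck j S (cons_set I) (cons_weight w) G'"
      by (metis unif_Ck.simps(2))
    have "unif_deriv_at I w (\<lambda>x i. F x i + G x i) (\<lambda>x i. F' x i + G' x i) x" if "x \<in> S" for x
      unfolding unif_deriv_at_def
    proof (intro conjI allI impI ballI)
      show "linear (\<lambda>h. F' x (h # i) + G' x (h # i))" if "i \<in> I" for i
        using d \<open>x \<in> S\<close> that unfolding unif_deriv_at_def by (intro linear_compose_add) auto
      fix e :: real assume "e > 0"
      then have "\<forall>\<^sub>F h in nhds 0. \<forall>i\<in>I. norm (F (x + h) i - F x i - F' x (h # i)) \<le> e/2 * (norm h * w i)"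
        "\<forall>\<^sub>F h in nhds 0. \<forall>i\<in>I. norm (G (x + h) i - G x i - G' x (h # i)) \<le> e/2 * (norm h * w i)"
        using d(1)[rule_format, OF \<open>x \<in> S\<close>] d(3)[rule_format, OF \<open>x \<in> S\<close>] half_gt_zero[OF \<open>e > 0\<close>]
        unfolding unif_deriv_at_def by meson+
      then show "\<forall>\<^sub>F h in nhds 0. \<forall>i\<in>I. norm (F (x + h) i + G (x + h) i - (F x i + G x i) - (F' x (h # i) + G' x (h # i))) \<le> e * (norm h * w i)"
      proof eventually_elim
        case (elim h)
        show ?case
        proof
          fix i assume "i \<in> I"
          have "norm ((F (x + h) i - F x i - F' x (h # i)) + (G (x + h) i - G x i - G' x (h # i))) \<le> e/2 * (norm h * w i) + e/2 * (norm h * w i)"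
            using elim \<open>i \<in> I\<close> by (intro norm_triangle_le add_mono) auto
          then show "norm (F (x + h) i + G (x + h) i - (F x i + G x i) - (F' x (h # i) + G' x (h # i))) \<le> e * (norm h * w i)"
            by (simp add: algebra_simps)
        qed
      qed
    qed
    moreover have "unif_Ck j S (cons_set I) (cons_weight w) (\<lambda>x i. F' x i + G' x i)"
      using Suc.IH d by blast
    ultimately show ?case using c unif_Ck_cont[OF Suc.prems(1)] unif_Ck_cont[OF Suc.prems(2)]
      unfolding unif_Ck.simps by blast
  }
qed

text \<open>Epsilon bookkeeping; \<open>e' \<le> 1\<close> lets a perturbed factor be bounded with
  \<open>K + 1\<close> in place of \<open>K\<close>.\<close>

lemma small_factor:
  fixes e C :: real
  assumes "0 < e" "1 \<le> C"
  obtains e' where "0 < e'" "e' \<le> 1" "e' * C \<le> e"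
proof
  show "0 < min 1 (e / C)" "min 1 (e / C) \<le> 1" using assms by auto
  have "min 1 (e / C) * C \<le> e / C * C" using assms by (intro mult_right_mono) auto
  then show "min 1 (e / C) * C \<le> e" using assms by simp
qed

lemma unif_cont_at_mult:
  fixes F G :: "'a::real_normed_vector \<Rightarrow> 'a list \<Rightarrow> real"
  assumes F: "unif_cont_at I w F x" and G: "unif_cont_at I v G x"
  shows "unif_cont_at I (\<lambda>i. w i * v i) (\<lambda>x i. F x i * G x i) x"
  unfolding unif_cont_at_def
proof (intro conjI allI impI)
  obtain K where KF: "K \<ge> 0" "\<forall>i\<in>I. \<bar>F x i\<bar> \<le> K * w i"
    using F unfolding unif_cont_at_def by auto
  obtain K' where KG: "K' \<ge> 0" "\<forall>i\<in>I. \<bar>G x i\<bar> \<le> K' * v i"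
    using G unfolding unif_cont_at_def by auto
  note K = KF KG
  have "norm (F x i * G x i) \<le> (K * K') * (w i * v i)" if "i \<in> I" for i
  proof -
    have "\<bar>F x i\<bar> * \<bar>G x i\<bar> \<le> (K * w i) * (K' * v i)"
      using K that by (intro mult_mono') auto
    then show ?thesis by (simp add: abs_mult algebra_simps)
  qed
  then show "\<exists>K\<ge>0. \<forall>i\<in>I. norm (F x i * G x i) \<le> K * (w i * v i)"
    using K by (meson mult_nonneg_nonneg)
  fix e :: real assume "e > 0"
  obtain e' where e': "e' > 0" "e' \<le> 1" "e' * (K + K' + 1) \<le> e"
    using small_factor[OF \<open>e > 0\<close>, of "K + K' + 1"] K by auto
  from F G e'(1) have "\<forall>\<^sub>F y in nhds x. \<forall>i\<in>I. norm (F y i - F x i) \<le> e' * w i"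
    "\<forall>\<^sub>F y in nhds x. \<forall>i\<in>I. norm (G y i - G x i) \<le> e' * v i"
    unfolding unif_cont_at_def by blast+
  then show "\<forall>\<^sub>F y in nhds x. \<forall>i\<in>I. norm (F y i * G y i - F x i * G x i) \<le> e * (w i * v i)"
  proof eventually_elim
    case (elim y)
    show ?case
    proof
      fix i assume i: "i \<in> I"
      have a: "\<bar>F y i - F x i\<bar> \<le> e' * w i" "\<bar>G y i - G x i\<bar> \<le> e' * v i" using elim i by auto
      \<comment> \<open>The weights are nonnegative because a positive multiple of each bounds an
        absolute value.\<close>
      have wv: "0 \<le> w i" "0 \<le> v i"
        using a e' by (meson abs_ge_zero order_trans zero_le_mult_iff not_le)+
      have "\<bar>G y i\<bar> \<le> \<bar>G y i - G x i\<bar> + \<bar>G x i\<bar>" by linarith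
      also have "\<dots> \<le> 1 * v i + K' * v i"
        using a K i e'(2) wv by (intro add_mono order_trans[OF a(2)] mult_right_mono) auto
      finally have g: "\<bar>G y i\<bar> \<le> (K' + 1) * v i" by (simp add: algebra_simps)
      have "F y i * G y i - F x i * G x i = (F y i - F x i) * G y i + F x i * (G y i - G x i)"
        by (simp add: algebra_simps)
      then have "\<bar>F y i * G y i - F x i * G x i\<bar> \<le> \<bar>F y i - F x i\<bar> * \<bar>G y i\<bar> + \<bar>F x i\<bar> * \<bar>G y i - G x i\<bar>"
        by (metis abs_mult abs_triangle_ineq)
      also have "\<dots> \<le> (e' * w i) * ((K' + 1) * v i) + (K * w i) * (e' * v i)"
        using a g K i wv e' by (intro add_mono mult_mono) auto
      also have "\<dots> = (e' * (K + K' + 1)) * (w i * v i)" by (simp add: algebra_simps)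
      also have "\<dots> \<le> e * (w i * v i)" using e'(3) wv by (intro mult_right_mono) auto
      finally show "norm (F y i * G y i - F x i * G x i) \<le> e * (w i * v i)" by simp
    qed
  qed
qed

lemma unif_deriv_at_mult:
  fixes F G :: "'a::real_normed_vector \<Rightarrow> 'a list \<Rightarrow> real"
  assumes F: "unif_cont_at I w F x" "unif_deriv_at I w F F' x" "unif_cont_at (cons_set I) (cons_weight w) F' x"
    and G: "unif_cont_at I v G x" "unif_deriv_at I v G G' x"
  shows "unif_deriv_at I (\<lambda>i. w i * v i) (\<lambda>x i. F x i * G x i) (\<lambda>x l. F' x l * G x (tl l) + F x (tl l) * G' x l) x"
  unfolding unif_deriv_at_def list.sel
proof (intro conjI allI impI ballI)
  show "linear (\<lambda>h. F' x (h # i) * G x i + F x i * G' x (h # i))" if "i \<in> I" for i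
  proof -
    have "linear (\<lambda>h. F' x (h # i))" "linear (\<lambda>h. G' x (h # i))"
      using that F(2) G(2) unfolding unif_deriv_at_def by auto
    then show ?thesis by (simp add: linear_iff algebra_simps)
  qed
  obtain K where KF: "K \<ge> 0" "\<forall>i\<in>I. \<bar>F x i\<bar> \<le> K * w i"
    using F(1) unfolding unif_cont_at_def by auto
  obtain K' where KG: "K' \<ge> 0" "\<forall>i\<in>I. \<bar>G x i\<bar> \<le> K' * v i"
    using G(1) unfolding unif_cont_at_def by auto
  note K = KF KG
  obtain K1 where K1: "K1 \<ge> 0" "\<forall>l\<in>cons_set I. \<bar>F' x l\<bar> \<le> K1 * cons_weight w l"
    using F(3) unfolding unif_cont_at_def by auto
  fix e :: real assume "e > 0"
  obtain e' where e': "e' > 0" "e' \<le> 1" "e' * (K + K' + K1 + 1) \<le> e"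
    using small_factor[OF \<open>e > 0\<close>, of "K + K' + K1 + 1"] K K1 by auto
  have "\<forall>\<^sub>F h in nhds 0. \<forall>i\<in>I. norm (F (x + h) i - F x i - F' x (h # i)) \<le> e' * (norm h * w i)"
    using F(2) e'(1) unfolding unif_deriv_at_def by meson
  moreover have "\<forall>\<^sub>F h in nhds 0. \<forall>i\<in>I. norm (G (x + h) i - G x i - G' x (h # i)) \<le> e' * (norm h * v i)"
    using G(2) e'(1) unfolding unif_deriv_at_def by meson
  moreover have "\<forall>\<^sub>F h in nhds 0. \<forall>i\<in>I. norm (G (x + h) i - G x i) \<le> e' * v i"
    using G(1) e'(1) unfolding unif_cont_at_def by (intro eventually_nhds_shift) blast
  moreover have "\<forall>\<^sub>F h in nhds 0. \<forall>i\<in>I. norm (F (x + h) i - F x i) \<le> e' * w i"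
    using F(1) e'(1) unfolding unif_cont_at_def by (intro eventually_nhds_shift) blast
  ultimately show "\<forall>\<^sub>F h in nhds 0. \<forall>i\<in>I. norm (F (x + h) i * G (x + h) i - F x i * G x i
      - (F' x (h # i) * G x i + F x i * G' x (h # i))) \<le> e * (norm h * (w i * v i))"
  proof eventually_elim
    case (elim h)
    show ?case
    proof
      fix i assume i: "i \<in> I"
      have a: "\<bar>F (x + h) i - F x i - F' x (h # i)\<bar> \<le> e' * (norm h * w i)"
        "\<bar>G (x + h) i - G x i - G' x (h # i)\<bar> \<le> e' * (norm h * v i)"
        "\<bar>G (x + h) i - G x i\<bar> \<le> e' * v i" "\<bar>F (x + h) i - F x i\<bar> \<le> e' * w i" using elim i by auto
      have wv: "0 \<le> w i" "0 \<le> v i"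
        using a e' by (meson abs_ge_zero order_trans zero_le_mult_iff not_le)+
      have f': "\<bar>F' x (h # i)\<bar> \<le> K1 * (norm h * w i)"
        using K1(2)[rule_format, of "h # i"] i by (auto simp: cons_set_def cons_weight_def)
      have "\<bar>G (x + h) i\<bar> \<le> \<bar>G (x + h) i - G x i\<bar> + \<bar>G x i\<bar>" by linarith
      also have "\<dots> \<le> 1 * v i + K' * v i"
        using a K i e'(2) wv by (intro add_mono order_trans[OF a(3)] mult_right_mono) auto
      finally have g: "\<bar>G (x + h) i\<bar> \<le> (K' + 1) * v i" by (simp add: algebra_simps)
      \<comment> \<open>Each of the three products has one small factor: the remainder of
        \<open>F\<close>, the remainder of \<open>G\<close>, or the increment of \<open>G\<close>
        against the merely bounded \<open>F'\<close>.\<close>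
      have eq: "F (x + h) i * G (x + h) i - F x i * G x i - (F' x (h # i) * G x i + F x i * G' x (h # i))
        = (F (x + h) i - F x i - F' x (h # i)) * G (x + h) i + F' x (h # i) * (G (x + h) i - G x i)
          + F x i * (G (x + h) i - G x i - G' x (h # i))"
        by (simp add: algebra_simps)
      have "\<bar>F (x + h) i * G (x + h) i - F x i * G x i - (F' x (h # i) * G x i + F x i * G' x (h # i))\<bar> \<le> \<bar>F (x + h) i - F x i - F' x (h # i)\<bar> * \<bar>G (x + h) i\<bar> + \<bar>F' x (h # i)\<bar> * \<bar>G (x + h) i - G x i\<bar>
          + \<bar>F x i\<bar> * \<bar>G (x + h) i - G x i - G' x (h # i)\<bar>"
        unfolding eq abs_mult[symmetric] by (rule order_trans[OF abs_triangle_ineq add_right_mono[OF abs_triangle_ineq]])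
      also have "\<dots> \<le> (e' * (norm h * w i)) * ((K' + 1) * v i) + (K1 * (norm h * w i)) * (e' * v i)
          + (K * w i) * (e' * (norm h * v i))"
      proof (intro add_mono mult_mono)
        show "\<bar>F x i\<bar> \<le> K * w i" using K i by blast
      qed (use a(1-3) g f' K(1) K1(1) K(3) wv e'(1) in \<open>simp_all add: mult_nonneg_nonneg\<close>)
      also have "\<dots> = (e' * (K + K' + K1 + 1)) * (norm h * (w i * v i))" by (simp add: algebra_simps)
      also have "\<dots> \<le> e * (norm h * (w i * v i))" using e'(3) wv by (intro mult_right_mono) auto
      finally show "norm (F (x + h) i * G (x + h) i - F x i * G x i
        - (F' x (h # i) * G x i + F x i * G' x (h # i))) \<le> e * (norm h * (w i * v i))" by simp
    qed
  qed
qed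

text \<open>Both terms of the Leibniz rule are again products, now on \<open>cons_set I\<close>,
  once the undifferentiated factor is pulled back by \<open>tl\<close>. Keeping the index set and
  both weights arbitrary lets the induction hypothesis apply to them.\<close>

lemma unif_Ck_mult:
  fixes F G :: "'a::real_normed_vector \<Rightarrow> 'a list \<Rightarrow> real"
  assumes "unif_Ck j S I w F" "unif_Ck j S I v G" "open S"
  shows "unif_Ck j S I (\<lambda>i. w i * v i) (\<lambda>x i. F x i * G x i)"
  using assms
proof (induction j arbitrary: I w v F G)
  case 0
  then show ?case by (simp add: unif_cont_at_mult)
next
  case (Suc j)
  then obtain F' G' where d: "\<forall>x\<in>S. unif_deriv_at I w F F' x" "unif_Ck j S (cons_set I) (cons_weight w) F'"
    "\<forall>x\<in>S. unif_deriv_at I v G G' x" "unif_Ck j S (cons_set I) (cons_weight v) G'"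
    by (metis unif_Ck.simps(2))
  let ?c = "cons_weight (\<lambda>i. w i * v i)"
  have "unif_Ck j S (cons_set I) (\<lambda>l. v (tl l)) (\<lambda>x l. G x (tl l))"
    by (rule unif_Ck_reindex[OF unif_Ck_SucD[OF Suc.prems(2)]]) (auto simp: cons_set_def)
  from unif_Ck_cong[OF Suc.IH[OF d(2) this assms(3)] assms(3), where v = ?c, OF refl]
  have 1: "unif_Ck j S (cons_set I) ?c (\<lambda>x l. F' x l * G x (tl l))"
    by (auto simp: cons_weight_def)
  have "unif_Ck j S (cons_set I) (\<lambda>l. w (tl l)) (\<lambda>x l. F x (tl l))"
    by (rule unif_Ck_reindex[OF unif_Ck_SucD[OF Suc.prems(1)]]) (auto simp: cons_set_def)
  from unif_Ck_cong[OF Suc.IH[OF this d(4) assms(3)] assms(3), where v = ?c, OF refl]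
  have 2: "unif_Ck j S (cons_set I) ?c (\<lambda>x l. F x (tl l) * G' x l)"
    by (auto simp: cons_weight_def mult.left_commute)
  have "unif_deriv_at I (\<lambda>i. w i * v i) (\<lambda>x i. F x i * G x i) (\<lambda>x l. F' x l * G x (tl l) + F x (tl l) * G' x l) x"
    if "x \<in> S" for x
    using unif_deriv_at_mult unif_Ck_cont[OF Suc.prems(1) that] unif_Ck_cont[OF Suc.prems(2) that]
      unif_Ck_cont[OF d(2) that] d that by blast
  moreover have "unif_cont_at I (\<lambda>i. w i * v i) (\<lambda>x i. F x i * G x i) x" if "x \<in> S" for x
    using unif_cont_at_mult unif_Ck_cont[OF Suc.prems(1) that] unif_Ck_cont[OF Suc.prems(2) that] by blast
  ultimately show ?case using unif_Ck_add[OF 1 2] unfolding unif_Ck.simps by blast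
qed

lemma unif_Ck_zero:
  fixes S :: "'a::real_normed_vector set"
  assumes "\<And>i. i \<in> I \<Longrightarrow> 0 \<le> w i"
  shows "unif_Ck j S I w (\<lambda>_ _. 0 :: 'b::real_normed_vector)"
  using assms
proof (induction j arbitrary: I w)
  case 0
  then show ?case by (auto simp: unif_cont_at_def)
next
  case (Suc j)
  have "unif_Ck j S (cons_set I) (cons_weight w) (\<lambda>_ _. 0 :: 'b)"
    by (rule Suc.IH) (auto simp: cons_set_def cons_weight_def Suc.prems)
  moreover have "unif_deriv_at I w (\<lambda>_ _. 0 :: 'b) (\<lambda>_ _. 0) x" for x :: 'a
    using Suc.prems by (auto simp: unif_deriv_at_def linear_iff)
  ultimately show ?case using Suc.prems
    by (auto simp: unif_cont_at_def intro!: exI[of _ "\<lambda>_ _. 0"])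
qed

lemma unif_Ck_const:
  fixes S :: "'a::real_normed_vector set"
  shows "unif_Ck j S {[]} (\<lambda>_. 1) (\<lambda>_ _. c :: 'b::real_normed_vector)"
proof (cases j)
  have c: "unif_cont_at {[]} (\<lambda>_. 1) (\<lambda>_ _. c) x" for x :: 'a
    by (auto simp: unif_cont_at_def intro: exI[of _ "norm c"])
  {
    case 0 then show ?thesis using c by simp
  next
    case (Suc i)
    have "unif_deriv_at {[]} (\<lambda>_. 1) (\<lambda>_ _. c) (\<lambda>_ _. 0) x" for x :: 'a
      by (auto simp: unif_deriv_at_def linear_iff)
    moreover have "unif_Ck i S (cons_set {[]}) (cons_weight (\<lambda>_. 1)) (\<lambda>_ _. 0 :: 'b)"
      by (rule unif_Ck_zero) (auto simp: cons_weight_def)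
    ultimately show ?thesis using c Suc by auto
  }
qed

lemma unif_deriv_at_imp_has_derivative:
  assumes "unif_deriv_at {[]} (\<lambda>_. 1) (\<lambda>x _. u x) F' x" "\<And>h. norm (F' x [h]) \<le> norm h * K"
  shows "(u has_derivative (\<lambda>h. F' x [h])) (at x)"
  unfolding has_derivative_at_alt
proof (intro conjI allI impI)
  show "bounded_linear (\<lambda>h. F' x [h])"
    using assms unfolding unif_deriv_at_def
    by (intro bounded_linear_intro[of _ K]) (auto simp: linear_iff)
  fix e :: real assume "e > 0"
  then have "\<forall>\<^sub>F h in nhds 0. norm (u (x + h) - u x - F' x [h]) \<le> e * norm h"
    using assms(1) unfolding unif_deriv_at_def by auto
  then obtain d where "d > 0" and d: "\<And>h. norm h < d \<Longrightarrow> norm (u (x + h) - u x - F' x [h]) \<le> e * norm h"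
    unfolding eventually_nhds_metric by (auto simp: dist_norm)
  then show "\<exists>d>0. \<forall>y. norm (y - x) < d \<longrightarrow> norm (u y - u x - F' x [y - x]) \<le> e * norm (y - x)"
    by (metis add.commute diff_add_cancel)
qed

lemma has_derivative_imp_unif_deriv_at:
  assumes "(u has_derivative D) (at x)"
  shows "unif_deriv_at {[]} (\<lambda>_. 1) (\<lambda>x _. u x) (\<lambda>_ l. D (hd l)) x"
  unfolding unif_deriv_at_def
proof (intro conjI allI impI ballI)
  show "linear (\<lambda>h. D (hd (h # i)))" for i :: "'a list"
    using has_derivative_linear[OF assms] by simp
  fix e :: real assume "e > 0"
  then obtain d where "d > 0" and d: "\<And>y. norm (y - x) < d \<Longrightarrow> norm (u y - u x - D (y - x)) \<le> e * norm (y - x)"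
    using assms unfolding has_derivative_at_alt by blast
  show "\<forall>\<^sub>F h in nhds 0. \<forall>i\<in>{[]}. norm (u (x + h) - u x - D (hd (h # i))) \<le> e * (norm h * 1)"
    unfolding eventually_nhds_metric using d[of "x + _"] \<open>d > 0\<close> by (auto simp: dist_norm)
qed

lemma unif_cont_at_scalar: "unif_cont_at {[]} (\<lambda>_. 1) (\<lambda>x _. u x) x \<longleftrightarrow> isCont u x"
proof
  assume L: "unif_cont_at {[]} (\<lambda>_. 1) (\<lambda>x _. u x) x"
  show "isCont u x"
    unfolding isCont_def
  proof (rule tendstoI)
    fix e :: real assume "e > 0"
    have "\<forall>e>0. \<forall>\<^sub>F y in nhds x. norm (u y - u x) \<le> e"
      using L unfolding unif_cont_at_def by simp
    then have "\<forall>\<^sub>F y in nhds x. norm (u y - u x) \<le> e / 2"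
      using half_gt_zero[OF \<open>e > 0\<close>] by blast
    then show "\<forall>\<^sub>F y in at x. dist (u y) (u x) < e"
      unfolding eventually_at_filter
      by eventually_elim (use \<open>e > 0\<close> in \<open>auto simp: dist_norm\<close>)
  qed
next
  assume R: "isCont u x"
  have "\<forall>\<^sub>F y in nhds x. norm (u y - u x) \<le> e" if "e > 0" for e
  proof -
    have "(u \<longlongrightarrow> u x) (nhds x)" using R by (simp add: continuous_at tendsto_at_iff_tendsto_nhds)
    then have "\<forall>\<^sub>F y in nhds x. dist (u y) (u x) < e" using that tendstoD by blast
    then show ?thesis by eventually_elim (simp add: dist_norm)
  qed
  then show "unif_cont_at {[]} (\<lambda>_. 1) (\<lambda>x _. u x) x"
    unfolding unif_cont_at_def by (auto intro: exI[of _ "norm (u x)"])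
qed

text \<open>The weighted bound on \<open>F'\<close> at the index \<open>[h]\<close> turns linearity
  into bounded linearity. Continuity is extracted for each fixed direction \<open>h\<close>, the
  form in which it is applied to transition maps along coordinate segments.\<close>

lemma unif_Ck_has_derivative:
  assumes "unif_Ck (Suc j) S {[]} (\<lambda>_. 1) (\<lambda>x _. u x)"
  shows "\<exists>F'. unif_Ck j S (cons_set {[]}) (cons_weight (\<lambda>_. 1)) F' \<and>
    (\<forall>x\<in>S. (u has_derivative (\<lambda>h. F' x [h])) (at x) \<and> (\<forall>h. isCont (\<lambda>x. F' x [h]) x))"
proof -
  obtain F' where d: "\<And>x. x \<in> S \<Longrightarrow> unif_deriv_at {[]} (\<lambda>_. 1) (\<lambda>x _. u x) F' x"
    and F': "unif_Ck j S (cons_set {[]}) (cons_weight (\<lambda>_. 1)) F'"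
    using assms by auto
  have mem: "[h] \<in> cons_set {[]}" for h :: 'a by (simp add: cons_set_def)
  have "(u has_derivative (\<lambda>h. F' x [h])) (at x)" if "x \<in> S" for x
  proof -
    obtain K where "\<forall>l\<in>cons_set {[]}. norm (F' x l) \<le> K * cons_weight (\<lambda>_. 1) l"
      using unif_Ck_cont[OF F' \<open>x \<in> S\<close>] unfolding unif_cont_at_def by auto
    then have "norm (F' x [h]) \<le> norm h * K" for h
      using mem[of h] by (auto simp: cons_weight_def mult.commute)
    then show ?thesis by (rule unif_deriv_at_imp_has_derivative[OF d[OF that]])
  qed
  moreover have "isCont (\<lambda>x. F' x [h]) x" if "x \<in> S" for x h
  proof -
    have "unif_cont_at {[]} (\<lambda>_. cons_weight (\<lambda>_. 1) [h]) (\<lambda>x _. F' x [h]) x"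
      using unif_Ck_cont[OF unif_Ck_reindex[OF F', of "{[]}" "\<lambda>_. [h]"] that] mem by simp
    then have "\<forall>e>0. \<forall>\<^sub>F y in nhds x. norm (F' y [h] - F' x [h]) \<le> e * norm h"
      unfolding unif_cont_at_def by (simp add: cons_weight_def)
    then have *: "\<forall>\<^sub>F y in nhds x. norm (F' y [h] - F' x [h]) \<le> e * norm h" if "e > 0" for e
      using that by blast
    have "\<forall>\<^sub>F y in nhds x. norm (F' y [h] - F' x [h]) \<le> e" if "e > 0" for e
    proof -
      obtain e' where "0 < e'" "e' * (norm h + 1) \<le> e"
        using small_factor[OF \<open>e > 0\<close>, of "norm h + 1"] by auto
      moreover have "e' * norm h \<le> e' * (norm h + 1)" using \<open>0 < e'\<close> by simp
      ultimately have "e' * norm h \<le> e" by linarith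
      show ?thesis using *[OF \<open>0 < e'\<close>] by eventually_elim (use \<open>e' * norm h \<le> e\<close> in linarith)
    qed
    then have "unif_cont_at {[]} (\<lambda>_. 1) (\<lambda>x _. F' x [h]) x"
      unfolding unif_cont_at_def by (auto intro: exI[of _ "norm (F' x [h])"])
    then show ?thesis unfolding unif_cont_at_scalar .
  qed
  ultimately show ?thesis using F' by blast
qed

text \<open>The chain rule gives the derivative \<open>\<sigma>' (u x) * F' x l\<close>. Its first
  factor has the same form with \<open>\<sigma>'\<close> for \<open>\<sigma>\<close> and one order
  less, its second is a derivative of \<open>u\<close>; so induction over all smooth
  \<open>\<sigma>\<close> and the product rule suffice.\<close>

lemma unif_Ck_compose_smooth:
  fixes u :: "'a::real_normed_vector \<Rightarrow> real"
  assumes "smooth_real \<sigma>" "unif_Ck j S {[]} (\<lambda>_. 1) (\<lambda>x _. u x)" "open S"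
  shows "unif_Ck j S {[]} (\<lambda>_. 1) (\<lambda>x _. \<sigma> (u x))"
  using assms(1,2)
proof (induction j arbitrary: \<sigma>)
  have diff: "\<exists>\<sigma>'. \<forall>t. (\<sigma> has_real_derivative \<sigma>' t) (at t)" if "smooth_real \<sigma>" for \<sigma>
    using that times_diff.simps(2) unfolding smooth_real_def by metis
  have c: "unif_cont_at {[]} (\<lambda>_. 1) (\<lambda>x _. \<sigma> (u x)) x"
    if "smooth_real \<sigma>" "unif_cont_at {[]} (\<lambda>_. 1) (\<lambda>x _. u x) x" for \<sigma> x
    using that(2) diff[OF that(1)] unfolding unif_cont_at_scalar
    by (metis DERIV_isCont isCont_o2)
  {
    case 0 then show ?case using c by simp
  next
    case (Suc j)
    obtain \<sigma>' where \<sigma>': "\<And>t. (\<sigma> has_real_derivative \<sigma>' t) (at t)" using diff[OF Suc.prems(1)] by blast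
    obtain F' where F': "unif_Ck j S (cons_set {[]}) (cons_weight (\<lambda>_. 1)) F'"
      "\<forall>x\<in>S. (u has_derivative (\<lambda>h. F' x [h])) (at x)"
      using unif_Ck_has_derivative[OF Suc.prems(2)] by meson
    have "unif_Ck j S {[]} (\<lambda>_. 1) (\<lambda>x _. \<sigma>' (u x))"
      using Suc.IH[OF smooth_real_deriv[OF Suc.prems(1) \<sigma>'] unif_Ck_SucD[OF Suc.prems(2)]] .
    from unif_Ck_reindex[OF this, of "cons_set {[]}" "\<lambda>_. []"]
    have "unif_Ck j S (cons_set {[]}) (\<lambda>_. 1) (\<lambda>x _. \<sigma>' (u x))" by simp
    from unif_Ck_mult[OF this F'(1) assms(3)]
    have 1: "unif_Ck j S (cons_set {[]}) (cons_weight (\<lambda>_. 1)) (\<lambda>x l. \<sigma>' (u x) * F' x l)" by simp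
    have 2: "unif_deriv_at {[]} (\<lambda>_. 1) (\<lambda>x _. \<sigma> (u x)) (\<lambda>x l. \<sigma>' (u x) * F' x l) x" if "x \<in> S" for x
    proof -
      have "((\<lambda>x. \<sigma> (u x)) has_derivative (\<lambda>h. \<sigma>' (u x) * F' x [h])) (at x)"
        using has_derivative_compose[OF F'(2)[rule_format, OF that], of \<sigma> "\<lambda>y. \<sigma>' (u x) * y"] \<sigma>'[of "u x"]
        by (simp add: has_field_derivative_def)
      from unif_deriv_at_cong[OF has_derivative_imp_unif_deriv_at[OF this] open_UNIV UNIV_I]
      show ?thesis by auto
    qed
    show ?case unfolding unif_Ck.simps(2)
      using 1 2 c[OF Suc.prems(1) unif_Ck_cont[OF Suc.prems(2)]] by blast
  }
qed

text \<open>A derivative named by a formula instead of an existential. It agrees with every witness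
  on the relevant indices, so witnesses found on different open sets or for different orders can be
  merged.\<close>

definition dir_deriv :: "('a::real_normed_vector \<Rightarrow> 'a list \<Rightarrow> 'b::real_normed_vector) \<Rightarrow> 'a \<Rightarrow> 'a list \<Rightarrow> 'b" where
  "dir_deriv F x l = vector_derivative (\<lambda>t. F (x + t *\<^sub>R hd l) (tl l)) (at 0)"

lemma unif_deriv_at_has_vector_derivative:
  assumes "unif_deriv_at I w F F' x" "i \<in> I"
  shows "((\<lambda>t. F (x + t *\<^sub>R h) i) has_vector_derivative F' x (h # i)) (at 0)"
  unfolding has_vector_derivative_def has_derivative_at_alt
proof (intro conjI allI impI)
  show "bounded_linear (\<lambda>t. t *\<^sub>R F' x (h # i))" by (rule bounded_linear_scaleR_left)
  fix e :: real assume "e > 0"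
  obtain e' where e': "0 < e'" "e' * (norm h * \<bar>w i\<bar> + 1) \<le> e"
    using small_factor[OF \<open>e > 0\<close>, of "norm h * \<bar>w i\<bar> + 1"] by auto
  have "e' * (norm h * w i) \<le> e' * (norm h * \<bar>w i\<bar> + 1)"
  proof (rule mult_left_mono)
    have "norm h * w i \<le> norm h * \<bar>w i\<bar>" by (intro mult_left_mono) auto
    then show "norm h * w i \<le> norm h * \<bar>w i\<bar> + 1" by linarith
  qed (use e'(1) in simp)
  then have e'': "e' * (norm h * w i) \<le> e" using e'(2) by linarith
  have ev: "\<forall>\<^sub>F h in nhds 0. norm (F (x + h) i - F x i - F' x (h # i)) \<le> e' * (norm h * w i)"
  proof -
    have "\<forall>\<^sub>F h in nhds 0. \<forall>i\<in>I. norm (F (x + h) i - F x i - F' x (h # i)) \<le> e' * (norm h * w i)"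
      using assms(1) e'(1) unfolding unif_deriv_at_def by meson
    then show ?thesis by eventually_elim (use assms(2) in blast)
  qed
  have lin: "linear (\<lambda>h. F' x (h # i))" using assms unfolding unif_deriv_at_def by blast
  have "((\<lambda>t. t *\<^sub>R h) \<longlongrightarrow> 0) (nhds (0::real))"
  proof -
    have "isCont (\<lambda>t. t *\<^sub>R h) (0::real)" by (intro continuous_intros)
    then show ?thesis
      using tendsto_at_iff_tendsto_nhds[of "\<lambda>t. t *\<^sub>R h" "0::real"] by (simp add: isCont_def)
  qed
  then have "\<forall>\<^sub>F t in nhds (0::real). norm (F (x + t *\<^sub>R h) i - F x i - F' x ((t *\<^sub>R h) # i)) \<le> e' * (norm (t *\<^sub>R h) * w i)"
    using ev by (rule eventually_compose_filterlim[rotated])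
  then obtain d where d: "d > 0" "\<And>t. \<bar>t\<bar> < d \<Longrightarrow> norm (F (x + t *\<^sub>R h) i - F x i - F' x ((t *\<^sub>R h) # i)) \<le> e' * (norm (t *\<^sub>R h) * w i)"
    unfolding eventually_nhds_metric by (auto simp: dist_norm)
  have "norm (F (x + t *\<^sub>R h) i - F x i - t *\<^sub>R F' x (h # i)) \<le> e * \<bar>t\<bar>" if "\<bar>t\<bar> < d" for t
  proof -
    have "norm (F (x + t *\<^sub>R h) i - F x i - t *\<^sub>R F' x (h # i)) \<le> \<bar>t\<bar> * (e' * (norm h * w i))"
      using d(2)[OF that] linear_scale[OF lin, of t h] by (simp add: algebra_simps)
    also have "\<dots> \<le> \<bar>t\<bar> * e" using e'' by (intro mult_left_mono) auto
    finally show ?thesis by (simp add: mult.commute)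
  qed
  then show "\<exists>d>0. \<forall>y. norm (y - 0) < d \<longrightarrow>
      norm (F (x + y *\<^sub>R h) i - F (x + 0 *\<^sub>R h) i - (y - 0) *\<^sub>R F' x (h # i)) \<le> e * norm (y - 0)"
    using d(1) by auto
qed

lemma dir_deriv_eq:
  assumes "unif_deriv_at I w F F' x" "i \<in> I"
  shows "dir_deriv F x (h # i) = F' x (h # i)"
  using vector_derivative_at[OF unif_deriv_at_has_vector_derivative[OF assms]] by (simp add: dir_deriv_def)

lemma unif_Ck_Suc_dir_deriv:
  assumes "unif_Ck (Suc j) S I w F" "open S"
  shows "unif_Ck j S (cons_set I) (cons_weight w) (dir_deriv F)"
    and "x \<in> S \<Longrightarrow> unif_deriv_at I w F (dir_deriv F) x"
proof -
  obtain F' where d: "\<And>x. x \<in> S \<Longrightarrow> unif_deriv_at I w F F' x" "unif_Ck j S (cons_set I) (cons_weight w) F'"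
    using assms(1) by auto
  have eq: "F' x l = dir_deriv F x l" if "x \<in> S" "l \<in> cons_set I" for x l
    using dir_deriv_eq[OF d(1)[OF that(1)]] that(2) by (auto simp: cons_set_def)
  show "unif_Ck j S (cons_set I) (cons_weight w) (dir_deriv F)"
    by (rule unif_Ck_cong[OF d(2) assms(2) eq refl])
  show "unif_deriv_at I w F (dir_deriv F) x" if "x \<in> S"
    by (rule unif_deriv_at_cong[OF d(1)[OF that] open_UNIV UNIV_I refl refl])
      (auto intro!: eq that simp: cons_set_def)
qed

text \<open>The local witnesses for the derivative all agree with \<open>dir_deriv\<close>, which is
  therefore a witness on the whole of \<open>S\<close>.\<close>

lemma unif_Ck_local:
  assumes "\<And>x. x \<in> S \<Longrightarrow> \<exists>T. open T \<and> x \<in> T \<and> unif_Ck j T I w F"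
  shows "unif_Ck j S I w F"
  using assms
proof (induction j arbitrary: I w F)
  case 0
  then show ?case by force
next
  case (Suc j)
  have "unif_Ck j S (cons_set I) (cons_weight w) (dir_deriv F)"
    by (rule Suc.IH) (meson Suc.prems unif_Ck_Suc_dir_deriv(1))
  moreover have "unif_deriv_at I w F (dir_deriv F) x" if "x \<in> S" for x
    using Suc.prems[OF that] unif_Ck_Suc_dir_deriv(2) by blast
  moreover have "unif_cont_at I w F x" if "x \<in> S" for x
    using Suc.prems[OF that] unif_Ck_cont by blast
  ultimately show ?case by auto
qed

section \<open>Comparison with the iterated derivatives of \<open>Ck_on\<close>\<close>

definition list_weight :: "'a::real_normed_vector list \<Rightarrow> real" where
  "list_weight vs = prod_list (map norm vs)"

lemma list_weight_simps [simp]: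
  "list_weight [] = 1" "list_weight (v # vs) = norm v * list_weight vs"
  by (simp_all add: list_weight_def)

lemma list_weight_nonneg: "0 \<le> list_weight vs"
  by (induction vs) auto

lemma list_weight_le_1: "(\<And>v. v \<in> set vs \<Longrightarrow> norm v \<le> 1) \<Longrightarrow> list_weight vs \<le> 1"
  by (induction vs) (auto intro!: mult_le_one list_weight_nonneg)

lemma multilinear_norm_le:
  assumes "\<And>vs. length vs = n \<Longrightarrow> norm (T vs) \<le> e * list_weight vs" "0 \<le> e"
  shows "0 \<le> multilinear_norm n T" "multilinear_norm n T \<le> e"
proof -
  let ?M = "{norm (T vs) | vs. length vs = n \<and> (\<forall>v\<in>set vs. norm v \<le> 1)}"
  have up: "m \<le> e" if "m \<in> ?M" for m
  proof -
    obtain vs where vs: "m = norm (T vs)" "length vs = n" "\<forall>v\<in>set vs. norm v \<le> 1" using \<open>m \<in> ?M\<close> by blast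
    have "e * list_weight vs \<le> e * 1" using assms(2) vs list_weight_le_1 by (intro mult_left_mono) auto
    then show ?thesis using assms(1)[OF vs(2)] vs(1) by linarith
  qed
  have mem: "norm (T (replicate n 0)) \<in> ?M" by (intro CollectI exI[of _ "replicate n 0"]) auto
  show "multilinear_norm n T \<le> e" unfolding multilinear_norm_def
    by (rule cSup_least) (use mem up in auto)
  have "0 \<le> norm (T (replicate n 0))" by simp
  also have "\<dots> \<le> multilinear_norm n T" unfolding multilinear_norm_def
    by (rule cSup_upper[OF mem]) (use up in \<open>auto simp: bdd_above_def\<close>)
  finally show "0 \<le> multilinear_norm n T" .
qed

text \<open>By homogeneity in each slot the arguments can be scaled to norm 1. If one of them is 0,
  the weight is 0 and the crude bound with \<open>K\<close> already forces the value to
  vanish.\<close>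

lemma multilinear_norm_bound:
  fixes T :: "'a::real_normed_vector list \<Rightarrow> 'b::real_normed_vector"
  assumes T: "bounded_multilinear n T" and l: "length vs = n"
  shows "norm (T vs) \<le> multilinear_norm n T * list_weight vs"
proof -
  have lin: "linear (\<lambda>v. T (vs[i := v]))" if "length vs = n" "i < n" for vs i
    using T that unfolding bounded_multilinear_def by blast
  obtain K where K: "\<And>vs. length vs = n \<Longrightarrow> norm (T vs) \<le> K * list_weight vs"
    using T unfolding bounded_multilinear_def list_weight_def by blast
  let ?M = "{norm (T vs) | vs. length vs = n \<and> (\<forall>v\<in>set vs. norm v \<le> 1)}"
  have "bdd_above ?M"
  proof (rule bdd_aboveI)
    fix m assume "m \<in> ?M"
    then obtain vs where vs: "m = norm (T vs)" "length vs = n" "\<forall>v\<in>set vs. norm v \<le> 1" by blast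
    have "K * list_weight vs \<le> \<bar>K\<bar> * 1"
      using vs list_weight_le_1[of vs] list_weight_nonneg[of vs] by (intro mult_mono) auto
    then show "m \<le> \<bar>K\<bar>" using K[OF vs(2)] vs(1) by linarith
  qed
  then have ub: "norm (T us) \<le> multilinear_norm n T" if "length us = n" "\<forall>v\<in>set us. norm v \<le> 1" for us
    unfolding multilinear_norm_def using that by (intro cSup_upper) auto
  let ?s = "\<lambda>v::'a. v /\<^sub>R norm v"
  \<comment> \<open>The unscaled tail \<open>bs\<close> is arbitrary so that the induction can
    release one slot at a time, from the right.\<close>
  have step: "T (map ?s as @ bs) = T (as @ bs) /\<^sub>R list_weight as"
    if "length (as @ bs) = n" for as bs
    using that
  proof (induction as arbitrary: bs rule: rev_induct)
    case (snoc a as)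
    let ?vs = "map ?s as @ a # bs"
    have i: "length ?vs = n" "length as < n" using snoc.prems by auto
    have "T (map ?s (as @ [a]) @ bs) = T (?vs[length as := ?s a])" by (simp add: list_update_append)
    also have "\<dots> = T (?vs[length as := a]) /\<^sub>R norm a"
      using linear_scale[OF lin[OF i], of "inverse (norm a)" a] by simp
    also have "T (?vs[length as := a]) = T (map ?s as @ (a # bs))" by (simp add: list_update_append)
    also have "\<dots> = T (as @ a # bs) /\<^sub>R list_weight as" using snoc.prems by (intro snoc.IH) simp
    finally show ?case by (simp add: list_weight_def)
  qed simp
  show ?thesis
  proof (cases "list_weight vs = 0")
    case True
    then show ?thesis using K[OF l] by simp
  next
    case False
    then have pos: "list_weight vs > 0" using list_weight_nonneg[of vs] by linarith
    have "norm (?s v) \<le> 1" for v by (cases "v = 0") auto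
    then have "norm (T (map ?s vs)) \<le> multilinear_norm n T"
      using l by (intro ub) (simp_all del: norm_scaleR)
    then show ?thesis using step[of vs "[]"] l pos by (simp add: field_simps)
  qed
qed

definition all_lists :: "nat \<Rightarrow> 'a list set" where
  "all_lists n = {vs. length vs = n}"

lemma cons_set_all_lists: "cons_set (all_lists n) = all_lists (Suc n)"
  unfolding cons_set_def all_lists_def by (auto simp: length_Suc_conv)

lemma cons_weight_list_weight: "l \<in> all_lists (Suc n) \<Longrightarrow> cons_weight list_weight l = list_weight l"
  by (auto simp: all_lists_def cons_weight_def length_Suc_conv)

lemma bounded_multilinear_diff:
  assumes "bounded_multilinear n T" "bounded_multilinear n U"
  shows "bounded_multilinear n (\<lambda>vs. T vs - U vs)"
  unfolding bounded_multilinear_def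
proof (intro conjI allI impI)
  show "linear (\<lambda>v. T (vs[i := v]) - U (vs[i := v]))" if "length vs = n \<and> i < n" for vs i
    using assms that unfolding bounded_multilinear_def by (intro linear_compose_sub) auto
  obtain K K' where K: "\<And>vs. length vs = n \<Longrightarrow> norm (T vs) \<le> K * prod_list (map norm vs)"
    "\<And>vs. length vs = n \<Longrightarrow> norm (U vs) \<le> K' * prod_list (map norm vs)"
    using assms unfolding bounded_multilinear_def by metis
  have "norm (T vs - U vs) \<le> (K + K') * prod_list (map norm vs)" if "length vs = n" for vs
    unfolding distrib_right using K[OF that] by (intro order_trans[OF norm_triangle_ineq4] add_mono)
  then show "\<exists>K. \<forall>vs. length vs = n \<longrightarrow> norm (T vs - U vs) \<le> K * prod_list (map norm vs)" by blast
qed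

lemma bounded_multilinear_Cons:
  assumes "bounded_multilinear (Suc n) T"
  shows "bounded_multilinear n (\<lambda>vs. T (h # vs))"
  unfolding bounded_multilinear_def
proof (intro conjI allI impI)
  show "linear (\<lambda>v. T (h # vs[i := v]))" if "length vs = n \<and> i < n" for vs i
  proof -
    have "linear (\<lambda>v. T ((h # vs)[Suc i := v]))"
      using assms that unfolding bounded_multilinear_def by (metis Suc_mono length_Cons)
    then show ?thesis by simp
  qed
  obtain K where K: "\<And>vs. length vs = Suc n \<Longrightarrow> norm (T vs) \<le> K * prod_list (map norm vs)"
    using assms unfolding bounded_multilinear_def by metis
  then show "\<exists>K. \<forall>vs. length vs = n \<longrightarrow> norm (T (h # vs)) \<le> K * prod_list (map norm vs)"
    using K[of "h # _"] by (intro exI[of _ "K * norm h"]) (auto simp: mult.assoc)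
qed

text \<open>Each \<open>D m\<close> is of class \<open>j\<close> in the indexed sense whenever
  \<open>m + j \<le> k\<close>, and operator norms become estimates weighted by
  \<open>list_weight\<close>. The filters \<open>at x\<close> and \<open>at 0\<close> omit the base
  point, where the estimates are checked separately.\<close>

lemma Ck_on_imp_unif_Ck:
  assumes "Ck_on k S f" "open S" "enat j \<le> k"
  shows "unif_Ck j S {[]} (\<lambda>_. 1) (\<lambda>x _. f x)"
proof -
  obtain D where D: "(\<forall>x\<in>S. D 0 x [] = f x) \<and>
    (\<forall>n. enat n \<le> k \<longrightarrow> (\<forall>x\<in>S. bounded_multilinear n (D n x))) \<and>
    (\<forall>n. enat n < k \<longrightarrow> (\<forall>x\<in>S.
       ((\<lambda>h. multilinear_norm n (\<lambda>vs. D n (x + h) vs - D n x vs - D (Suc n) x (h # vs)) / norm h) \<longlongrightarrow> 0) (at 0))) \<and>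
    (\<forall>n. enat n \<le> k \<longrightarrow> (\<forall>x\<in>S.
       ((\<lambda>y. multilinear_norm n (\<lambda>vs. D n y vs - D n x vs)) \<longlongrightarrow> 0) (at x)))"
    using assms(1) unfolding Ck_on_def by (rule exE)
  then have D0: "\<And>x. x \<in> S \<Longrightarrow> D 0 x [] = f x"
    and ml: "\<And>n x. enat n \<le> k \<Longrightarrow> x \<in> S \<Longrightarrow> bounded_multilinear n (D n x)"
    and der: "\<And>n x. enat n < k \<Longrightarrow> x \<in> S \<Longrightarrow>
       ((\<lambda>h. multilinear_norm n (\<lambda>vs. D n (x + h) vs - D n x vs - D (Suc n) x (h # vs)) / norm h) \<longlongrightarrow> 0) (at 0)"
    and cont: "\<And>n x. enat n \<le> k \<Longrightarrow> x \<in> S \<Longrightarrow>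
       ((\<lambda>y. multilinear_norm n (\<lambda>vs. D n y vs - D n x vs)) \<longlongrightarrow> 0) (at x)"
    by simp_all
  have C: "unif_cont_at (all_lists n) list_weight (D n) x" if n: "enat n \<le> k" and x: "x \<in> S" for n x
    unfolding unif_cont_at_def
  proof (intro conjI allI impI)
    obtain K where K: "\<And>vs. length vs = n \<Longrightarrow> norm (D n x vs) \<le> K * list_weight vs"
      using ml[OF n x] unfolding bounded_multilinear_def list_weight_def by blast
    have "norm (D n x vs) \<le> \<bar>K\<bar> * list_weight vs" if "length vs = n" for vs
      using K[OF that] mult_right_mono[OF abs_ge_self list_weight_nonneg, of K vs] by linarith
    then show "\<exists>K\<ge>0. \<forall>i\<in>all_lists n. norm (D n x i) \<le> K * list_weight i"
      unfolding all_lists_def by (intro exI[of _ "\<bar>K\<bar>"]) auto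
    fix e :: real assume "e > 0"
    then have "\<forall>\<^sub>F y in at x. dist (multilinear_norm n (\<lambda>vs. D n y vs - D n x vs)) 0 < e"
      using cont[OF n x] tendstoD by blast
    then have "\<forall>\<^sub>F y in nhds x. y \<noteq> x \<longrightarrow> multilinear_norm n (\<lambda>vs. D n y vs - D n x vs) < e"
      unfolding eventually_at_filter by eventually_elim auto
    moreover have "\<forall>\<^sub>F y in nhds x. y \<in> S" using assms(2) x by (rule eventually_nhds_in_open)
    ultimately show "\<forall>\<^sub>F y in nhds x. \<forall>i\<in>all_lists n. norm (D n y i - D n x i) \<le> e * list_weight i"
    proof eventually_elim
      case (elim y)
      show ?case
      proof
        fix vs :: "'a list" assume "vs \<in> all_lists n"
        then have l: "length vs = n" by (simp add: all_lists_def)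
        show "norm (D n y vs - D n x vs) \<le> e * list_weight vs"
        proof (cases "y = x")
          case True
          then show ?thesis using mult_nonneg_nonneg[OF less_imp_le[OF \<open>e > 0\<close>] list_weight_nonneg] by simp
        next
          case False
          have "norm (D n y vs - D n x vs) \<le> multilinear_norm n (\<lambda>vs. D n y vs - D n x vs) * list_weight vs"
            by (rule multilinear_norm_bound[OF bounded_multilinear_diff[OF ml[OF n] ml[OF n]] l]) (use elim x in auto)
          also have "\<dots> \<le> e * list_weight vs"
            using elim False list_weight_nonneg[of vs] by (intro mult_right_mono) auto
          finally show ?thesis .
        qed
      qed
    qed
  qed
  have Df: "unif_deriv_at (all_lists n) list_weight (D n) (D (Suc n)) x" if n: "enat (Suc n) \<le> k" and x: "x \<in> S" for n x
    unfolding unif_deriv_at_def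
  proof (intro conjI allI impI ballI)
    have n': "enat n < k" "enat n \<le> k" using n by (auto simp: Suc_ile_eq order.strict_implies_order)
    show "linear (\<lambda>h. D (Suc n) x (h # i))" if "i \<in> all_lists n" for i
    proof -
      have "linear (\<lambda>v. D (Suc n) x ((0 # i)[0 := v]))"
        using ml[OF n x] that unfolding bounded_multilinear_def all_lists_def
        by (metis length_Cons mem_Collect_eq zero_less_Suc)
      then show ?thesis by simp
    qed
    fix e :: real assume "e > 0"
    then have "\<forall>\<^sub>F h in at 0. dist (multilinear_norm n (\<lambda>vs. D n (x + h) vs - D n x vs - D (Suc n) x (h # vs)) / norm h) 0 < e"
      using der[OF n'(1) x] tendstoD by blast
    then have "\<forall>\<^sub>F h in nhds 0. h \<noteq> 0 \<longrightarrow> multilinear_norm n (\<lambda>vs. D n (x + h) vs - D n x vs - D (Suc n) x (h # vs)) / norm h < e"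
      unfolding eventually_at_filter by eventually_elim (auto intro: order_le_less_trans[OF divide_right_mono[OF abs_ge_self]])
    moreover have "\<forall>\<^sub>F h in nhds 0. x + h \<in> S"
      by (rule eventually_nhds_shift[OF eventually_nhds_in_open[OF assms(2) x]])
    ultimately show "\<forall>\<^sub>F h in nhds 0. \<forall>i\<in>all_lists n. norm (D n (x + h) i - D n x i - D (Suc n) x (h # i)) \<le> e * (norm h * list_weight i)"
    proof eventually_elim
      case (elim h)
      show ?case
      proof
        fix vs :: "'a list" assume "vs \<in> all_lists n"
        then have l: "length vs = n" by (simp add: all_lists_def)
        have b: "bounded_multilinear n (\<lambda>vs. D (Suc n) x (h # vs))" by (rule bounded_multilinear_Cons[OF ml[OF n x]])
        have nb: "norm (D n (x + h) vs - D n x vs - D (Suc n) x (h # vs))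
            \<le> multilinear_norm n (\<lambda>vs. D n (x + h) vs - D n x vs - D (Suc n) x (h # vs)) * list_weight vs"
          by (rule multilinear_norm_bound[OF bounded_multilinear_diff[OF bounded_multilinear_diff[OF ml[OF n'(2)] ml[OF n'(2)]] b] l])
            (use elim x in auto)
        show "norm (D n (x + h) vs - D n x vs - D (Suc n) x (h # vs)) \<le> e * (norm h * list_weight vs)"
        proof (cases "h = 0")
          case True
          have "linear (\<lambda>v. D (Suc n) x ((0 # vs)[0 := v]))"
            using ml[OF n x] l unfolding bounded_multilinear_def by (metis length_Cons zero_less_Suc)
          then have "D (Suc n) x (0 # vs) = 0" using linear_0 by fastforce
          then show ?thesis using True by simp
        next
          case False
          have "multilinear_norm n (\<lambda>vs. D n (x + h) vs - D n x vs - D (Suc n) x (h # vs)) \<le> e * norm h"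
            using elim False by (simp add: field_simps)
          from mult_right_mono[OF this list_weight_nonneg[of vs]] nb show ?thesis by (simp add: mult.assoc)
        qed
      qed
    qed
  qed
  have "unif_Ck j S (all_lists m) list_weight (D m)" if "enat (m + j) \<le> k" for m j
    using that
  proof (induction j arbitrary: m)
    case 0
    then show ?case using C by simp
  next
    case (Suc j)
    have m: "enat m \<le> k" "enat (Suc m) \<le> k"
      by (rule order_trans[OF _ Suc.prems], simp)+
    have "unif_Ck j S (all_lists (Suc m)) list_weight (D (Suc m))" using Suc by simp
    from unif_Ck_cong[OF this assms(2) refl, of "cons_weight list_weight"]
    have "unif_Ck j S (cons_set (all_lists m)) (cons_weight list_weight) (D (Suc m))"
      by (simp add: cons_set_all_lists cons_weight_list_weight)
    then show ?case unfolding unif_Ck.simps using C[OF m(1)] Df[OF m(2)] by blast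
  qed
  from this[of 0 j] have "unif_Ck j S (all_lists 0) list_weight (D 0)" using assms(3) by simp
  moreover have "all_lists 0 = {[] :: 'a list}" by (auto simp: all_lists_def)
  ultimately show ?thesis
    using unif_Ck_cong[of j S "{[]}" list_weight "D 0" "\<lambda>x _. f x" "\<lambda>_. 1"] assms(2) D0 by simp
qed

text \<open>The derivative along \<open>h\<close> is computed on a line through \<open>x\<close>,
  where \<open>F\<close> is linear in \<open>v\<close> for all small parameters; uniqueness of
  vector derivatives transfers this. It yields linearity of higher derivatives in the slots after
  the first.\<close>

lemma linear_dir_deriv:
  assumes d: "unif_deriv_at I w F F' x" and S: "open S" "x \<in> S"
    and lin: "\<And>y. y \<in> S \<Longrightarrow> linear (\<lambda>v. F y (g v))" and g: "\<And>v. g v \<in> I"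
  shows "linear (\<lambda>v. F' x (h # g v))"
proof -
  have D: "((\<lambda>t. F (x + t *\<^sub>R h) (g v)) has_vector_derivative F' x (h # g v)) (at 0)" for v
    by (rule unif_deriv_at_has_vector_derivative[OF d g])
  have "isCont (\<lambda>t. x + t *\<^sub>R h) (0::real)" by (intro continuous_intros)
  then have ev: "\<forall>\<^sub>F t in nhds (0::real). x + t *\<^sub>R h \<in> S"
  proof -
    have "((\<lambda>t. x + t *\<^sub>R h) \<longlongrightarrow> x) (nhds (0::real))"
      using tendsto_at_iff_tendsto_nhds[of "\<lambda>t. x + t *\<^sub>R h" "0::real"] \<open>isCont _ _\<close> by (simp add: isCont_def)
    then show ?thesis using S by (rule topological_tendstoD)
  qed
  have l: "linear (\<lambda>v. F x (g v))" using lin S(2) by blast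
  show ?thesis
  proof (rule linearI)
    fix u v
    have "((\<lambda>t. F (x + t *\<^sub>R h) (g u) + F (x + t *\<^sub>R h) (g v)) has_vector_derivative F' x (h # g (u + v))) (at 0)"
      by (rule has_derivative_transform_eventually[OF D[of "u + v", unfolded has_vector_derivative_def], folded has_vector_derivative_def])
        (use ev lin linear_add l in \<open>auto simp: eventually_at_filter linear_add elim!: eventually_mono\<close>)
    then show "F' x (h # g (u + v)) = F' x (h # g u) + F' x (h # g v)"
      using vector_derivative_unique_at has_vector_derivative_add[OF D[of u] D[of v]] by blast
  next
    fix r v
    have "((\<lambda>t. r *\<^sub>R F (x + t *\<^sub>R h) (g v)) has_vector_derivative F' x (h # g (r *\<^sub>R v))) (at 0)"
      by (rule has_derivative_transform_eventually[OF D[of "r *\<^sub>R v", unfolded has_vector_derivative_def], folded has_vector_derivative_def])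
        (use ev lin linear_scale l in \<open>auto simp: eventually_at_filter linear_scale elim!: eventually_mono\<close>)
    moreover have "((\<lambda>t. r *\<^sub>R F (x + t *\<^sub>R h) (g v)) has_vector_derivative r *\<^sub>R F' x (h # g v)) (at 0)"
      using bounded_linear.has_vector_derivative[OF bounded_linear_scaleR_right D] .
    ultimately show "F' x (h # g (r *\<^sub>R v)) = r *\<^sub>R F' x (h # g v)"
      using vector_derivative_unique_at by blast
  qed
qed

text \<open>The iterates of \<open>dir_deriv\<close> form one sequence of derivatives for all
  orders. Separate witnesses for each \<open>j\<close> would not do for
  \<open>k = \<infinity>\<close>, as \<open>Ck_on\<close> asks for a single sequence.\<close>

lemma unif_Ck_imp_Ck_on:
  assumes U: "\<And>j. enat j \<le> k \<Longrightarrow> unif_Ck j S {[]} (\<lambda>_. 1) (\<lambda>x _. f x)" and S: "open S"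
  shows "Ck_on k S f"
proof -
  define D where "D n = (dir_deriv ^^ n) (\<lambda>x _. f x)" for n
  have it: "unif_Ck (j - n) S (all_lists n) list_weight (D n)" if "n \<le> j" "enat j \<le> k" for n j
    using that(1)
  proof (induction n)
    case 0
    have "all_lists 0 = {[] :: 'a list}" by (auto simp: all_lists_def)
    then show ?case
      using unif_Ck_cong[OF U[OF that(2)] S, of "\<lambda>x _. f x" list_weight] unfolding D_def by simp
  next
    case (Suc n)
    then have "unif_Ck (Suc (j - Suc n)) S (all_lists n) list_weight (D n)" by (simp add: Suc_diff_Suc del: unif_Ck.simps)
    from unif_Ck_Suc_dir_deriv(1)[OF this S]
    have "unif_Ck (j - Suc n) S (all_lists (Suc n)) (cons_weight list_weight) (D (Suc n))"
      by (simp add: cons_set_all_lists D_def)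
    from unif_Ck_cong[OF this S refl cons_weight_list_weight] show ?case .
  qed
  have C: "unif_cont_at (all_lists n) list_weight (D n) x" if "enat n \<le> k" "x \<in> S" for n x
    using it[OF order_refl that(1)] that(2) by simp
  have Df: "unif_deriv_at (all_lists n) list_weight (D n) (D (Suc n)) x" if "enat (Suc n) \<le> k" "x \<in> S" for n x
  proof -
    have "unif_Ck (Suc 0) S (all_lists n) list_weight (D n)" using it[of n "Suc n"] that(1) by simp
    from unif_Ck_Suc_dir_deriv(2)[OF this S that(2)] show ?thesis by (simp add: D_def)
  qed
  \<comment> \<open>Slot 0 is linear because \<open>D (Suc n)\<close> is a derivative; the later
    slots inherit linearity from \<open>D n\<close>.\<close>
  have L: "linear (\<lambda>v. D n x (vs[i := v]))" if "enat n \<le> k" "x \<in> S" "length vs = n" "i < n" for n x vs i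
    using that
  proof (induction n arbitrary: vs i x)
    case (Suc n)
    note d = Df[OF Suc.prems(1,2)]
    obtain h us where vs: "vs = h # us" "length us = n" using Suc.prems(3) by (cases vs) auto
    show ?case
    proof (cases i)
      case 0
      then show ?thesis using d vs unfolding unif_deriv_at_def all_lists_def by simp
    next
      case (Suc i')
      have "linear (\<lambda>v. D (Suc n) x (h # us[i' := v]))"
      proof (rule linear_dir_deriv[OF d S Suc.prems(2)])
        have "enat n \<le> k" using Suc.prems(1) by (meson Suc_ile_eq order.strict_implies_order)
        then show "linear (\<lambda>v. D n y (us[i' := v]))" if "y \<in> S" for y
          using Suc.IH[OF _ that vs(2)] Suc Suc.prems(4) by simp
        show "us[i' := v] \<in> all_lists n" for v using vs by (simp add: all_lists_def)
      qed
      then show ?thesis using Suc vs by simp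
    qed
  qed simp
  have mln: "((\<lambda>y. multilinear_norm n (T y)) \<longlongrightarrow> 0) F"
    if "\<And>e. e > 0 \<Longrightarrow> \<forall>\<^sub>F y in F. \<forall>vs\<in>all_lists n. norm (T y vs) \<le> e * list_weight vs" for n and T :: "'a \<Rightarrow> 'a list \<Rightarrow> 'b" and F
  proof (rule tendstoI)
    fix e :: real assume "e > 0"
    then have "\<forall>\<^sub>F y in F. \<forall>vs\<in>all_lists n. norm (T y vs) \<le> e / 2 * list_weight vs" using that[of "e/2"] by simp
    then show "\<forall>\<^sub>F y in F. dist (multilinear_norm n (T y)) 0 < e"
    proof eventually_elim
      case (elim y)
      then show ?case using multilinear_norm_le[of n "T y" "e/2"] \<open>e > 0\<close> by (force simp: all_lists_def)
    qed
  qed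
  show ?thesis unfolding Ck_on_def
  proof (intro exI[of _ D] conjI ballI allI impI)
    show "D 0 x [] = f x" for x by (simp add: D_def)
    show "bounded_multilinear n (D n x)" if "enat n \<le> k" "x \<in> S" for n x
      using L[OF that] C[OF that] unfolding bounded_multilinear_def unif_cont_at_def all_lists_def list_weight_def by auto
    show "((\<lambda>y. multilinear_norm n (\<lambda>vs. D n y vs - D n x vs)) \<longlongrightarrow> 0) (at x)" if "enat n \<le> k" "x \<in> S" for n x
      by (rule mln) (use C[OF that] in \<open>auto simp: unif_cont_at_def eventually_at_filter elim: eventually_mono\<close>)
    show "((\<lambda>h. multilinear_norm n (\<lambda>vs. D n (x + h) vs - D n x vs - D (Suc n) x (h # vs)) / norm h) \<longlongrightarrow> 0) (at 0)"
      if "enat n < k" "x \<in> S" for n x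
    proof (rule tendstoI)
      fix e :: real assume "e > 0"
      have d: "unif_deriv_at (all_lists n) list_weight (D n) (D (Suc n)) x" using Df that by (simp add: Suc_ile_eq)
      have "\<forall>\<^sub>F h in nhds 0. \<forall>i\<in>all_lists n. norm (D n (x + h) i - D n x i - D (Suc n) x (h # i)) \<le> e / 2 * (norm h * list_weight i)"
        using d half_gt_zero[OF \<open>e > 0\<close>] unfolding unif_deriv_at_def by meson
      then show "\<forall>\<^sub>F h in at 0. dist (multilinear_norm n (\<lambda>vs. D n (x + h) vs - D n x vs - D (Suc n) x (h # vs)) / norm h) 0 < e"
        unfolding eventually_at_filter
      proof eventually_elim
        case (elim h)
        show ?case
        proof
          assume h: "h \<noteq> 0"
          show "h \<in> UNIV \<longrightarrow> dist (multilinear_norm n (\<lambda>vs. D n (x + h) vs - D n x vs - D (Suc n) x (h # vs)) / norm h) 0 < e"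
          proof
          have "0 \<le> multilinear_norm n (\<lambda>vs. D n (x + h) vs - D n x vs - D (Suc n) x (h # vs))"
            "multilinear_norm n (\<lambda>vs. D n (x + h) vs - D n x vs - D (Suc n) x (h # vs)) \<le> e / 2 * norm h"
            using elim \<open>e > 0\<close> multilinear_norm_le[of n "\<lambda>vs. D n (x + h) vs - D n x vs - D (Suc n) x (h # vs)" "e / 2 * norm h"]
            by (auto simp: all_lists_def mult.assoc)
          moreover have "e / 2 * norm h < e * norm h" using h \<open>e > 0\<close> by simp
          ultimately show "dist (multilinear_norm n (\<lambda>vs. D n (x + h) vs - D n x vs - D (Suc n) x (h # vs)) / norm h) 0 < e"
            using h by (simp add: divide_less_eq)
          qed
        qed
      qed
    qed
  qed
qed

lemma Ck_on_iff:
  "open S \<Longrightarrow> Ck_on k S f \<longleftrightarrow> (\<forall>j. enat j \<le> k \<longrightarrow> unif_Ck j S {[]} (\<lambda>_. 1) (\<lambda>x _. f x))"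
  using Ck_on_imp_unif_Ck unif_Ck_imp_Ck_on by blast

lemma Ck_on_const: "open S \<Longrightarrow> Ck_on k S (\<lambda>_. c)"
  by (simp add: Ck_on_iff unif_Ck_const)

lemma Ck_on_add: "open S \<Longrightarrow> Ck_on k S f \<Longrightarrow> Ck_on k S g \<Longrightarrow> Ck_on k S (\<lambda>x. f x + g x)"
  by (simp add: Ck_on_iff unif_Ck_add)

lemma Ck_on_mult:
  fixes f g :: "'a::real_normed_vector \<Rightarrow> real"
  assumes "open S" "Ck_on k S f" "Ck_on k S g"
  shows "Ck_on k S (\<lambda>x. f x * g x)"
  using assms unif_Ck_mult[of _ S "{[]}" "\<lambda>_. 1" "\<lambda>x _. f x" "\<lambda>_. 1" "\<lambda>x _. g x"]
  by (simp add: Ck_on_iff)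

lemma Ck_on_compose_smooth:
  "open S \<Longrightarrow> smooth_real \<sigma> \<Longrightarrow> Ck_on k S f \<Longrightarrow> Ck_on k S (\<lambda>x. \<sigma> (f x))"
  by (simp add: Ck_on_iff unif_Ck_compose_smooth)

lemma Ck_on_local:
  assumes "open S" "\<And>x. x \<in> S \<Longrightarrow> \<exists>T g. open T \<and> x \<in> T \<and> T \<subseteq> S \<and> Ck_on k S g \<and> (\<forall>y\<in>T. f y = g y)"
  shows "Ck_on k S f"
  unfolding Ck_on_iff[OF assms(1)]
proof (intro allI impI)
  fix j assume j: "enat j \<le> k"
  show "unif_Ck j S {[]} (\<lambda>_. 1) (\<lambda>x _. f x)"
  proof (rule unif_Ck_local)
    fix x assume "x \<in> S"
    then obtain T g where T: "open T" "x \<in> T" "T \<subseteq> S" "Ck_on k S g" "\<forall>y\<in>T. f y = g y" using assms(2) by blast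
    then have "unif_Ck j S {[]} (\<lambda>_. 1) (\<lambda>x _. g x)" using j Ck_on_iff[OF assms(1)] by blast
    then have "unif_Ck j T {[]} (\<lambda>_. 1) (\<lambda>x _. g x)" using T(3) by (rule unif_Ck_subset)
    then have "unif_Ck j T {[]} (\<lambda>_. 1) (\<lambda>x _. f x)"
      by (rule unif_Ck_cong[OF _ T(1)]) (use T(5) in auto)
    then show "\<exists>T. open T \<and> x \<in> T \<and> unif_Ck j T {[]} (\<lambda>_. 1) (\<lambda>x _. f x)" using T by blast
  qed
qed

lemma Ck_on_has_derivative:
  assumes "Ck_on k S f" "open S" "1 \<le> k"
  shows "\<exists>D. \<forall>x\<in>S. (f has_derivative D x) (at x) \<and> (\<forall>h. isCont (\<lambda>x. D x h) x)"
proof -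
  have "unif_Ck (Suc 0) S {[]} (\<lambda>_. 1) (\<lambda>x _. f x)"
    using assms(1,3) Ck_on_iff[OF assms(2)] unfolding one_enat_def One_nat_def by blast
  from unif_Ck_has_derivative[OF this] obtain F' where
    "\<forall>x\<in>S. (f has_derivative (\<lambda>h. F' x [h])) (at x) \<and> (\<forall>h. isCont (\<lambda>x. F' x [h]) x)" by meson
  then show ?thesis by (intro exI[of _ "\<lambda>x h. F' x [h]"])
qed

section \<open>Tangent vectors and slopes\<close>

locale finsler_manifold =
  fixes A :: "('m::t2_space, 'x::banach) chart set"
    and N :: "('m, 'x) finsler_structure"
    and l :: enat
  assumes NU: "NU_finsler_manifold l A N" and l1: "1 \<le> l"
begin

lemma manifold: "banach_manifold l A"
  using NU by (simp add: NU_finsler_manifold_def)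

lemma chart_at: "\<exists>\<kappa>\<in>A. x \<in> chart_dom \<kappa>"
  using manifold unfolding banach_manifold_def by blast

lemma charts: "\<kappa> \<in> A \<Longrightarrow> is_chart \<kappa>"
  using manifold unfolding banach_manifold_def by blast

lemma open_chart_dom: "\<kappa> \<in> A \<Longrightarrow> open (chart_dom \<kappa>)"
  and open_chart_img: "\<kappa> \<in> A \<Longrightarrow> open (chart_map \<kappa> ` chart_dom \<kappa>)"
  and homeo: "\<kappa> \<in> A \<Longrightarrow> homeomorphism (chart_dom \<kappa>) (chart_map \<kappa> ` chart_dom \<kappa>) (chart_map \<kappa>) (chart_inv \<kappa>)"
  using charts unfolding is_chart_def by blast+

lemma chart_inv_map: "\<kappa> \<in> A \<Longrightarrow> x \<in> chart_dom \<kappa> \<Longrightarrow> chart_inv \<kappa> (chart_map \<kappa> x) = x"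
  by (rule homeomorphism_apply1[OF homeo])

lemma isCont_chart_map: "\<kappa> \<in> A \<Longrightarrow> x \<in> chart_dom \<kappa> \<Longrightarrow> isCont (chart_map \<kappa>) x"
  using homeomorphism_cont1[OF homeo] open_chart_dom continuous_on_eq_continuous_at by blast

lemma chart_img_open:
  assumes "\<kappa> \<in> A" "open U"
  shows "open (chart_map \<kappa> ` (chart_dom \<kappa> \<inter> U))"
proof -
  have "chart_map \<kappa> ` (chart_dom \<kappa> \<inter> U) = chart_map \<kappa> ` chart_dom \<kappa> \<inter> chart_inv \<kappa> -` U"
    using chart_inv_map[OF assms(1)] by (auto simp: image_iff)
  then show ?thesis
    using continuous_open_preimage[OF homeomorphism_cont2[OF homeo[OF assms(1)]] open_chart_img[OF assms(1)] assms(2)] by simp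
qed

abbreviation tdiff :: "('m, 'x) chart \<Rightarrow> ('m, 'x) chart \<Rightarrow> 'm \<Rightarrow> 'x \<Rightarrow> 'x" where
  "tdiff \<kappa> \<kappa>' x \<equiv> frechet_derivative (chart_map \<kappa>' \<circ> chart_inv \<kappa>) (at (chart_map \<kappa> x))"

lemma transition_C1:
  assumes "\<kappa> \<in> A" "\<kappa>' \<in> A" "x \<in> chart_dom \<kappa>" "x \<in> chart_dom \<kappa>'"
  shows "((chart_map \<kappa>' \<circ> chart_inv \<kappa>) has_derivative tdiff \<kappa> \<kappa>' x) (at (chart_map \<kappa> x))"
    and "isCont (\<lambda>y. frechet_derivative (chart_map \<kappa>' \<circ> chart_inv \<kappa>) (at y) v) (chart_map \<kappa> x)"
proof -
  let ?S = "chart_map \<kappa> ` (chart_dom \<kappa> \<inter> chart_dom \<kappa>')"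
  have S: "open ?S" using chart_img_open assms open_chart_dom by blast
  have x: "chart_map \<kappa> x \<in> ?S" using assms by blast
  have "Ck_on l ?S (chart_map \<kappa>' \<circ> chart_inv \<kappa>)"
    using manifold assms unfolding banach_manifold_def compatible_charts_def by blast
  from Ck_on_has_derivative[OF this S l1] obtain D where
    D: "\<And>y. y \<in> ?S \<Longrightarrow> ((chart_map \<kappa>' \<circ> chart_inv \<kappa>) has_derivative D y) (at y)"
    and c: "\<And>y h. y \<in> ?S \<Longrightarrow> isCont (\<lambda>x. D x h) y" by blast
  have eq: "frechet_derivative (chart_map \<kappa>' \<circ> chart_inv \<kappa>) (at y) = D y" if "y \<in> ?S" for y
    using frechet_derivative_at[OF D[OF that]] by simp
  show "((chart_map \<kappa>' \<circ> chart_inv \<kappa>) has_derivative tdiff \<kappa> \<kappa>' x) (at (chart_map \<kappa> x))"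
    using D[OF x] eq[OF x] by simp
  have "\<forall>\<^sub>F y in nhds (chart_map \<kappa> x). frechet_derivative (chart_map \<kappa>' \<circ> chart_inv \<kappa>) (at y) v = D y v"
    using eventually_nhds_in_open[OF S x] by eventually_elim (simp add: eq)
  then show "isCont (\<lambda>y. frechet_derivative (chart_map \<kappa>' \<circ> chart_inv \<kappa>) (at y) v) (chart_map \<kappa> x)"
    using c[OF x, of v] isCont_cong by fast
qed

text \<open>On the open image of the overlap, \<open>f\<close> read in one chart is \<open>f\<close>
  read in the other after the transition map. The codomain is general: with a chart map for
  \<open>f\<close> this becomes the cocycle rule for \<open>tdiff\<close>.\<close>

lemma change_chart_has_derivative:
  assumes D: "((f \<circ> chart_inv \<kappa>') has_derivative D) (at (chart_map \<kappa>' x))"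
    and \<kappa>: "\<kappa> \<in> A" "\<kappa>' \<in> A" "x \<in> chart_dom \<kappa>" "x \<in> chart_dom \<kappa>'"
  shows "((f \<circ> chart_inv \<kappa>) has_derivative (\<lambda>v. D (tdiff \<kappa> \<kappa>' x v))) (at (chart_map \<kappa> x))"
proof -
  have "((f \<circ> chart_inv \<kappa>') has_derivative D) (at ((chart_map \<kappa>' \<circ> chart_inv \<kappa>) (chart_map \<kappa> x)))"
    using D chart_inv_map[OF \<kappa>(1,3)] by simp
  from diff_chain_at[OF transition_C1(1)[OF \<kappa>] this]
  have "(((f \<circ> chart_inv \<kappa>') \<circ> (chart_map \<kappa>' \<circ> chart_inv \<kappa>)) has_derivative (\<lambda>v. D (tdiff \<kappa> \<kappa>' x v))) (at (chart_map \<kappa> x))"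
    by (simp add: comp_def)
  then show ?thesis
    by (rule has_derivative_transform_within_open[OF _ chart_img_open[OF \<kappa>(1) open_chart_dom[OF \<kappa>(2)]]])
      (use \<kappa> chart_inv_map in \<open>auto\<close>)
qed

lemma tdiff_trans:
  assumes "\<kappa> \<in> A" "\<kappa>' \<in> A" "\<kappa>'' \<in> A" "x \<in> chart_dom \<kappa>" "x \<in> chart_dom \<kappa>'" "x \<in> chart_dom \<kappa>''"
  shows "tdiff \<kappa> \<kappa>'' x v = tdiff \<kappa>' \<kappa>'' x (tdiff \<kappa> \<kappa>' x v)"
  using frechet_derivative_at[OF change_chart_has_derivative[OF transition_C1(1)[OF assms(2,3,5,6)] assms(1,2,4,5)]]
  by (simp add: fun_eq_iff)

lemma tdiff_refl:
  assumes "\<kappa> \<in> A" "x \<in> chart_dom \<kappa>"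
  shows "tdiff \<kappa> \<kappa> x v = v"
proof -
  have "((\<lambda>y. y) has_derivative (\<lambda>v. v)) (at (chart_map \<kappa> x))" by (rule has_derivative_ident)
  then have "((chart_map \<kappa> \<circ> chart_inv \<kappa>) has_derivative (\<lambda>v. v)) (at (chart_map \<kappa> x))"
    by (rule has_derivative_transform_within_open[OF _ open_chart_img[OF assms(1)]])
      (use assms chart_inv_map in auto)
  from frechet_derivative_at[OF this] show ?thesis by (simp add: fun_eq_iff)
qed

lemma tdiff_linear:
  assumes "\<kappa> \<in> A" "\<kappa>' \<in> A" "x \<in> chart_dom \<kappa>" "x \<in> chart_dom \<kappa>'"
  shows "linear (tdiff \<kappa> \<kappa>' x)"
  using has_derivative_linear[OF transition_C1(1)[OF assms]] .

lemma tangent_vec_change: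
  assumes "\<kappa> \<in> A" "\<kappa>' \<in> A" "x \<in> chart_dom \<kappa>" "x \<in> chart_dom \<kappa>'"
  shows "tangent_vec A x \<kappa> v = tangent_vec A x \<kappa>' (tdiff \<kappa> \<kappa>' x v)"
  unfolding tangent_vec_def using tdiff_trans[OF assms(1,2) _ assms(3,4)] by auto

lemma tangent_vec_mem:
  "\<kappa> \<in> A \<Longrightarrow> x \<in> chart_dom \<kappa> \<Longrightarrow> (\<kappa>, w) \<in> tangent_vec A x \<kappa> v \<longleftrightarrow> w = v"
  unfolding tangent_vec_def by (simp add: tdiff_refl)

lemma tangent_vec_in_space: "\<kappa> \<in> A \<Longrightarrow> x \<in> chart_dom \<kappa> \<Longrightarrow> tangent_vec A x \<kappa> v \<in> tangent_space A x"
  unfolding tangent_space_def by blast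

lemma tangent_spaceE:
  assumes "\<tau> \<in> tangent_space A x" "\<kappa> \<in> A" "x \<in> chart_dom \<kappa>"
  obtains v where "\<tau> = tangent_vec A x \<kappa> v"
  using assms tangent_vec_change unfolding tangent_space_def by blast

lemma chart_diff_tangent_vec:
  "\<kappa> \<in> A \<Longrightarrow> x \<in> chart_dom \<kappa> \<Longrightarrow> chart_diff \<kappa> (tangent_vec A x \<kappa> v) = v"
  unfolding chart_diff_def by (simp add: tangent_vec_mem)

lemma tangent_scale_vec:
  assumes "\<kappa> \<in> A" "x \<in> chart_dom \<kappa>"
  shows "tangent_scale a (tangent_vec A x \<kappa> v) = tangent_vec A x \<kappa> (a *\<^sub>R v)"
  unfolding tangent_scale_def tangent_vec_def
  using linear_scale[OF tdiff_linear[OF assms(1) _ assms(2)]] by auto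

lemma norm_on_tangent: "norm_on_tangent_space A N x"
  using NU by (simp add: NU_finsler_manifold_def finsler_P1_def)

lemma N_nonneg: "\<kappa> \<in> A \<Longrightarrow> x \<in> chart_dom \<kappa> \<Longrightarrow> 0 \<le> N x (tangent_vec A x \<kappa> v)"
  using norm_on_tangent tangent_vec_in_space unfolding norm_on_tangent_space_def by blast

lemma N_scale: "\<kappa> \<in> A \<Longrightarrow> x \<in> chart_dom \<kappa> \<Longrightarrow> N x (tangent_vec A x \<kappa> (a *\<^sub>R v)) = \<bar>a\<bar> * N x (tangent_vec A x \<kappa> v)"
  using norm_on_tangent tangent_vec_in_space tangent_scale_vec unfolding norm_on_tangent_space_def by metis

lemma N_zero: "\<kappa> \<in> A \<Longrightarrow> x \<in> chart_dom \<kappa> \<Longrightarrow> N x (tangent_vec A x \<kappa> 0) = 0"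
  using N_scale[of \<kappa> x 0 0] by simp

lemma N_equiv:
  assumes "\<kappa> \<in> A" "x \<in> chart_dom \<kappa>"
  obtains c where "c > 0" "\<And>v. c * norm v \<le> N x (tangent_vec A x \<kappa> v)"
  using NU assms that unfolding NU_finsler_manifold_def finsler_P1_def equivalent_to_norm_def by meson

text \<open>This is (NU1) in coordinates, and the link between the topology and the Finsler metric:
  inside the chart a coordinate segment has length at most \<open>K\<close> times its norm.\<close>

lemma N_local_bound:
  obtains \<kappa> K where "\<kappa> \<in> A" "x0 \<in> chart_dom \<kappa>" "0 < K"
    "\<And>x v. x \<in> chart_dom \<kappa> \<Longrightarrow> N x (tangent_vec A x \<kappa> v) \<le> K * norm v"
proof -
  obtain \<kappa> K where \<kappa>: "\<kappa> \<in> A" "x0 \<in> chart_dom \<kappa>" "1 \<le> K"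
    and b: "\<And>x \<tau>. x \<in> chart_dom \<kappa> \<Longrightarrow> \<tau> \<in> tangent_space A x \<Longrightarrow> 1 / K * N x \<tau> \<le> norm (chart_diff \<kappa> \<tau>)"
    using NU unfolding NU_finsler_manifold_def finsler_NU1_def by meson
  have "N x (tangent_vec A x \<kappa> v) \<le> K * norm v" if "x \<in> chart_dom \<kappa>" for x v
    using b[OF that tangent_vec_in_space[OF \<kappa>(1) that], of v] \<kappa>(3) chart_diff_tangent_vec[OF \<kappa>(1) that]
    by (simp add: field_simps)
  then show ?thesis using that \<kappa> by (metis less_le_trans zero_less_one)
qed

text \<open>Differentiability is part of this bound, whereas \<open>differential_norm\<close> is a
  supremum that carries no information for a non-differentiable \<open>g\<close> or an unbounded
  set. Quantifying over all charts lets several functions be treated in one common chart.\<close>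

definition slope_le :: "('m \<Rightarrow> real) \<Rightarrow> 'm \<Rightarrow> real \<Rightarrow> bool" where
  "slope_le g x L \<longleftrightarrow> (\<forall>\<kappa>\<in>A. x \<in> chart_dom \<kappa> \<longrightarrow>
     (\<exists>D. ((g \<circ> chart_inv \<kappa>) has_derivative D) (at (chart_map \<kappa> x)) \<and>
        (\<forall>v. \<bar>D v\<bar> \<le> L * N x (tangent_vec A x \<kappa> v))))"

text \<open>One chart is enough, since the derivative and the coordinates of a tangent vector change
  by the same transition map.\<close>

lemma slope_leI:
  assumes "\<kappa>' \<in> A" "x \<in> chart_dom \<kappa>'" "((g \<circ> chart_inv \<kappa>') has_derivative D) (at (chart_map \<kappa>' x))"
    "\<And>v. \<bar>D v\<bar> \<le> L * N x (tangent_vec A x \<kappa>' v)"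
  shows "slope_le g x L"
  unfolding slope_le_def
proof (intro ballI impI)
  fix \<kappa> assume \<kappa>: "\<kappa> \<in> A" "x \<in> chart_dom \<kappa>"
  note d = change_chart_has_derivative[OF assms(3) \<kappa>(1) assms(1) \<kappa>(2) assms(2)]
  show "\<exists>D. ((g \<circ> chart_inv \<kappa>) has_derivative D) (at (chart_map \<kappa> x)) \<and>
        (\<forall>v. \<bar>D v\<bar> \<le> L * N x (tangent_vec A x \<kappa> v))"
    by (rule exI, rule conjI[OF d]) (use assms(4) tangent_vec_change[OF \<kappa>(1) assms(1) \<kappa>(2) assms(2)] in simp)
qed

lemma slope_le_mono: "slope_le g x L \<Longrightarrow> L \<le> L' \<Longrightarrow> slope_le g x L'"
  unfolding slope_le_def by (meson N_nonneg mult_right_mono order_trans)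

text \<open>The definite description in \<open>differential\<close> is justified: by the change of
  charts every representative gives the value \<open>D v\<close>, and \<open>(\<kappa>, v)\<close>
  is a representative.\<close>

lemma differential_tangent_vec:
  assumes "((g \<circ> chart_inv \<kappa>) has_derivative D) (at (chart_map \<kappa> x))" "\<kappa> \<in> A" "x \<in> chart_dom \<kappa>"
  shows "differential g x (tangent_vec A x \<kappa> v) = D v"
proof -
  have "frechet_derivative (g \<circ> chart_inv \<kappa>') (at (chart_map \<kappa>' x)) (tdiff \<kappa> \<kappa>' x v) = D v"
    if "\<kappa>' \<in> A" "x \<in> chart_dom \<kappa>'" for \<kappa>'
  proof -
    have "tdiff \<kappa>' \<kappa> x (tdiff \<kappa> \<kappa>' x v) = v"
      using tdiff_trans[OF assms(2) that(1) assms(2,3) that(2) assms(3)] tdiff_refl[OF assms(2,3)] by metis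
    then show ?thesis
      using frechet_derivative_at[OF change_chart_has_derivative[OF assms(1) that(1) assms(2) that(2) assms(3)]] by metis
  qed
  then have 1: "\<forall>(\<kappa>', w)\<in>tangent_vec A x \<kappa> v. D v = frechet_derivative (g \<circ> chart_inv \<kappa>') (at (chart_map \<kappa>' x)) w"
    unfolding tangent_vec_def by auto
  have 2: "(\<kappa>, v) \<in> tangent_vec A x \<kappa> v" using assms(2,3) tangent_vec_mem by blast
  have "(\<forall>(\<kappa>', w)\<in>tangent_vec A x \<kappa> v. r = frechet_derivative (g \<circ> chart_inv \<kappa>') (at (chart_map \<kappa>' x)) w) \<longleftrightarrow> r = D v" for r
  proof
    assume "\<forall>(\<kappa>', w)\<in>tangent_vec A x \<kappa> v. r = frechet_derivative (g \<circ> chart_inv \<kappa>') (at (chart_map \<kappa>' x)) w"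
    from bspec[OF this 2] bspec[OF 1 2] show "r = D v" by simp
  qed (use 1 in simp)
  then show ?thesis unfolding differential_def by simp
qed

lemma differential_norm_le:
  assumes "slope_le g x L" "0 \<le> L"
  shows "differential_norm A N g x \<le> L"
proof -
  obtain \<kappa> where \<kappa>: "\<kappa> \<in> A" "x \<in> chart_dom \<kappa>" using chart_at by blast
  obtain D where D: "((g \<circ> chart_inv \<kappa>) has_derivative D) (at (chart_map \<kappa> x))"
    "\<And>v. \<bar>D v\<bar> \<le> L * N x (tangent_vec A x \<kappa> v)" using assms(1) \<kappa> unfolding slope_le_def by blast
  show ?thesis unfolding differential_norm_def
  proof (rule cSup_least)
    \<comment> \<open>Bounding a supremum from above requires a nonempty set; the zero vector
      supplies a member.\<close>
    show "{\<bar>differential g x \<tau>\<bar> |\<tau>. \<tau> \<in> tangent_space A x \<and> N x \<tau> \<le> 1} \<noteq> {}"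
      using tangent_vec_in_space[OF \<kappa>, of 0] N_zero[OF \<kappa>] by force
    fix m assume "m \<in> {\<bar>differential g x \<tau>\<bar> |\<tau>. \<tau> \<in> tangent_space A x \<and> N x \<tau> \<le> 1}"
    then obtain v where v: "m = \<bar>differential g x (tangent_vec A x \<kappa> v)\<bar>" "N x (tangent_vec A x \<kappa> v) \<le> 1"
      using tangent_spaceE[OF _ \<kappa>] by (smt (verit, best) mem_Collect_eq)
    then have "m \<le> L * N x (tangent_vec A x \<kappa> v)" using D differential_tangent_vec[OF D(1) \<kappa>] by simp
    also have "\<dots> \<le> L * 1" using v(2) assms(2) by (intro mult_left_mono)
    finally show "m \<le> L" by simp
  qed
qed

text \<open>The lower estimate in (P1) bounds the coordinates of the Finsler unit ball, so the
  supremum runs over a bounded set and dominates its members. Homogeneity extends the estimate from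
  the unit ball to all vectors.\<close>

lemma slope_le_differential_norm:
  assumes D: "((g \<circ> chart_inv \<kappa>) has_derivative D) (at (chart_map \<kappa> x))" and \<kappa>: "\<kappa> \<in> A" "x \<in> chart_dom \<kappa>"
    and le: "differential_norm A N g x \<le> L"
  shows "slope_le g x L"
proof (rule slope_leI[OF \<kappa> D])
  fix v
  let ?n = "\<lambda>v. N x (tangent_vec A x \<kappa> v)"
  obtain c where c: "c > 0" "\<And>v. c * norm v \<le> ?n v" using N_equiv[OF \<kappa>] by blast
  obtain B where B: "B > 0" "\<And>v. \<bar>D v\<bar> \<le> norm v * B"
    using bounded_linear.pos_bounded[OF has_derivative_bounded_linear[OF D]] by auto
  have sup: "\<bar>D w\<bar> \<le> L" if "?n w \<le> 1" for w
  proof -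
    have "\<bar>D w\<bar> \<le> differential_norm A N g x"
      unfolding differential_norm_def
    proof (rule cSup_upper)
      show "\<bar>D w\<bar> \<in> {\<bar>differential g x \<tau>\<bar> |\<tau>. \<tau> \<in> tangent_space A x \<and> N x \<tau> \<le> 1}"
        using that tangent_vec_in_space[OF \<kappa>, of w] differential_tangent_vec[OF D \<kappa>, of w] by force
      show "bdd_above {\<bar>differential g x \<tau>\<bar> |\<tau>. \<tau> \<in> tangent_space A x \<and> N x \<tau> \<le> 1}"
      proof (rule bdd_aboveI)
        fix m assume "m \<in> {\<bar>differential g x \<tau>\<bar> |\<tau>. \<tau> \<in> tangent_space A x \<and> N x \<tau> \<le> 1}"
        then obtain u where u: "m = \<bar>D u\<bar>" "?n u \<le> 1"
          using tangent_spaceE[OF _ \<kappa>] differential_tangent_vec[OF D \<kappa>] by (smt (verit, best) mem_Collect_eq)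
        have "c * norm u \<le> 1" using c(2)[of u] u(2) by linarith
        then have "norm u \<le> 1 / c" using c(1) by (simp add: field_simps)
        then have "norm u * B \<le> 1 / c * B" using B(1) by (intro mult_right_mono) auto
        then show "m \<le> 1 / c * B" using B(2)[of u] u(1) by linarith
      qed
    qed
    then show ?thesis using le by linarith
  qed
  show "\<bar>D v\<bar> \<le> L * ?n v"
  proof (cases "?n v = 0")
    case True
    then have "v = 0" using c(1) c(2)[of v] by (simp add: mult_le_0_iff)
    then show ?thesis using linear_0[OF has_derivative_linear[OF D]] True by simp
  next
    case False
    then have pos: "?n v > 0" using N_nonneg[OF \<kappa>, of v] by linarith
    have "?n (inverse (?n v) *\<^sub>R v) = 1" using N_scale[OF \<kappa>] pos by simp
    then have "\<bar>D (inverse (?n v) *\<^sub>R v)\<bar> \<le> L" using sup by simp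
    then show ?thesis using linear_scale[OF has_derivative_linear[OF D]] pos by (simp add: abs_mult field_simps)
  qed
qed

lemma slope_le_chart:
  obtains \<kappa> where "\<kappa> \<in> A" "x \<in> chart_dom \<kappa>"
    "\<And>g L. slope_le g x L \<Longrightarrow> \<exists>D. ((g \<circ> chart_inv \<kappa>) has_derivative D) (at (chart_map \<kappa> x)) \<and>
        (\<forall>v. \<bar>D v\<bar> \<le> L * N x (tangent_vec A x \<kappa> v))"
  using chart_at that unfolding slope_le_def by metis

lemma slope_le_local:
  assumes "slope_le g' x L" "open U" "x \<in> U" "\<And>y. y \<in> U \<Longrightarrow> g y = g' y"
  shows "slope_le g x L"
proof -
  obtain \<kappa> D where \<kappa>: "\<kappa> \<in> A" "x \<in> chart_dom \<kappa>"
    and D: "((g' \<circ> chart_inv \<kappa>) has_derivative D) (at (chart_map \<kappa> x))" "\<And>v. \<bar>D v\<bar> \<le> L * N x (tangent_vec A x \<kappa> v)"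
    using slope_le_chart assms(1) by metis
  have "((g \<circ> chart_inv \<kappa>) has_derivative D) (at (chart_map \<kappa> x))"
    by (rule has_derivative_transform_within_open[OF D(1) chart_img_open[OF \<kappa>(1) assms(2)]])
      (use \<kappa> assms chart_inv_map[OF \<kappa>(1)] in auto)
  then show ?thesis by (rule slope_leI[OF \<kappa> _ D(2)])
qed

lemma slope_le_isCont:
  assumes "slope_le g x L"
  shows "isCont g x"
proof -
  obtain \<kappa> D where \<kappa>: "\<kappa> \<in> A" "x \<in> chart_dom \<kappa>"
    and D: "((g \<circ> chart_inv \<kappa>) has_derivative D) (at (chart_map \<kappa> x))"
    using slope_le_chart assms by metis
  have "isCont (\<lambda>y. (g \<circ> chart_inv \<kappa>) (chart_map \<kappa> y)) x"
    by (rule isCont_o2[OF isCont_chart_map[OF \<kappa>] has_derivative_continuous[OF D]])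
  moreover have "\<forall>\<^sub>F y in nhds x. (g \<circ> chart_inv \<kappa>) (chart_map \<kappa> y) = g y"
    using eventually_nhds_in_open[OF open_chart_dom[OF \<kappa>(1)] \<kappa>(2)]
    by eventually_elim (simp add: chart_inv_map[OF \<kappa>(1)])
  ultimately show ?thesis using isCont_cong by fast
qed

lemma slope_le_const: "slope_le (\<lambda>_. c) x 0"
  by (rule slope_le_chart) (auto intro!: slope_leI simp: comp_def)

lemma slope_le_add:
  assumes "slope_le f x L" "slope_le g x L'"
  shows "slope_le (\<lambda>x. f x + g x) x (L + L')"
proof -
  obtain \<kappa> D D' where \<kappa>: "\<kappa> \<in> A" "x \<in> chart_dom \<kappa>"
    and D: "((f \<circ> chart_inv \<kappa>) has_derivative D) (at (chart_map \<kappa> x))" "\<And>v. \<bar>D v\<bar> \<le> L * N x (tangent_vec A x \<kappa> v)"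
    and D': "((g \<circ> chart_inv \<kappa>) has_derivative D') (at (chart_map \<kappa> x))" "\<And>v. \<bar>D' v\<bar> \<le> L' * N x (tangent_vec A x \<kappa> v)"
    using slope_le_chart assms by metis
  show ?thesis
  proof (rule slope_leI[OF \<kappa>])
    show "((\<lambda>x. f x + g x) \<circ> chart_inv \<kappa> has_derivative (\<lambda>v. D v + D' v)) (at (chart_map \<kappa> x))"
      using has_derivative_add[OF D(1) D'(1)] by (simp add: comp_def)
    show "\<bar>D v + D' v\<bar> \<le> (L + L') * N x (tangent_vec A x \<kappa> v)" for v
      using order_trans[OF abs_triangle_ineq add_mono[OF D(2) D'(2)]] by (simp add: distrib_right)
  qed
qed

lemma slope_le_compose:
  assumes "slope_le g x L" "(\<sigma> has_real_derivative s) (at (g x))" "\<bar>s\<bar> \<le> K"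
  shows "slope_le (\<lambda>x. \<sigma> (g x)) x (K * L)"
proof -
  obtain \<kappa> D where \<kappa>: "\<kappa> \<in> A" "x \<in> chart_dom \<kappa>"
    and D: "((g \<circ> chart_inv \<kappa>) has_derivative D) (at (chart_map \<kappa> x))" "\<And>v. \<bar>D v\<bar> \<le> L * N x (tangent_vec A x \<kappa> v)"
    using slope_le_chart assms by metis
  have "(\<sigma> has_derivative (\<lambda>t. s * t)) (at ((g \<circ> chart_inv \<kappa>) (chart_map \<kappa> x)))"
    using assms(2) chart_inv_map[OF \<kappa>] by (simp add: has_field_derivative_def)
  from has_derivative_compose[OF D(1) this]
  have "((\<lambda>x. \<sigma> (g x)) \<circ> chart_inv \<kappa> has_derivative (\<lambda>v. s * D v)) (at (chart_map \<kappa> x))" by (simp add: comp_def)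
  moreover have "\<bar>s * D v\<bar> \<le> K * L * N x (tangent_vec A x \<kappa> v)" for v
  proof -
    have "\<bar>s\<bar> * \<bar>D v\<bar> \<le> K * (L * N x (tangent_vec A x \<kappa> v))" using assms(3) D(2) by (intro mult_mono') auto
    then show ?thesis by (simp add: abs_mult mult.assoc)
  qed
  ultimately show ?thesis by (rule slope_leI[OF \<kappa>])
qed

text \<open>No constant is lost, so the bound survives any number of iterations.\<close>

lemma slope_le_smooth_max:
  assumes "slope_le f x L" "slope_le g x L" "(\<sigma> has_real_derivative s) (at (g x - f x))" "0 \<le> s" "s \<le> 1"
  shows "slope_le (\<lambda>x. f x + \<sigma> (g x - f x)) x L"
proof -
  obtain \<kappa> D D' where \<kappa>: "\<kappa> \<in> A" "x \<in> chart_dom \<kappa>"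
    and D: "((f \<circ> chart_inv \<kappa>) has_derivative D) (at (chart_map \<kappa> x))" "\<And>v. \<bar>D v\<bar> \<le> L * N x (tangent_vec A x \<kappa> v)"
    and D': "((g \<circ> chart_inv \<kappa>) has_derivative D') (at (chart_map \<kappa> x))" "\<And>v. \<bar>D' v\<bar> \<le> L * N x (tangent_vec A x \<kappa> v)"
    using slope_le_chart assms by metis
  have "(\<sigma> has_derivative (\<lambda>t. s * t)) (at ((g \<circ> chart_inv \<kappa>) (chart_map \<kappa> x) - (f \<circ> chart_inv \<kappa>) (chart_map \<kappa> x)))"
    using assms(3) chart_inv_map[OF \<kappa>] by (simp add: has_field_derivative_def)
  from has_derivative_add[OF D(1) has_derivative_compose[OF has_derivative_diff[OF D'(1) D(1)] this]]
  have "((\<lambda>x. f x + \<sigma> (g x - f x)) \<circ> chart_inv \<kappa> has_derivative (\<lambda>v. D v + s * (D' v - D v))) (at (chart_map \<kappa> x))"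
    by (simp add: comp_def)
  moreover have "\<bar>D v + s * (D' v - D v)\<bar> \<le> L * N x (tangent_vec A x \<kappa> v)" for v
  proof -
    let ?B = "L * N x (tangent_vec A x \<kappa> v)"
    have "D v + s * (D' v - D v) = (1 - s) * D v + s * D' v" by (simp add: algebra_simps)
    then have "\<bar>D v + s * (D' v - D v)\<bar> \<le> (1 - s) * \<bar>D v\<bar> + s * \<bar>D' v\<bar>"
      using assms(4,5) by (metis abs_mult abs_of_nonneg abs_triangle_ineq diff_ge_0_iff_ge)
    also have "\<dots> \<le> (1 - s) * ?B + s * ?B" using assms(4,5) D(2) D'(2) by (intro add_mono mult_left_mono) auto
    finally show ?thesis by (simp add: algebra_simps)
  qed
  ultimately show ?thesis by (rule slope_leI[OF \<kappa>])
qed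

text \<open>Product rule: the term with the derivative of \<open>f\<close> costs at most
  \<open>L\<close>, and the derivative of the cutoff costs at most \<open>K * L\<close> because
  \<open>f\<close> is bounded by 1 at \<open>x\<close>.\<close>

lemma slope_le_cutoff:
  assumes "slope_le f x L" "slope_le g x L" "(\<tau> has_real_derivative s) (at (g x))" "\<bar>s\<bar> \<le> K"
    "\<bar>f x\<bar> \<le> 1" "0 \<le> \<tau> (g x)" "\<tau> (g x) \<le> 1"
  shows "slope_le (\<lambda>x. f x * (1 - \<tau> (g x))) x ((1 + K) * L)"
proof -
  obtain \<kappa> D D' where \<kappa>: "\<kappa> \<in> A" "x \<in> chart_dom \<kappa>"
    and D: "((f \<circ> chart_inv \<kappa>) has_derivative D) (at (chart_map \<kappa> x))" "\<And>v. \<bar>D v\<bar> \<le> L * N x (tangent_vec A x \<kappa> v)"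
    and D': "((g \<circ> chart_inv \<kappa>) has_derivative D') (at (chart_map \<kappa> x))" "\<And>v. \<bar>D' v\<bar> \<le> L * N x (tangent_vec A x \<kappa> v)"
    using slope_le_chart assms by metis
  have "(\<tau> has_derivative (\<lambda>t. s * t)) (at ((g \<circ> chart_inv \<kappa>) (chart_map \<kappa> x)))"
    using assms(3) chart_inv_map[OF \<kappa>] by (simp add: has_field_derivative_def)
  from has_derivative_mult[OF D(1) has_derivative_diff[OF has_derivative_const[of 1] has_derivative_compose[OF D'(1) this]]]
  have "((\<lambda>x. f x * (1 - \<tau> (g x))) \<circ> chart_inv \<kappa> has_derivative (\<lambda>v. f x * (0 - s * D' v) + D v * (1 - \<tau> (g x)))) (at (chart_map \<kappa> x))"
    using chart_inv_map[OF \<kappa>] by (simp add: comp_def)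
  moreover have "\<bar>f x * (0 - s * D' v) + D v * (1 - \<tau> (g x))\<bar> \<le> (1 + K) * L * N x (tangent_vec A x \<kappa> v)" for v
  proof -
    let ?B = "L * N x (tangent_vec A x \<kappa> v)"
    have B: "0 \<le> ?B" using D(2)[of v] by linarith
    have "\<bar>f x * (0 - s * D' v) + D v * (1 - \<tau> (g x))\<bar> \<le> \<bar>f x\<bar> * (\<bar>s\<bar> * \<bar>D' v\<bar>) + \<bar>D v\<bar> * \<bar>1 - \<tau> (g x)\<bar>"
      by (rule order_trans[OF abs_triangle_ineq]) (simp add: abs_mult)
    also have "\<dots> \<le> 1 * (K * ?B) + ?B * 1"
      using assms(4-7) D(2) D'(2) B by (intro add_mono mult_mono) auto
    finally show ?thesis by (simp add: algebra_simps)
  qed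
  ultimately show ?thesis by (rule slope_leI[OF \<kappa>])
qed

end

section \<open>Curves and the Finsler metric\<close>

lemma vector_derivative_on_Icc:
  fixes f :: "real \<Rightarrow> 'a::real_normed_vector"
  assumes "a < b" "t \<in> {a..b}" "(f has_vector_derivative y) (at t within {a..b})"
  shows "vector_derivative f (at t within {a..b}) = y"
  using vector_derivative_within[OF _ assms(3)] assms(1,2) islimpt_Icc[of a b t]
  by (simp add: trivial_limit_within)

lemma isCont_line:
  fixes y w :: "'a::real_normed_vector"
  shows "isCont (\<lambda>t. y + t *\<^sub>R w) t"
  by (intro continuous_intros)

context finsler_manifold
begin

abbreviation chart_vel :: "real set \<Rightarrow> (real \<Rightarrow> 'm) \<Rightarrow> ('m, 'x) chart \<Rightarrow> real \<Rightarrow> 'x" where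
  "chart_vel I c \<kappa> t \<equiv> vector_derivative (chart_map \<kappa> \<circ> c) (at t within I)"

text \<open>
  Unlike \<open>velocity\<close>, this is the one-sided velocity at the endpoints of \<open>I\<close>, so that the speed of a \<open>C\<^sup>1\<close>
  curve is continuous on all of \<open>I\<close> and no value has to be excluded.
\<close>

definition velocity_within :: "real set \<Rightarrow> (real \<Rightarrow> 'm) \<Rightarrow> real \<Rightarrow> ('m, 'x) tangent_vector" where
  "velocity_within I c t = {(\<kappa>, v). \<kappa> \<in> A \<and> c t \<in> chart_dom \<kappa> \<and> v = chart_vel I c \<kappa> t}"

lemma curve_chart_vel:
  assumes "C1_curve_on A {a..b} c" "a < b" "\<kappa> \<in> A"
  shows "t \<in> {a..b} \<Longrightarrow> c t \<in> chart_dom \<kappa> \<Longrightarrow>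
      ((chart_map \<kappa> \<circ> c) has_vector_derivative chart_vel {a..b} c \<kappa> t) (at t within {a..b})"
    and "continuous_on ({a..b} \<inter> c -` chart_dom \<kappa>) (chart_vel {a..b} c \<kappa>)"
proof -
  obtain D where D: "continuous_on ({a..b} \<inter> c -` chart_dom \<kappa>) D"
    "\<And>t. t \<in> {a..b} \<inter> c -` chart_dom \<kappa> \<Longrightarrow> ((chart_map \<kappa> \<circ> c) has_vector_derivative D t) (at t within {a..b})"
    using assms(1,3) unfolding C1_curve_on_def by blast
  have eq: "chart_vel {a..b} c \<kappa> t = D t" if "t \<in> {a..b} \<inter> c -` chart_dom \<kappa>" for t
    using vector_derivative_on_Icc[OF assms(2) _ D(2)] that by blast
  show "((chart_map \<kappa> \<circ> c) has_vector_derivative chart_vel {a..b} c \<kappa> t) (at t within {a..b})"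
    if "t \<in> {a..b}" "c t \<in> chart_dom \<kappa>" using D(2)[of t] eq[of t] that by simp
  show "continuous_on ({a..b} \<inter> c -` chart_dom \<kappa>) (chart_vel {a..b} c \<kappa>)"
    using D(1) eq continuous_on_cong[OF refl, of _ "chart_vel {a..b} c \<kappa>" D] by blast
qed

lemma curve_comp_derivative:
  assumes c: "C1_curve_on A {a..b} c" "a < b" and \<kappa>: "\<kappa> \<in> A" "t \<in> {a..b}" "c t \<in> chart_dom \<kappa>"
    and D: "((f \<circ> chart_inv \<kappa>) has_derivative D) (at (chart_map \<kappa> (c t)))"
  shows "((f \<circ> c) has_vector_derivative D (chart_vel {a..b} c \<kappa> t)) (at t within {a..b})"
proof -
  have "((f \<circ> chart_inv \<kappa>) has_derivative D) (at ((chart_map \<kappa> \<circ> c) t) within (chart_map \<kappa> \<circ> c) ` {a..b})"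
    using has_derivative_at_withinI[OF D] by simp
  from vector_derivative_diff_chain_within[OF curve_chart_vel(1)[OF c \<kappa>] this]
  have d: "((f \<circ> chart_inv \<kappa> \<circ> (chart_map \<kappa> \<circ> c)) has_vector_derivative D (chart_vel {a..b} c \<kappa> t)) (at t within {a..b})" .
  have "(c \<longlongrightarrow> c t) (at t within {a..b})"
    using c(1) \<kappa>(2) unfolding C1_curve_on_def continuous_on_def by blast
  then have "\<forall>\<^sub>F s in at t within {a..b}. c s \<in> chart_dom \<kappa>"
    using open_chart_dom[OF \<kappa>(1)] \<kappa>(3) by (rule topological_tendstoD)
  then have ev: "\<forall>\<^sub>F s in at t within {a..b}. (f \<circ> chart_inv \<kappa> \<circ> (chart_map \<kappa> \<circ> c)) s = (f \<circ> c) s"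
    by eventually_elim (simp add: chart_inv_map[OF \<kappa>(1)])
  show ?thesis
    using has_derivative_transform_eventually[OF d[unfolded has_vector_derivative_def] ev _ \<kappa>(2)] chart_inv_map[OF \<kappa>(1,3)]
    by (simp add: has_vector_derivative_def comp_def)
qed

lemma velocity_within_eq:
  assumes c: "C1_curve_on A {a..b} c" "a < b" and \<kappa>: "\<kappa> \<in> A" "t \<in> {a..b}" "c t \<in> chart_dom \<kappa>"
  shows "velocity_within {a..b} c t = tangent_vec A (c t) \<kappa> (chart_vel {a..b} c \<kappa> t)"
proof -
  have "chart_vel {a..b} c \<kappa>' t = tdiff \<kappa> \<kappa>' (c t) (chart_vel {a..b} c \<kappa> t)"
    if "\<kappa>' \<in> A" "c t \<in> chart_dom \<kappa>'" for \<kappa>'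
    using vector_derivative_on_Icc[OF c(2) \<kappa>(2)
        curve_comp_derivative[OF c \<kappa> transition_C1(1)[OF \<kappa>(1) that(1) \<kappa>(3) that(2)]]] .
  then show ?thesis unfolding velocity_within_def tangent_vec_def by auto
qed

lemma velocity_within_interior: "a < t \<Longrightarrow> t < b \<Longrightarrow> velocity_within {a..b} c t = velocity A c t"
  unfolding velocity_within_def velocity_def by (simp add: at_within_Icc_at)

text \<open>The lift of \<open>c\<close> to the tangent bundle is continuous: the preimage of a
  generating open set consists of the times at which \<open>c\<close> lies in the chart and the pair
  of position and velocity in coordinates lies in \<open>W\<close>. Continuity of \<open>N\<close>
  on the bundle then applies.\<close>

lemma continuous_speed:
  assumes c: "C1_curve_on A {a..b} c" "a < b"
  shows "continuous_on {a..b} (\<lambda>t. N (c t) (velocity_within {a..b} c t))"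
proof -
  let ?I = "{a..b}" and ?V = "velocity_within {a..b} c"
  have cc: "continuous_on ?I c" using c(1) unfolding C1_curve_on_def by blast
  have 1: "openin (top_of_set ?I) ((\<lambda>t. (c t, ?V t)) -` U \<inter> ?I)"
    if W: "\<kappa> \<in> A" "open W" "W \<subseteq> (chart_map \<kappa> ` chart_dom \<kappa>) \<times> UNIV"
      "U = (\<lambda>(y, v). (chart_inv \<kappa> y, tangent_vec A (chart_inv \<kappa> y) \<kappa> v)) ` W" for U \<kappa> W
  proof -
    let ?J = "?I \<inter> c -` chart_dom \<kappa>"
    let ?f = "\<lambda>t. (chart_map \<kappa> (c t), chart_vel ?I c \<kappa> t)"
    have J: "openin (top_of_set ?I) ?J"
      using continuous_openin_preimage_gen[OF cc open_chart_dom[OF W(1)]] .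
    have "continuous_on ?J (\<lambda>t. chart_map \<kappa> (c t))"
      by (rule continuous_on_compose2[OF homeomorphism_cont1[OF homeo[OF W(1)]]])
        (use continuous_on_subset[OF cc, of "?J"] in auto)
    then have "continuous_on ?J ?f" using curve_chart_vel(2)[OF c W(1)] by (intro continuous_on_Pair)
    then have "openin (top_of_set ?J) (?J \<inter> ?f -` W)" using W(2) by (rule continuous_openin_preimage_gen)
    then have "openin (top_of_set ?I) (?J \<inter> ?f -` W)" using J by (rule openin_trans)
    moreover have "(\<lambda>t. (c t, ?V t)) -` U \<inter> ?I = ?J \<inter> ?f -` W"
    proof (intro set_eqI iffI)
      fix t assume "t \<in> (\<lambda>t. (c t, ?V t)) -` U \<inter> ?I"
      then obtain y v where t: "t \<in> ?I" "(y, v) \<in> W" "c t = chart_inv \<kappa> y" "?V t = tangent_vec A (c t) \<kappa> v"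
        using W(4) by auto
      then obtain x where x: "x \<in> chart_dom \<kappa>" "y = chart_map \<kappa> x" using W(3) by blast
      then have ct: "c t = x" using t chart_inv_map[OF W(1)] by simp
      have "tangent_vec A (c t) \<kappa> v = tangent_vec A (c t) \<kappa> (chart_vel ?I c \<kappa> t)"
        using t(4) velocity_within_eq[OF c W(1) t(1)] ct x by simp
      then have "v = chart_vel ?I c \<kappa> t" using tangent_vec_mem[OF W(1)] ct x by metis
      then show "t \<in> ?J \<inter> ?f -` W" using t ct x by simp
    next
      fix t assume t: "t \<in> ?J \<inter> ?f -` W"
      have "(c t, ?V t) = (\<lambda>(y, v). (chart_inv \<kappa> y, tangent_vec A (chart_inv \<kappa> y) \<kappa> v)) (?f t)"
        using t velocity_within_eq[OF c W(1)] chart_inv_map[OF W(1)] by simp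
      then show "t \<in> (\<lambda>t. (c t, ?V t)) -` U \<inter> ?I" using t W(4) by blast
    qed
    ultimately show ?thesis by simp
  qed
  \<comment> \<open>A generated topology lives on the union of its generators, so the lift must be
    shown to stay inside it.\<close>
  have 2: "\<exists>\<kappa> W. \<kappa> \<in> A \<and> open W \<and> W \<subseteq> (chart_map \<kappa> ` chart_dom \<kappa>) \<times> UNIV \<and>
      (c t, ?V t) \<in> (\<lambda>(y, v). (chart_inv \<kappa> y, tangent_vec A (chart_inv \<kappa> y) \<kappa> v)) ` W" if t: "t \<in> ?I" for t
  proof -
    obtain \<kappa> where \<kappa>: "\<kappa> \<in> A" "c t \<in> chart_dom \<kappa>" using chart_at by blast
    have "(c t, ?V t) = (\<lambda>(y, v). (chart_inv \<kappa> y, tangent_vec A (chart_inv \<kappa> y) \<kappa> v)) (chart_map \<kappa> (c t), chart_vel ?I c \<kappa> t)"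
      using velocity_within_eq[OF c \<kappa>(1) t \<kappa>(2)] chart_inv_map[OF \<kappa>] by simp
    moreover have "(chart_map \<kappa> (c t), chart_vel ?I c \<kappa> t) \<in> (chart_map \<kappa> ` chart_dom \<kappa>) \<times> UNIV" using \<kappa> by blast
    ultimately have "(c t, ?V t) \<in> (\<lambda>(y, v). (chart_inv \<kappa> y, tangent_vec A (chart_inv \<kappa> y) \<kappa> v)) ` ((chart_map \<kappa> ` chart_dom \<kappa>) \<times> UNIV)"
      by (rule image_eqI)
    moreover have "open ((chart_map \<kappa> ` chart_dom \<kappa>) \<times> (UNIV :: 'x set))" using open_Times[OF open_chart_img[OF \<kappa>(1)] open_UNIV] .
    ultimately show ?thesis using \<kappa>(1)
      by (intro exI[of _ \<kappa>] exI[of _ "(chart_map \<kappa> ` chart_dom \<kappa>) \<times> (UNIV :: 'x set)"] conjI) (assumption | rule order_refl)+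
  qed
  have "continuous_map (top_of_set ?I) (tangent_bundle A) (\<lambda>t. (c t, ?V t))"
    unfolding tangent_bundle_def continuous_on_generated_topo_iff topspace_euclidean_subtopology
  proof (intro conjI allI impI)
    fix U assume "U \<in> {(\<lambda>(y, v). (chart_inv \<kappa> y, tangent_vec A (chart_inv \<kappa> y) \<kappa> v)) ` W | \<kappa> W.
        \<kappa> \<in> A \<and> open W \<and> W \<subseteq> (chart_map \<kappa> ` chart_dom \<kappa>) \<times> UNIV}"
    then show "openin (top_of_set ?I) ((\<lambda>t. (c t, ?V t)) -` U \<inter> ?I)"
      by (elim CollectE exE conjE) (rule 1)
  next
    show "(\<lambda>t. (c t, ?V t)) ` ?I \<subseteq> \<Union> {(\<lambda>(y, v). (chart_inv \<kappa> y, tangent_vec A (chart_inv \<kappa> y) \<kappa> v)) ` W | \<kappa> W.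
        \<kappa> \<in> A \<and> open W \<and> W \<subseteq> (chart_map \<kappa> ` chart_dom \<kappa>) \<times> UNIV}"
    proof (rule image_subsetI)
      fix t assume "t \<in> ?I"
      from 2[OF this] show "(c t, ?V t) \<in> \<Union> {(\<lambda>(y, v). (chart_inv \<kappa> y, tangent_vec A (chart_inv \<kappa> y) \<kappa> v)) ` W | \<kappa> W.
        \<kappa> \<in> A \<and> open W \<and> W \<subseteq> (chart_map \<kappa> ` chart_dom \<kappa>) \<times> UNIV}"
        by (elim exE conjE) (rule UnionI, rule CollectI, (rule exI conjI refl | assumption)+)
    qed
  qed
  moreover have "continuous_map (tangent_bundle A) euclideanreal (\<lambda>(x, \<tau>). N x \<tau>)"
    using NU by (simp add: NU_finsler_manifold_def)
  ultimately have "continuous_map (top_of_set ?I) euclideanreal ((\<lambda>(x, \<tau>). N x \<tau>) \<circ> (\<lambda>t. (c t, ?V t)))"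
    by (rule continuous_map_compose)
  then show ?thesis by (simp add: comp_def)
qed

definition curve_length :: "real set \<Rightarrow> (real \<Rightarrow> 'm) \<Rightarrow> real" where
  "curve_length I c = integral I (\<lambda>t. N (c t) (velocity_within I c t))"

lemma curve_length_integral:
  assumes c: "C1_curve_on A {a..b} c" "a < b"
  shows "((\<lambda>t. N (c t) (velocity_within {a..b} c t)) has_integral curve_length {a..b} c) {a..b}"
  unfolding curve_length_def
  using integrable_continuous_real[OF continuous_speed[OF c]] by (rule integrable_integral)

text \<open>One-sided and two-sided velocities can differ only at the two endpoints, a null set.
  Asking for agreement of \<open>c'\<close> with \<open>c\<close> only in the interior lets
  \<open>c'\<close> be a concatenation of which \<open>c\<close> is one piece.\<close>

lemma curve_length_velocity:
  assumes c: "C1_curve_on A {a..b} c" "a < b" and e: "\<And>t. a < t \<Longrightarrow> t < b \<Longrightarrow> c' t = c t"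
  shows "((\<lambda>t. N (c' t) (velocity A c' t)) has_integral curve_length {a..b} c) {a..b}"
proof (rule has_integral_spike_finite[OF _ _ curve_length_integral[OF c]])
  show "finite {a, b}" by simp
  fix t assume t: "t \<in> {a..b} - {a, b}"
  then have ab: "a < t" "t < b" by auto
  have "vector_derivative (chart_map \<kappa> \<circ> c') (at t) = vector_derivative (chart_map \<kappa> \<circ> c) (at t)" for \<kappa> :: "('m, 'x) chart"
  proof (rule vector_derivative_cong_eq)
    have "\<forall>\<^sub>F x in nhds t. x \<in> {a<..<b}" using ab by (intro eventually_nhds_in_open) auto
    then show "\<forall>\<^sub>F x in nhds t. x \<in> UNIV \<longrightarrow> (chart_map \<kappa> \<circ> c') x = (chart_map \<kappa> \<circ> c) x"
      by eventually_elim (simp add: e)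
  qed auto
  then show "N (c' t) (velocity A c' t) = N (c t) (velocity_within {a..b} c t)"
    using e[OF ab] velocity_within_interior[OF ab] by (simp add: velocity_def)
qed

lemma speed_nonneg:
  assumes c: "C1_curve_on A {a..b} c" "a < b" "t \<in> {a..b}"
  shows "0 \<le> N (c t) (velocity_within {a..b} c t)"
proof -
  obtain \<kappa> where \<kappa>: "\<kappa> \<in> A" "c t \<in> chart_dom \<kappa>" using chart_at by blast
  show ?thesis using velocity_within_eq[OF c(1,2) \<kappa>(1) c(3) \<kappa>(2)] N_nonneg[OF \<kappa>] by simp
qed

lemma curve_length_nonneg: "C1_curve_on A {a..b} c \<Longrightarrow> a < b \<Longrightarrow> 0 \<le> curve_length {a..b} c"
  by (rule has_integral_nonneg[OF curve_length_integral]) (auto intro: speed_nonneg)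

text \<open>Fundamental theorem of calculus for \<open>g \<circ> c\<close>, whose derivative is the
  differential of \<open>g\<close> at the velocity and hence at most \<open>L\<close> times the
  speed.\<close>

lemma curve_increment:
  assumes c: "C1_curve_on A {a..b} c" "a < b" and g: "\<And>x. slope_le g x L"
  shows "\<bar>g (c b) - g (c a)\<bar> \<le> L * curve_length {a..b} c"
proof -
  let ?I = "{a..b}"
  let ?g' = "\<lambda>t. vector_derivative (g \<circ> c) (at t within ?I)"
  have d: "((g \<circ> c) has_vector_derivative ?g' t) (at t within ?I) \<and> \<bar>?g' t\<bar> \<le> L * N (c t) (velocity_within ?I c t)"
    if t: "t \<in> ?I" for t
  proof -
    obtain \<kappa> where \<kappa>: "\<kappa> \<in> A" "c t \<in> chart_dom \<kappa>" using chart_at by blast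
    obtain D where D: "((g \<circ> chart_inv \<kappa>) has_derivative D) (at (chart_map \<kappa> (c t)))"
      "\<And>v. \<bar>D v\<bar> \<le> L * N (c t) (tangent_vec A (c t) \<kappa> v)" using g[of "c t"] \<kappa> unfolding slope_le_def by blast
    note h = curve_comp_derivative[OF c \<kappa>(1) t \<kappa>(2) D(1)]
    have "?g' t = D (chart_vel ?I c \<kappa> t)" by (rule vector_derivative_on_Icc[OF c(2) t h])
    then show ?thesis using h D(2) velocity_within_eq[OF c \<kappa>(1) t \<kappa>(2)] by simp
  qed
  have i: "(?g' has_integral ((g \<circ> c) b - (g \<circ> c) a)) ?I"
    by (rule fundamental_theorem_of_calculus) (use c(2) d in \<open>auto simp del: o_apply\<close>)
  have "norm (integral ?I ?g') \<le> integral ?I (\<lambda>t. L * N (c t) (velocity_within ?I c t))"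
    by (rule Henstock_Kurzweil_Integration.integral_norm_bound_integral)
      (use i d integrable_cmul[OF has_integral_integrable[OF curve_length_integral[OF c]], of L] in \<open>auto simp: integrable_on_def\<close>)
  then show ?thesis using integral_unique[OF i] by (simp add: curve_length_def)
qed

lemma C1_curve_on_cong:
  assumes "C1_curve_on A I c" "\<And>t. t \<in> I \<Longrightarrow> c' t = c t"
  shows "C1_curve_on A I c'"
proof -
  have eq: "I \<inter> c' -` U = I \<inter> c -` U" for U using assms(2) by auto
  have "((chart_map \<kappa> \<circ> c') has_vector_derivative v) (at t within I)"
    if "((chart_map \<kappa> \<circ> c) has_vector_derivative v) (at t within I)" "t \<in> I" for \<kappa> :: "('m, 'x) chart" and v t
    by (rule has_vector_derivative_transform[OF that(2) _ that(1)]) (simp add: assms(2))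
  then show ?thesis using assms unfolding C1_curve_on_def eq
    by (metis (no_types, lifting) IntD1 continuous_on_cong)
qed

text \<open>The cases \<open>m = 1\<close> and \<open>m = -1\<close> shift and reverse a curve; in
  both the speed is unchanged.\<close>

lemma curve_affine:
  assumes c: "C1_curve_on A {a..b} c" "a < b" and m: "\<bar>m\<bar> = 1"
    and J: "a' < b'" "(\<lambda>s. m * s + q) ` {a'..b'} = {a..b}"
  shows "C1_curve_on A {a'..b'} (\<lambda>s. c (m * s + q))"
    and "curve_length {a'..b'} (\<lambda>s. c (m * s + q)) = curve_length {a..b} c"
proof -
  let ?\<phi> = "\<lambda>s. m * s + q" and ?J = "{a'..b'}" and ?I = "{a..b}"
  let ?c = "\<lambda>s. c (?\<phi> s)"
  have \<phi>: "?\<phi> s \<in> ?I" if "s \<in> ?J" for s using J(2) that by blast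
  have cc: "continuous_on ?I c" using c(1) unfolding C1_curve_on_def by blast
  have d: "((chart_map \<kappa> \<circ> ?c) has_vector_derivative m *\<^sub>R chart_vel ?I c \<kappa> (?\<phi> s)) (at s within ?J)"
    if "s \<in> ?J" "?c s \<in> chart_dom \<kappa>" "\<kappa> \<in> A" for s \<kappa>
  proof -
    have "(?\<phi> has_vector_derivative m) (at s within ?J)"
      by (auto intro!: derivative_eq_intros simp: has_vector_derivative_def mult.commute)
    moreover have "((chart_map \<kappa> \<circ> c) has_vector_derivative chart_vel ?I c \<kappa> (?\<phi> s)) (at (?\<phi> s) within ?\<phi> ` ?J)"
      using curve_chart_vel(1)[OF c that(3) \<phi>[OF that(1)] that(2)] J(2) by simp
    ultimately show ?thesis using vector_diff_chain_within[of ?\<phi> m s ?J "chart_map \<kappa> \<circ> c"] by (simp add: comp_def)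
  qed
  show C: "C1_curve_on A ?J ?c"
    unfolding C1_curve_on_def
  proof (intro conjI ballI)
    show "continuous_on ?J ?c"
      by (rule continuous_on_compose2[OF cc]) (use \<phi> in \<open>auto intro!: continuous_intros\<close>)
    fix \<kappa> assume \<kappa>: "\<kappa> \<in> A"
    have "continuous_on (?J \<inter> ?c -` chart_dom \<kappa>) (\<lambda>s. m *\<^sub>R chart_vel ?I c \<kappa> (?\<phi> s))"
      by (intro continuous_intros continuous_on_compose2[OF curve_chart_vel(2)[OF c \<kappa>], where f = ?\<phi>]) (use \<phi> in auto)
    then show "\<exists>D. continuous_on (?J \<inter> ?c -` chart_dom \<kappa>) D \<and>
        (\<forall>t\<in>?J \<inter> ?c -` chart_dom \<kappa>. ((chart_map \<kappa> \<circ> ?c) has_vector_derivative D t) (at t within ?J))"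
      using d \<kappa> by (intro exI[of _ "\<lambda>s. m *\<^sub>R chart_vel ?I c \<kappa> (?\<phi> s)"]) auto
  qed
  have sp: "N (?c s) (velocity_within ?J ?c s) = N (c (?\<phi> s)) (velocity_within ?I c (?\<phi> s))" if s: "s \<in> ?J" for s
  proof -
    obtain \<kappa> where \<kappa>: "\<kappa> \<in> A" "?c s \<in> chart_dom \<kappa>" using chart_at by blast
    have "velocity_within ?J ?c s = tangent_vec A (?c s) \<kappa> (m *\<^sub>R chart_vel ?I c \<kappa> (?\<phi> s))"
      using velocity_within_eq[OF C J(1) \<kappa>(1) s \<kappa>(2)]
        vector_derivative_on_Icc[OF J(1) s d[OF s \<kappa>(2,1)]] by simp
    then show ?thesis using velocity_within_eq[OF c \<kappa>(1) \<phi>[OF s] \<kappa>(2)] N_scale[OF \<kappa>] m by simp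
  qed
  have m0: "m \<noteq> 0" using m by auto
  have "(\<lambda>x. (1 / m) *\<^sub>R x + - ((1 / m) *\<^sub>R q)) ` ?I = ?J"
    unfolding J(2)[symmetric] image_image using m0 by (simp add: field_simps)
  then have "((\<lambda>s. N (c (?\<phi> s)) (velocity_within ?I c (?\<phi> s))) has_integral curve_length ?I c) ?J"
    using has_integral_affinity[OF curve_length_integral[OF c, folded box_real(2)] m0, of q] m by simp
  then have "((\<lambda>s. N (?c s) (velocity_within ?J ?c s)) has_integral curve_length ?I c) ?J"
    using has_integral_eq[of ?J _ "\<lambda>s. N (?c s) (velocity_within ?J ?c s)"] sp by simp
  then show "curve_length ?J ?c = curve_length ?I c"
    using has_integral_unique curve_length_integral[OF C J(1)] by blast
qed

section \<open>Arcs, chains and the infimum over paths\<close>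

definition arc :: "'m \<Rightarrow> 'm \<Rightarrow> real \<Rightarrow> bool" where
  "arc p q r \<longleftrightarrow> (\<exists>a b c. a < b \<and> C1_curve_on A {a..b} c \<and> c a = p \<and> c b = q \<and> r = curve_length {a..b} c)"

lemma arc_end_at:
  assumes "arc p q r"
  obtains a c where "a < e" "C1_curve_on A {a..e} c" "c a = p" "c e = q" "r = curve_length {a..e} c"
proof -
  obtain a b c where c: "a < b" "C1_curve_on A {a..b} c" "c a = p" "c b = q" "r = curve_length {a..b} c"
    using assms unfolding arc_def by blast
  have "(\<lambda>s. 1 * s + (b - e)) ` {a - (b - e)..e} = {a..b}" by simp
  from curve_affine[OF c(2,1) _ _ this] c show ?thesis
    by (intro that[of "a - (b - e)" "\<lambda>s. c (1 * s + (b - e))"]) auto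
qed

lemma arc_sym:
  assumes "arc p q r"
  shows "arc q p r"
proof -
  obtain a b c where c: "a < b" "C1_curve_on A {a..b} c" "c a = p" "c b = q" "r = curve_length {a..b} c"
    using assms unfolding arc_def by blast
  have "(\<lambda>s. (-1) * s + 0) ` {-b..-a} = {a..b}" by simp
  from curve_affine[OF c(2,1) _ _ this] c show ?thesis
    unfolding arc_def by (intro exI[of _ "-b"] exI[of _ "-a"] exI[of _ "\<lambda>s. c ((-1) * s + 0)"]) auto
qed

text \<open>A piecewise curve as a finite sequence of arcs, of which only endpoints and total length
  are kept. Concatenation and reversal become inductions without gluing parametrisations.\<close>

inductive chain :: "'m \<Rightarrow> 'm \<Rightarrow> real \<Rightarrow> bool" where
  chain_arc: "arc p q r \<Longrightarrow> chain p q r"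
| chain_step: "arc p q r \<Longrightarrow> chain q s r' \<Longrightarrow> chain p s (r + r')"

lemma chain_trans: "chain p q r \<Longrightarrow> chain q s r' \<Longrightarrow> chain p s (r + r')"
proof (induction rule: chain.induct)
  case (chain_step p q r s r'')
  then show ?case using chain.chain_step by (metis add.assoc)
qed (rule chain_step)

lemma chain_sym: "chain p q r \<Longrightarrow> chain q p r"
proof (induction rule: chain.induct)
  case (chain_step p q r s r')
  then show ?case using chain_trans[OF _ chain_arc[OF arc_sym]] by (metis add.commute)
qed (rule chain_arc[OF arc_sym])

lemma chain_nonneg: "chain p q r \<Longrightarrow> 0 \<le> r"
proof (induction rule: chain.induct)
  have arc: "0 \<le> r" if "arc p q r" for p q r
    using that curve_length_nonneg unfolding arc_def by blast
  {
    case chain_arc then show ?case by (rule arc)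
  next
    case chain_step then show ?case using arc by fastforce
  }
qed

lemma chain_slope:
  assumes "\<And>x. slope_le g x L"
  shows "chain p q r \<Longrightarrow> \<bar>g p - g q\<bar> \<le> L * r"
proof (induction rule: chain.induct)
  have arc: "\<bar>g p - g q\<bar> \<le> L * r" if "arc p q r" for p q r
    using that curve_increment[OF _ _ assms] unfolding arc_def by (metis abs_minus_commute)
  {
    case chain_arc then show ?case by (rule arc)
  next
    case (chain_step p q r s r')
    have "\<bar>g p - g s\<bar> \<le> \<bar>g p - g q\<bar> + \<bar>g q - g s\<bar>" by linarith
    also have "\<dots> \<le> L * r + L * r'" using arc[OF chain_step(1)] chain_step(3) by (rule add_mono)
    finally show ?case by (simp add: distrib_left)
  }
qed

text \<open>The integral is split at the breakpoints. A genuine \<open>has_integral\<close> is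
  established because \<open>path_length\<close> is an \<open>integral\<close>, whose value would be
  meaningless for a non-integrable speed.\<close>

lemma path_chain:
  assumes "piecewise_C1_path A a b c"
  shows "\<exists>r. ((\<lambda>t. N (c t) (velocity A c t)) has_integral r) {a..b} \<and> chain (c a) (c b) r"
proof -
  let ?f = "\<lambda>t. N (c t) (velocity A c t)"
  obtain n t where t: "t 0 = a" "t n = b" "a < b" and
    C: "\<And>i. i < n \<Longrightarrow> t i < t (Suc i)" "\<And>i. i < n \<Longrightarrow> C1_curve_on A {t i..t (Suc i)} c"
    using assms unfolding piecewise_C1_path_def by blast
  have I: "(?f has_integral curve_length {t i..t (Suc i)} c) {t i..t (Suc i)}"
    and R: "arc (c (t i)) (c (t (Suc i))) (curve_length {t i..t (Suc i)} c)" if "i < n" for i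
    using curve_length_velocity[OF C(2)[OF that] C(1)[OF that] refl] C[OF that] unfolding arc_def by blast+
  \<comment> \<open>The induction starts with one piece, as a chain has at least one arc;
    \<open>a < b\<close> excludes \<open>n = 0\<close>.\<close>
  have "\<exists>r. (?f has_integral r) {t 0..t (Suc m)} \<and> chain (c (t 0)) (c (t (Suc m))) r \<and> t 0 \<le> t (Suc m)" if "Suc m \<le> n" for m
    using that
  proof (induction m)
    case 0
    then show ?case using I[of 0] R[of 0] C(1)[of 0] chain_arc by fastforce
  next
    case (Suc m)
    then obtain r where r: "(?f has_integral r) {t 0..t (Suc m)}" "chain (c (t 0)) (c (t (Suc m))) r" "t 0 \<le> t (Suc m)" by auto
    have m: "Suc m < n" using Suc.prems by simp
    have "(?f has_integral (r + curve_length {t (Suc m)..t (Suc (Suc m))} c)) {t 0..t (Suc (Suc m))}"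
      by (rule has_integral_combine[OF r(3) _ r(1) I[OF m]]) (use C(1)[OF m] in simp)
    then show ?case using chain_trans[OF r(2) chain_arc[OF R[OF m]]] r(3) C(1)[OF m] by (meson less_imp_le order_trans)
  qed
  moreover have "n \<noteq> 0" using t by (metis less_irrefl)
  ultimately show ?thesis using t by (metis Suc_pred bot_nat_0.not_eq_extremum order_refl)
qed

text \<open>A new first arc is shifted so that it ends at the parameter where the path for the rest
  begins; the path itself is not reparametrised.\<close>

lemma chain_path:
  "chain p q r \<Longrightarrow> \<exists>a b c. piecewise_C1_path A a b c \<and> c a = p \<and> c b = q \<and> path_length A N a b c = r"
proof (induction rule: chain.induct)
  case (chain_arc p q r)
  then obtain a b c where c: "a < b" "C1_curve_on A {a..b} c" "c a = p" "c b = q" "r = curve_length {a..b} c"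
    unfolding arc_def by blast
  have "piecewise_C1_path A a b c"
    unfolding piecewise_C1_path_def
  proof (intro conjI exI)
    show "continuous_on {a..b} c" using c(2) by (simp add: C1_curve_on_def)
    show "\<forall>i<1. (if i = 0 then a else b) < (if Suc i = 0 then a else b) \<and>
        C1_curve_on A {if i = 0 then a else b..if Suc i = 0 then a else b} c" for i :: nat
      using c by simp
  qed (use c in auto)
  moreover have "path_length A N a b c = r"
    unfolding path_length_def using curve_length_velocity[OF c(2,1) refl] c(5) by (simp add: integral_unique)
  ultimately show ?case using c by blast
next
  case (chain_step p q r s r')
  then obtain a2 b2 c2 where c2: "piecewise_C1_path A a2 b2 c2" "c2 a2 = q" "c2 b2 = s" "path_length A N a2 b2 c2 = r'"
    by blast
  obtain a c1 where c1: "a < a2" "C1_curve_on A {a..a2} c1" "c1 a = p" "c1 a2 = q" "r = curve_length {a..a2} c1"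
    using arc_end_at[OF chain_step(1)] by metis
  obtain n t where t: "t 0 = a2" "t n = b2" and ab: "a2 < b2" and cc: "continuous_on {a2..b2} c2"
    and C: "\<And>i. i < n \<Longrightarrow> t i < t (Suc i)" "\<And>i. i < n \<Longrightarrow> C1_curve_on A {t i..t (Suc i)} c2"
    using c2(1) unfolding piecewise_C1_path_def by blast
  \<comment> \<open>At \<open>a2\<close> both curves pass through \<open>q\<close>, so the value
    chosen there fits both.\<close>
  define c where "c u = (if u \<le> a2 then c1 u else c2 u)" for u
  have e1: "c u = c1 u" if "u \<in> {a..a2}" for u using that by (simp add: c_def)
  have e2: "c u = c2 u" if "a2 \<le> u" for u using that c1(4) c2(2) by (auto simp: c_def)
  \<comment> \<open>The breakpoints of the rest, moved up by one index, with the new start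
    \<open>a\<close> in front.\<close>
  define t' where "t' i = (case i of 0 \<Rightarrow> a | Suc j \<Rightarrow> t j)" for i
  have low: "a2 \<le> t i" if "i \<le> n" for i
    using that
  proof (induction i)
    case (Suc i) then show ?case using C(1)[of i] by simp
  qed (simp add: t)
  have p: "piecewise_C1_path A a b2 c"
    unfolding piecewise_C1_path_def
  proof (intro conjI exI[of _ "Suc n"] exI[of _ t'] allI impI)
    show "a < b2" using c1(1) ab by simp
    have "continuous_on {a..a2} c" "continuous_on {a2..b2} c"
      using c1(2) cc continuous_on_cong[OF refl e1, of _ "\<lambda>x. x"] unfolding C1_curve_on_def
      by (auto simp: e2 cong: continuous_on_cong intro: continuous_on_eq[of "{a..a2}" c1] continuous_on_eq[of "{a2..b2}" c2] e1[symmetric])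
    then have "continuous_on ({a..a2} \<union> {a2..b2}) c" by (intro continuous_on_closed_Un) auto
    moreover have "{a..a2} \<union> {a2..b2} = {a..b2}" using c1(1) ab by auto
    ultimately show "continuous_on {a..b2} c" by simp
    fix i assume i: "i < Suc n"
    show "t' i < t' (Suc i)" using i C(1) c1(1) t by (auto simp: t'_def split: nat.split)
    show "C1_curve_on A {t' i..t' (Suc i)} c"
    proof (cases i)
      case 0
      then show ?thesis using C1_curve_on_cong[OF c1(2) e1] t by (simp add: t'_def)
    next
      case (Suc j)
      then have j: "j < n" using i by simp
      show ?thesis using C1_curve_on_cong[OF C(2)[OF j], of c] e2 low[of j] j Suc by (auto simp: t'_def)
    qed
  qed (use t in \<open>simp_all add: t'_def\<close>)
  let ?f = "\<lambda>c t. N (c t) (velocity A c t)"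
  have 1: "(?f c has_integral r) {a..a2}"
    using curve_length_velocity[OF c1(2,1), of c] c1(5) e1 by simp
  obtain r2 where "(?f c2 has_integral r2) {a2..b2}" using path_chain[OF c2(1)] by blast
  then have "(?f c2 has_integral r') {a2..b2}" using c2(4) integral_unique unfolding path_length_def by blast
  then have 2: "(?f c has_integral r') {a2..b2}"
  proof (rule has_integral_spike_finite[rotated 2])
    show "finite {a2, b2}" by simp
    fix u assume u: "u \<in> {a2..b2} - {a2, b2}"
    have "vector_derivative (chart_map \<kappa> \<circ> c) (at u) = vector_derivative (chart_map \<kappa> \<circ> c2) (at u)" for \<kappa> :: "('m, 'x) chart"
    proof (rule vector_derivative_cong_eq)
      have "\<forall>\<^sub>F x in nhds u. x \<in> {a2<..<b2}" using u by (intro eventually_nhds_in_open) auto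
      then show "\<forall>\<^sub>F x in nhds u. x \<in> UNIV \<longrightarrow> (chart_map \<kappa> \<circ> c) x = (chart_map \<kappa> \<circ> c2) x"
        by eventually_elim (simp add: e2)
    qed auto
    then show "?f c u = ?f c2 u" using u e2[of u] by (simp add: velocity_def)
  qed
  have "(?f c has_integral (r + r')) {a..b2}"
    by (rule has_integral_combine[OF _ _ 1 2]) (use c1(1) ab in auto)
  then have "path_length A N a b2 c = r + r'" unfolding path_length_def by (rule integral_unique)
  moreover have "c a = p" "c b2 = s" using e1[of a] e2[of b2] c1 c2 ab by auto
  ultimately show ?case using p by blast
qed

lemma finsler_dist_chain: "finsler_dist A N p q = Inf {ennreal r | r. chain p q r}"
proof -
  have "{ennreal (path_length A N a b c) | a b c. piecewise_C1_path A a b c \<and> c a = p \<and> c b = q} = {ennreal r | r. chain p q r}"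
  proof (intro set_eqI iffI)
    fix e assume "e \<in> {ennreal (path_length A N a b c) | a b c. piecewise_C1_path A a b c \<and> c a = p \<and> c b = q}"
    then obtain a b c where c: "e = ennreal (path_length A N a b c)" "piecewise_C1_path A a b c" "c a = p" "c b = q" by blast
    obtain r where "((\<lambda>t. N (c t) (velocity A c t)) has_integral r) {a..b}" "chain (c a) (c b) r" using path_chain[OF c(2)] by blast
    then show "e \<in> {ennreal r | r. chain p q r}" using c integral_unique unfolding path_length_def by blast
  next
    fix e assume "e \<in> {ennreal r | r. chain p q r}"
    then obtain r where r: "e = ennreal r" "chain p q r" by blast
    from chain_path[OF r(2)] show "e \<in> {ennreal (path_length A N a b c) | a b c. piecewise_C1_path A a b c \<and> c a = p \<and> c b = q}"
      using r(1) by blast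
  qed
  then show ?thesis unfolding finsler_dist_def by simp
qed

section \<open>The metric as a real number\<close>

definition reach :: "'m \<Rightarrow> 'm \<Rightarrow> bool" where
  "reach p q \<longleftrightarrow> (\<exists>r. chain p q r)"

text \<open>\<open>enn2real\<close> sends infinity to 0, so this number is a distance only together
  with \<open>reach\<close>.\<close>

definition rdist :: "'m \<Rightarrow> 'm \<Rightarrow> real" where
  "rdist p q = enn2real (finsler_dist A N p q)"

lemma rdist_le: "chain p q r \<Longrightarrow> rdist p q \<le> r"
proof -
  assume r: "chain p q r"
  have "finsler_dist A N p q \<le> ennreal r" unfolding finsler_dist_chain using r by (intro Inf_lower) blast
  then show ?thesis unfolding rdist_def using chain_nonneg[OF r] by (simp add: enn2real_leI)
qed

lemma finsler_dist_reach:
  "finsler_dist A N p q = (if reach p q then ennreal (rdist p q) else \<infinity>)"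
proof (cases "reach p q")
  case True
  then obtain r where r: "chain p q r" unfolding reach_def by blast
  have "finsler_dist A N p q \<le> ennreal r" unfolding finsler_dist_chain using r by (intro Inf_lower) blast
  then have "finsler_dist A N p q < \<infinity>" by (simp add: order_le_less_trans)
  then show ?thesis using True by (simp add: rdist_def)
next
  case False
  then have "{ennreal r | r. chain p q r} = {}" unfolding reach_def by blast
  then show ?thesis using False by (simp add: finsler_dist_chain)
qed

lemma finsler_dist_finite: "finsler_dist A N p q < \<infinity> \<longleftrightarrow> reach p q"
  by (simp add: finsler_dist_reach)

lemma rdist_nonneg: "0 \<le> rdist p q"
  by (simp add: rdist_def)

lemma rdist_less:
  assumes "reach p q" "rdist p q < e"
  obtains r where "chain p q r" "r < e"
proof -
  have "finsler_dist A N p q < ennreal e" using assms rdist_nonneg[of p q] by (simp add: finsler_dist_reach ennreal_lessI)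
  then obtain r where r: "chain p q r" "ennreal r < ennreal e" unfolding finsler_dist_chain Inf_less_iff by blast
  then have "r < e" using chain_nonneg[OF r(1)] by (simp add: ennreal_less_iff)
  then show ?thesis using that r by blast
qed

lemma reach_sym: "reach p q \<Longrightarrow> reach q p"
  unfolding reach_def using chain_sym by blast

lemma reach_trans: "reach p q \<Longrightarrow> reach q s \<Longrightarrow> reach p s"
  unfolding reach_def using chain_trans by blast

lemma rdist_sym: "rdist p q = rdist q p"
proof -
  have "{ennreal r | r. chain p q r} = {ennreal r | r. chain q p r}" using chain_sym by blast
  then show ?thesis by (simp add: rdist_def finsler_dist_chain)
qed

lemma rdist_triangle:
  assumes "reach p q" "reach q s"
  shows "rdist p s \<le> rdist p q + rdist q s"
proof (rule field_le_epsilon)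
  fix e :: real assume "e > 0"
  obtain r where r: "chain p q r" "r < rdist p q + e / 2" using rdist_less[OF assms(1)] \<open>e > 0\<close> by (metis less_add_same_cancel1 half_gt_zero)
  obtain r' where r': "chain q s r'" "r' < rdist q s + e / 2" using rdist_less[OF assms(2)] \<open>e > 0\<close> by (metis less_add_same_cancel1 half_gt_zero)
  have "rdist p s \<le> r + r'" using rdist_le[OF chain_trans[OF r(1) r'(1)]] .
  then show "rdist p s \<le> rdist p q + rdist q s + e" using r(2) r'(2) by simp
qed

lemma arc_refl: "arc p p 0"
proof -
  let ?c = "\<lambda>_::real. p"
  have d: "((chart_map \<kappa> \<circ> ?c) has_vector_derivative 0) (at t within {0..1})" for \<kappa> :: "('m, 'x) chart" and t
    by (simp add: comp_def)
  have C: "C1_curve_on A {0..1} ?c"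
    unfolding C1_curve_on_def using d by (auto intro!: exI[of _ "\<lambda>_. 0"])
  obtain \<kappa> where \<kappa>: "\<kappa> \<in> A" "p \<in> chart_dom \<kappa>" using chart_at by blast
  have "N (?c t) (velocity_within {0..1} ?c t) = 0" if "t \<in> {0..1}" for t
    using velocity_within_eq[OF C _ \<kappa>(1) that \<kappa>(2)] vector_derivative_on_Icc[OF _ that d] N_zero[OF \<kappa>] by simp
  then have "curve_length {0..1} ?c = integral {0..1} (\<lambda>_::real. 0)"
    unfolding curve_length_def by (intro integral_cong) auto
  then show ?thesis using C unfolding arc_def
    by (intro exI[of _ 0] exI[of _ 1] exI[of _ ?c]) simp
qed

lemma reach_refl: "reach p p"
  unfolding reach_def using chain_arc[OF arc_refl] by blast

lemma rdist_refl: "rdist p p = 0"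
  using rdist_le[OF chain_arc[OF arc_refl]] rdist_nonneg by (metis order_antisym)

text \<open>In a chart as in (NU1) the coordinate segment from \<open>p\<close> to a nearby
  \<open>q\<close> stays in the chart and is a short arc. Hence every metric ball is a neighbourhood
  of its centre, which makes Lipschitz functions continuous and dense sets metrically dense.\<close>

lemma small_neighbourhood:
  assumes "\<delta> > 0"
  obtains U where "open U" "p \<in> U" "\<And>q. q \<in> U \<Longrightarrow> reach p q \<and> rdist p q < \<delta>"
proof -
  obtain \<kappa> K where \<kappa>: "\<kappa> \<in> A" "p \<in> chart_dom \<kappa>" "0 < K"
    and K: "\<And>x v. x \<in> chart_dom \<kappa> \<Longrightarrow> N x (tangent_vec A x \<kappa> v) \<le> K * norm v" using N_local_bound by metis
  let ?y = "chart_map \<kappa> p"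
  obtain e where e: "e > 0" "ball ?y e \<subseteq> chart_map \<kappa> ` chart_dom \<kappa>"
    using open_chart_img[OF \<kappa>(1)] \<kappa>(2) open_contains_ball by (metis imageI)
  \<comment> \<open>The bound \<open>e\<close> keeps the segment inside the chart, and
    \<open>\<delta> / K\<close> makes its length less than \<open>\<delta>\<close>.\<close>
  define \<rho> where "\<rho> = min e (\<delta> / K)"
  have \<rho>: "\<rho> > 0" "\<rho> \<le> e" "K * \<rho> \<le> \<delta>"
    using e(1) assms \<kappa>(3) by (auto simp: \<rho>_def min_def field_simps)
  define U where "U = chart_dom \<kappa> \<inter> chart_map \<kappa> -` ball ?y \<rho>"
  have "open U" unfolding U_def
    using continuous_open_preimage[OF homeomorphism_cont1[OF homeo[OF \<kappa>(1)]] open_chart_dom[OF \<kappa>(1)] open_ball] .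
  moreover have "p \<in> U" using \<kappa> \<rho> by (simp add: U_def)
  moreover have "reach p q \<and> rdist p q < \<delta>" if q: "q \<in> U" for q
  proof -
    let ?w = "chart_map \<kappa> q - ?y"
    have w: "norm ?w < \<rho>" "q \<in> chart_dom \<kappa>" using q by (auto simp: U_def dist_norm norm_minus_commute)
    let ?l = "\<lambda>t::real. ?y + t *\<^sub>R ?w"
    have l: "?l t \<in> chart_map \<kappa> ` chart_dom \<kappa>" if "t \<in> {0..1}" for t
    proof -
      have "norm (t *\<^sub>R ?w) \<le> 1 * norm ?w" using that unfolding norm_scaleR by (intro mult_right_mono) auto
      then have "?l t \<in> ball ?y e" using w(1) \<rho>(2) by (simp add: dist_norm)
      then show ?thesis using e(2) by blast
    qed
    define c where "c t = chart_inv \<kappa> (?l t)" for t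
    have c: "c t \<in> chart_dom \<kappa>" "chart_map \<kappa> (c t) = ?l t" if "t \<in> {0..1}" for t
      using l[OF that] chart_inv_map[OF \<kappa>(1)] unfolding c_def by auto
    have ld: "(?l has_vector_derivative ?w) (at t within {0..1})" for t
      by (auto intro!: derivative_eq_intros simp: has_vector_derivative_def)
    have cd: "((f \<circ> c) has_vector_derivative D ?w) (at t within {0..1})"
      if t: "t \<in> {0..1}" and D: "((f \<circ> chart_inv \<kappa>) has_derivative D) (at (chart_map \<kappa> (c t)))" for f D t
    proof -
      have "((f \<circ> chart_inv \<kappa>) has_derivative D) (at (?l t) within ?l ` {0..1})"
        using has_derivative_at_withinI[OF D] c(2)[OF t] by simp
      from vector_derivative_diff_chain_within[OF ld this] show ?thesis by (simp add: comp_def c_def)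
    qed
    have C: "C1_curve_on A {0..1} c"
      unfolding C1_curve_on_def
    proof (intro conjI ballI)
      show cc: "continuous_on {0..1} c" unfolding c_def
        by (rule continuous_on_compose2[OF homeomorphism_cont2[OF homeo[OF \<kappa>(1)]]]) (use l in \<open>auto intro!: continuous_intros\<close>)
      fix \<kappa>' assume \<kappa>': "\<kappa>' \<in> A"
      have "isCont (\<lambda>t. frechet_derivative (chart_map \<kappa>' \<circ> chart_inv \<kappa>) (at (?l t)) ?w) t"
        if "t \<in> {0..1} \<inter> c -` chart_dom \<kappa>'" for t
      proof -
        have "isCont (\<lambda>y. frechet_derivative (chart_map \<kappa>' \<circ> chart_inv \<kappa>) (at y) ?w) (?l t)"
          using transition_C1(2)[OF \<kappa>(1) \<kappa>', of "c t" ?w] c[of t] that by auto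
        with isCont_line show ?thesis by (rule isCont_o2)
      qed
      then have "continuous_on ({0..1} \<inter> c -` chart_dom \<kappa>') (\<lambda>t. frechet_derivative (chart_map \<kappa>' \<circ> chart_inv \<kappa>) (at (?l t)) ?w)"
        by (intro continuous_at_imp_continuous_on) blast
      moreover have "((chart_map \<kappa>' \<circ> c) has_vector_derivative frechet_derivative (chart_map \<kappa>' \<circ> chart_inv \<kappa>) (at (?l t)) ?w) (at t within {0..1})"
        if "t \<in> {0..1} \<inter> c -` chart_dom \<kappa>'" for t
        using cd[OF _ transition_C1(1)[OF \<kappa>(1) \<kappa>', of "c t"]] c[of t] that by auto
      ultimately show "\<exists>D. continuous_on ({0..1} \<inter> c -` chart_dom \<kappa>') D \<and>
          (\<forall>t\<in>{0..1} \<inter> c -` chart_dom \<kappa>'. ((chart_map \<kappa>' \<circ> c) has_vector_derivative D t) (at t within {0..1}))" by blast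
    qed
    have sp: "N (c t) (velocity_within {0..1} c t) \<le> K * norm ?w" if t: "t \<in> {0..1}" for t
    proof -
      have "((chart_map \<kappa> \<circ> c) has_vector_derivative tdiff \<kappa> \<kappa> (c t) ?w) (at t within {0..1})"
        using cd[OF t transition_C1(1)[OF \<kappa>(1,1) c(1)[OF t] c(1)[OF t]]] .
      then have "chart_vel {0..1} c \<kappa> t = ?w"
        using vector_derivative_on_Icc[OF _ t] tdiff_refl[OF \<kappa>(1) c(1)[OF t]] by simp
      then show ?thesis using velocity_within_eq[OF C _ \<kappa>(1) t c(1)[OF t]] K[OF c(1)[OF t]] by simp
    qed
    have "curve_length {0..1} c \<le> K * norm ?w"
      using has_integral_le[OF curve_length_integral[OF C] has_integral_const_real[of "K * norm ?w" 0 1]] sp by simp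
    moreover have "c 0 = p" "c 1 = q" using chart_inv_map[OF \<kappa>(1)] \<kappa>(2) w(2) by (auto simp: c_def)
    then have "arc p q (curve_length {0..1} c)" using C unfolding arc_def
      by (intro exI[of _ 0] exI[of _ 1] exI[of _ c]) simp
    moreover have "K * norm ?w < K * \<rho>" using w(1) \<kappa>(3) by simp
    ultimately show ?thesis using rdist_le[OF chain_arc] chain_arc \<rho>(3) unfolding reach_def by fastforce
  qed
  ultimately show ?thesis using that by blast
qed

lemma slope_lipschitz:
  assumes "\<And>x. slope_le g x L" "0 \<le> L" "reach p q"
  shows "\<bar>g p - g q\<bar> \<le> L * rdist p q"
proof (rule field_le_epsilon)
  fix e :: real assume "e > 0"
  \<comment> \<open>The denominator \<open>L + 1\<close> admits the case
    \<open>L = 0\<close>.\<close>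
  have "rdist p q < rdist p q + e / (L + 1)" using \<open>e > 0\<close> assms(2) by simp
  from rdist_less[OF assms(3) this] obtain r where r: "chain p q r" "r < rdist p q + e / (L + 1)" by blast
  have "\<bar>g p - g q\<bar> \<le> L * r" by (rule chain_slope[OF assms(1) r(1)])
  also have "\<dots> \<le> L * (rdist p q + e / (L + 1))" using r(2) assms(2) by (intro mult_left_mono) auto
  also have "\<dots> = L * rdist p q + e * (L / (L + 1))" by (simp add: distrib_left)
  also have "\<dots> \<le> L * rdist p q + e * 1" using \<open>e > 0\<close> assms(2) by (intro add_left_mono mult_left_mono) auto
  finally show "\<bar>g p - g q\<bar> \<le> L * rdist p q + e" by simp
qed

section \<open>Lipschitz functions\<close>

lemma is_Lipschitz_const_iff:
  "is_Lipschitz_const A N G f L \<longleftrightarrow>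
     0 \<le> L \<and> (\<forall>p\<in>G. \<forall>q\<in>G. reach p q \<longrightarrow> \<bar>f p - f q\<bar> \<le> L * rdist p q)"
  unfolding is_Lipschitz_const_def finsler_dist_finite rdist_def ..

text \<open>The conditions on a constant are closed inequalities, so the infimum of all constants is
  again one and \<open>LEAST\<close> is attained. Pairs at distance 0 are separate because the
  argument divides by the distance.\<close>

lemma Lip_least:
  assumes "Lipschitz_map A N G f"
  shows "is_Lipschitz_const A N G f (Lip A N G f)"
    and "is_Lipschitz_const A N G f L \<Longrightarrow> Lip A N G f \<le> L"
proof -
  define S where "S = {L. is_Lipschitz_const A N G f L}"
  have ne: "S \<noteq> {}" using assms unfolding S_def Lipschitz_map_def by blast
  have bdd: "bdd_below S" by (rule bdd_belowI[of _ 0]) (simp add: S_def is_Lipschitz_const_iff)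
  have min: "is_Lipschitz_const A N G f (Inf S)"
    unfolding is_Lipschitz_const_iff
  proof (intro conjI ballI impI)
    show "0 \<le> Inf S" using ne by (intro cInf_greatest) (auto simp: S_def is_Lipschitz_const_iff)
    fix p q assume pq: "p \<in> G" "q \<in> G" "reach p q"
    have le: "\<bar>f p - f q\<bar> \<le> L * rdist p q" if "L \<in> S" for L
      using that pq by (simp add: S_def is_Lipschitz_const_iff)
    show "\<bar>f p - f q\<bar> \<le> Inf S * rdist p q"
    proof (cases "rdist p q = 0")
      case True
      then show ?thesis using ne le by auto
    next
      case False
      then have pos: "rdist p q > 0" using rdist_nonneg[of p q] by linarith
      have "\<bar>f p - f q\<bar> / rdist p q \<le> Inf S"
        using ne le pos by (intro cInf_greatest) (auto simp: divide_le_eq)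
      then show ?thesis using pos by (simp add: divide_le_eq)
    qed
  qed
  have low: "Inf S \<le> L" if "is_Lipschitz_const A N G f L" for L
    using that bdd by (intro cInf_lower) (auto simp: S_def)
  have "Lip A N G f = Inf S" unfolding Lip_def by (rule Least_equality[where P = "is_Lipschitz_const A N G f", OF min low])
  then show "is_Lipschitz_const A N G f (Lip A N G f)"
    "is_Lipschitz_const A N G f L \<Longrightarrow> Lip A N G f \<le> L" using min low by auto
qed

lemma slope_is_Lipschitz:
  assumes "\<And>x. slope_le g x L" "0 \<le> L"
  shows "is_Lipschitz_const A N UNIV g L"
  unfolding is_Lipschitz_const_iff using slope_lipschitz[OF assms] assms(2) by blast

text \<open>The infimum of the cones \<open>f q + L * rdist q x\<close> over the points
  \<open>q\<close> of \<open>G\<close> within reach of \<open>x\<close>. Reachability is an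
  equivalence relation, so a class meets \<open>G\<close> for all of its points or for none; in the
  second case the value 0 is chosen.\<close>

lemma McShane_extension:
  assumes f: "is_Lipschitz_const A N G f L"
  shows "\<exists>F. is_Lipschitz_const A N UNIV F L \<and> (\<forall>x\<in>G. F x = f x)"
proof -
  have L: "0 \<le> L" and lip: "\<And>p q. p \<in> G \<Longrightarrow> q \<in> G \<Longrightarrow> reach p q \<Longrightarrow> \<bar>f p - f q\<bar> \<le> L * rdist p q"
    using f unfolding is_Lipschitz_const_iff by auto
  define S where "S x = {f q + L * rdist q x | q. q \<in> G \<and> reach q x}" for x
  define F where "F x = (if S x = {} then 0 else Inf (S x))" for x
  have tri: "L * rdist p s \<le> L * rdist p q + L * rdist q s" if "reach p q" "reach q s" for p q s
    using mult_left_mono[OF rdist_triangle[OF that] L] by (simp add: distrib_left)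
  have bdd: "bdd_below (S x)" for x
  proof (cases "S x = {}")
    case False
    then obtain q0 where q0: "q0 \<in> G" "reach q0 x" unfolding S_def by blast
    have "f q0 - L * rdist q0 x \<le> f q + L * rdist q x" if q: "q \<in> G" "reach q x" for q
    proof -
      have "\<bar>f q0 - f q\<bar> \<le> L * rdist q0 q" using lip[OF q0(1) q(1) reach_trans[OF q0(2) reach_sym[OF q(2)]]] .
      then show ?thesis using tri[OF q0(2) reach_sym[OF q(2)]] rdist_sym[of x q] by simp
    qed
    then show ?thesis unfolding S_def by (intro bdd_belowI[of _ "f q0 - L * rdist q0 x"]) auto
  qed simp
  have half: "F y \<le> F x + L * rdist x y" if xy: "reach x y" for x y
  proof (cases "S x = {}")
    case True
    then have "S y = {}" unfolding S_def using reach_trans[OF _ reach_sym[OF xy]] by blast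
    then show ?thesis using True L rdist_nonneg by (simp add: F_def)
  next
    case False
    have y: "f q + L * rdist q y \<in> S y" if "q \<in> G" "reach q x" for q
      unfolding S_def using that reach_trans[OF that(2) xy] by blast
    then have ne: "S y \<noteq> {}" using False unfolding S_def by blast
    have "F y - L * rdist x y \<le> Inf (S x)"
    proof (rule cInf_greatest[OF False])
      fix m assume "m \<in> S x"
      then obtain q where q: "m = f q + L * rdist q x" "q \<in> G" "reach q x" unfolding S_def by blast
      have "F y \<le> f q + L * rdist q y" using cInf_lower[OF y[OF q(2,3)] bdd] ne by (simp add: F_def)
      then show "F y - L * rdist x y \<le> m" using tri[OF q(3) xy] q(1) by simp
    qed
    then show ?thesis using False by (simp add: F_def)
  qed
  have "\<bar>F x - F y\<bar> \<le> L * rdist x y" if "reach x y" for x y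
    using half[OF that] half[OF reach_sym[OF that]] rdist_sym[of x y] by (simp add: abs_le_iff)
  moreover have "F x = f x" if x: "x \<in> G" for x
  proof -
    have mem: "f x \<in> S x" unfolding S_def using x reach_refl[of x] rdist_refl[of x] by force
    have "f x \<le> m" if m: "m \<in> S x" for m
    proof -
      obtain q where q: "m = f q + L * rdist q x" "q \<in> G" "reach q x" using m unfolding S_def by blast
      then show ?thesis using lip[OF q(2) x q(3)] by simp
    qed
    then have "Inf (S x) = f x" using mem by (intro cInf_eq_minimum)
    then show ?thesis using mem by (auto simp: F_def)
  qed
  ultimately show ?thesis using L by (intro exI[of _ F]) (auto simp: is_Lipschitz_const_iff)
qed

lemma Lipschitz_isCont:
  assumes "is_Lipschitz_const A N UNIV F L"
  shows "isCont F x"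
  unfolding isCont_def
proof (rule tendstoI)
  fix e :: real assume "e > 0"
  have L: "0 \<le> L" using assms by (simp add: is_Lipschitz_const_iff)
  have "e / (L + 1) > 0" using \<open>e > 0\<close> L by simp
  then obtain U where U: "open U" "x \<in> U" "\<And>q. q \<in> U \<Longrightarrow> reach x q \<and> rdist x q < e / (L + 1)"
    using small_neighbourhood by metis
  have "dist (F y) (F x) < e" if "y \<in> U" for y
  proof -
    have "\<bar>F x - F y\<bar> \<le> L * rdist x y" using assms U(3)[OF that] by (simp add: is_Lipschitz_const_iff)
    also have "\<dots> \<le> L * (e / (L + 1))" using U(3)[OF that] L by (intro mult_left_mono) auto
    also have "\<dots> < e" using L \<open>e > 0\<close> by (simp add: divide_less_eq)
    finally show ?thesis by (simp add: dist_real_def abs_minus_commute)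
  qed
  then show "\<forall>\<^sub>F y in at x. dist (F y) (F x) < e"
    using U(1,2) unfolding eventually_at_topological by blast
qed

end

section \<open>Smooth Urysohn functions\<close>

text \<open>
  A smooth maximum: \<open>\<sigma> t\<close> lies between \<open>t - 1/8\<close> and \<open>max t 0\<close>, so it bounds the maximum from below and
  its errors do not accumulate. As \<open>\<sigma>' t\<close> lies in \<open>[0, 1]\<close>, the differential is a convex combination of
  those of the arguments.
\<close>

primrec smooth_sup :: "(real \<Rightarrow> real) \<Rightarrow> (nat \<Rightarrow> 'a \<Rightarrow> real) \<Rightarrow> nat \<Rightarrow> 'a \<Rightarrow> real" where
  "smooth_sup \<sigma> u 0 = (\<lambda>_. 0)"
| "smooth_sup \<sigma> u (Suc n) = (\<lambda>x. smooth_sup \<sigma> u n x + \<sigma> (u n x - smooth_sup \<sigma> u n x))"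

lemma smooth_sup_mono:
  assumes "\<And>t. 0 \<le> \<sigma> t" "m \<le> n"
  shows "smooth_sup \<sigma> u m x \<le> smooth_sup \<sigma> u n x"
  using assms(2)
proof (induction n rule: dec_induct)
  case (step n)
  then show ?case using assms(1)[of "u n x - smooth_sup \<sigma> u n x"] by simp
qed simp

lemma smooth_sup_nonneg: "(\<And>t. 0 \<le> \<sigma> t) \<Longrightarrow> 0 \<le> smooth_sup \<sigma> u n x"
  using smooth_sup_mono[of \<sigma> 0 n u x] by simp

lemma smooth_sup_lower:
  assumes "\<And>t. t - 1 / 8 \<le> \<sigma> t"
  shows "u n x - 1 / 8 \<le> smooth_sup \<sigma> u (Suc n) x"
  using assms[of "u n x - smooth_sup \<sigma> u n x"] by simp

lemma smooth_sup_upper: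
  assumes "\<And>t. \<sigma> t \<le> max t 0"
  shows "smooth_sup \<sigma> u (Suc n) x \<le> max (smooth_sup \<sigma> u n x) (u n x)"
  using assms[of "u n x - smooth_sup \<sigma> u n x"] by simp

text \<open>Stabilisation is exact and not just in the limit: the maximum is nonnegative and
  \<open>\<sigma>\<close> vanishes on nonpositive arguments. This makes the limit function agree
  locally with a finite stage.\<close>

lemma smooth_sup_const:
  assumes "\<And>t. 0 \<le> \<sigma> t" "\<And>t. t \<le> 0 \<Longrightarrow> \<sigma> t = 0" "\<And>i. n \<le> i \<Longrightarrow> u i x \<le> 0" "n \<le> m"
  shows "smooth_sup \<sigma> u m x = smooth_sup \<sigma> u n x"
  using assms(4)
proof (induction m rule: dec_induct)
  case (step m)
  have "u m x - smooth_sup \<sigma> u m x \<le> 0"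
    using assms(3)[OF step(1)] smooth_sup_nonneg[of \<sigma> u m x, OF assms(1)] by linarith
  then show ?case using step assms(2) by simp
qed simp

locale smooth_finsler = finsler_manifold A N l
  for A :: "('m::t2_space, 'x::banach) chart set" and N l +
  fixes k :: enat
  assumes k1: "1 \<le> k"
begin

lemma Ck_map_const: "Ck_map A k (\<lambda>_. c)"
  unfolding Ck_map_def using Ck_on_const[OF open_chart_img] by (auto simp: comp_def)

lemma Ck_map_add: "Ck_map A k f \<Longrightarrow> Ck_map A k g \<Longrightarrow> Ck_map A k (\<lambda>x. f x + g x)"
  unfolding Ck_map_def comp_def using Ck_on_add[OF open_chart_img] by blast

lemma Ck_map_mult: "Ck_map A k f \<Longrightarrow> Ck_map A k g \<Longrightarrow> Ck_map A k (\<lambda>x. f x * g x)"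
  unfolding Ck_map_def comp_def using Ck_on_mult[OF open_chart_img] by blast

lemma Ck_map_compose: "smooth_real \<sigma> \<Longrightarrow> Ck_map A k f \<Longrightarrow> Ck_map A k (\<lambda>x. \<sigma> (f x))"
  unfolding Ck_map_def comp_def using Ck_on_compose_smooth[OF open_chart_img] by blast

lemma Ck_map_diff:
  assumes "Ck_map A k f" "Ck_map A k g"
  shows "Ck_map A k (\<lambda>x. f x - g x)"
  using Ck_map_add[OF assms(1) Ck_map_mult[OF Ck_map_const[of "-1"] assms(2)]] by simp

lemma Ck_map_local:
  assumes "\<And>x. \<exists>U g'. open U \<and> x \<in> U \<and> Ck_map A k g' \<and> (\<forall>y\<in>U. g y = g' y)"
  shows "Ck_map A k g"
  unfolding Ck_map_def
proof
  fix \<kappa> assume \<kappa>: "\<kappa> \<in> A"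
  show "Ck_on k (chart_map \<kappa> ` chart_dom \<kappa>) (g \<circ> chart_inv \<kappa>)"
  proof (rule Ck_on_local[OF open_chart_img[OF \<kappa>]])
    fix y assume "y \<in> chart_map \<kappa> ` chart_dom \<kappa>"
    then obtain x where x: "x \<in> chart_dom \<kappa>" "y = chart_map \<kappa> x" by blast
    obtain U g' where U: "open U" "x \<in> U" "Ck_map A k g'" "\<forall>y\<in>U. g y = g' y" using assms by blast
    let ?T = "chart_map \<kappa> ` (chart_dom \<kappa> \<inter> U)"
    have "open ?T" "y \<in> ?T" "?T \<subseteq> chart_map \<kappa> ` chart_dom \<kappa>" "\<forall>z\<in>?T. (g \<circ> chart_inv \<kappa>) z = (g' \<circ> chart_inv \<kappa>) z"
      using chart_img_open[OF \<kappa> U(1)] x U chart_inv_map[OF \<kappa>] by auto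
    moreover have "Ck_on k (chart_map \<kappa> ` chart_dom \<kappa>) (g' \<circ> chart_inv \<kappa>)" using U(3) \<kappa> unfolding Ck_map_def by blast
    ultimately show "\<exists>T f. open T \<and> y \<in> T \<and> T \<subseteq> chart_map \<kappa> ` chart_dom \<kappa> \<and>
        Ck_on k (chart_map \<kappa> ` chart_dom \<kappa>) f \<and> (\<forall>z\<in>T. (g \<circ> chart_inv \<kappa>) z = f z)" by blast
  qed
qed

lemma Ck_map_slope_le:
  assumes "Ck_map A k g" "differential_norm A N g x \<le> L"
  shows "slope_le g x L"
proof -
  obtain \<kappa> where \<kappa>: "\<kappa> \<in> A" "x \<in> chart_dom \<kappa>" using chart_at by blast
  have "Ck_on k (chart_map \<kappa> ` chart_dom \<kappa>) (g \<circ> chart_inv \<kappa>)" using assms(1) \<kappa> unfolding Ck_map_def by blast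
  from Ck_on_has_derivative[OF this open_chart_img[OF \<kappa>(1)] k1] obtain D
    where "((g \<circ> chart_inv \<kappa>) has_derivative D) (at (chart_map \<kappa> x))" using \<kappa>(2) by blast
  from slope_le_differential_norm[OF this \<kappa> assms(2)] show ?thesis .
qed

lemma smooth_sup_Ck:
  assumes "smooth_real \<sigma>" "\<And>n. Ck_map A k (u n)"
  shows "Ck_map A k (smooth_sup \<sigma> u n)"
proof (induction n)
  case (Suc n)
  show ?case unfolding smooth_sup.simps
    by (rule Ck_map_add[OF Suc Ck_map_compose[OF assms(1) Ck_map_diff[OF assms(2) Suc]]])
qed (simp add: Ck_map_const)

lemma smooth_sup_slope:
  assumes "\<And>t. (\<sigma> has_real_derivative \<sigma>' t) (at t)" "\<And>t. 0 \<le> \<sigma>' t" "\<And>t. \<sigma>' t \<le> 1"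
    "\<And>n. slope_le (u n) x L" "0 \<le> L"
  shows "slope_le (smooth_sup \<sigma> u n) x L"
proof (induction n)
  case 0
  show ?case using slope_le_mono[OF slope_le_const assms(5)] by simp
next
  case (Suc n)
  show ?case unfolding smooth_sup.simps
    by (rule slope_le_smooth_max[OF Suc assms(4) assms(1)]) (use assms in auto)
qed

definition bump_at :: "real \<Rightarrow> real \<Rightarrow> 'm \<Rightarrow> ('m \<Rightarrow> real) \<Rightarrow> bool" where
  "bump_at L \<delta> p b \<longleftrightarrow> Ck_map A k b \<and> (\<forall>x. 0 \<le> b x \<and> b x \<le> 1) \<and> b p = 1 \<and>
     (\<forall>x. b x \<noteq> 0 \<longrightarrow> reach p x \<and> rdist p x < \<delta>) \<and> (\<forall>x. slope_le b x L)"

text \<open>The separation \<open>2 * \<delta>\<close> is the sum of two bump radii: a bump that is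
  nonzero at a point of \<open>Q\<close> cannot have its centre within \<open>\<delta>\<close> of
  \<open>P\<close>. So the bumps that must vanish on \<open>P\<close> and those needed on
  \<open>Q\<close> do not compete.\<close>

lemma smooth_urysohn:
  fixes \<rho> :: "nat \<Rightarrow> 'm"
  assumes dense: "\<And>U. open U \<Longrightarrow> U \<noteq> {} \<Longrightarrow> \<exists>n. \<rho> n \<in> U"
    and b: "\<And>n. bump_at L \<delta> (\<rho> n) (b n)" and L: "0 < L"
    and sep: "\<And>p q. p \<in> P \<Longrightarrow> q \<in> Q \<Longrightarrow> reach p q \<Longrightarrow> 2 * \<delta> \<le> rdist p q"
    and st: "smooth_real st" "\<And>t. (st has_real_derivative st' t) (at t)" "\<And>t. \<bar>st' t\<bar> \<le> K"
      "\<And>t. t \<le> 0 \<Longrightarrow> st t = 0" "\<And>t. 1 \<le> t \<Longrightarrow> st t = 1" "\<And>t. 0 \<le> st t" "\<And>t. st t \<le> 1"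
  shows "\<exists>h. Ck_map A k h \<and> (\<forall>x. slope_le h x (8 * K * ((1 + 4 * K) * L))) \<and> (\<forall>x. 0 \<le> h x \<and> h x \<le> 1) \<and>
    (\<forall>x\<in>P. h x = 0) \<and> (\<forall>x\<in>Q. h x = 1)"
proof -
  obtain \<sigma> \<sigma>' :: "real \<Rightarrow> real" where \<sigma>:
    "smooth_real \<sigma>" "\<And>t. (\<sigma> has_real_derivative \<sigma>' t) (at t)" "\<And>t. 0 \<le> \<sigma>' t" "\<And>t. \<sigma>' t \<le> 1"
    and \<sigma>0: "\<And>t. t \<le> 0 \<Longrightarrow> \<sigma> t = 0" and \<sigma>l: "\<And>t. t - 1 / 8 \<le> \<sigma> t" and \<sigma>n: "\<And>t. 0 \<le> \<sigma> t" and \<sigma>u: "\<And>t. \<sigma> t \<le> max t 0"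
    using smooth_ramp_exists by metis
  have K: "0 \<le> K" using st(3)[of 0] by linarith
  have bC: "Ck_map A k (b n)" and b01: "0 \<le> b n x" "b n x \<le> 1" and b1: "b n (\<rho> n) = 1"
    and bs: "b n x \<noteq> 0 \<Longrightarrow> reach (\<rho> n) x \<and> rdist (\<rho> n) x < \<delta>" and bL: "slope_le (b n) x L" for n x
    using b[of n] unfolding bump_at_def by blast+
  define s where "s = smooth_sup \<sigma> b"
  \<comment> \<open>With the argument \<open>4 * s n x - 1\<close> the cutoff is inactive up to the
    value 1/4 of \<open>s\<close> and complete from 1/2 on.\<close>
  define \<psi> where "\<psi> n x = b n x * (1 - st (4 * s n x + (-1)))" for n x
  \<comment> \<open>A bump of radius \<open>\<delta>\<close> around such a centre vanishes on
    \<open>P\<close>.\<close>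
  define good where "good n \<longleftrightarrow> (\<forall>p\<in>P. reach (\<rho> n) p \<longrightarrow> \<delta> \<le> rdist (\<rho> n) p)" for n
  define u where "u n = (if good n then \<psi> n else (\<lambda>_. 0))" for n
  define T where "T = smooth_sup \<sigma> u"
  let ?L = "(1 + 4 * K) * L"
  have L0: "0 \<le> ?L" using K L by simp
  have sC: "Ck_map A k (s n)" for n unfolding s_def by (rule smooth_sup_Ck[OF \<sigma>(1) bC])
  have sL: "slope_le (s n) x L" for n x unfolding s_def by (rule smooth_sup_slope[OF \<sigma>(2-4) bL]) (use L in auto)
  have "Ck_map A k (\<lambda>x. b n x * (1 - st (4 * s n x + (-1))))" for n
    by (rule Ck_map_mult[OF bC Ck_map_diff[OF Ck_map_const Ck_map_compose[OF smooth_real_affine[OF st(1)] sC]]])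
  then have uC: "Ck_map A k (u n)" for n unfolding u_def \<psi>_def by (simp add: Ck_map_const)
  have std: "((\<lambda>t. st (a * t + c)) has_real_derivative st' (a * t + c) * a) (at t)" for a c t
    by (rule DERIV_chain'[OF _ st(2)]) (auto intro!: derivative_eq_intros)
  have "slope_le (\<lambda>x. b n x * (1 - st (4 * s n x + (-1)))) x ?L" for n x
    by (rule slope_le_cutoff[OF bL sL, where \<tau> = "\<lambda>t. st (4 * t + (-1))", OF std])
      (use st(3,6,7) b01 in \<open>auto simp: abs_mult\<close>)
  then have uL: "slope_le (u n) x ?L" for n x
    unfolding u_def \<psi>_def using slope_le_mono[OF slope_le_const L0] by simp
  have TC: "Ck_map A k (T n)" for n unfolding T_def by (rule smooth_sup_Ck[OF \<sigma>(1) uC])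
  have TL: "slope_le (T n) x ?L" for n x unfolding T_def by (rule smooth_sup_slope[OF \<sigma>(2-4) uL L0])
  \<comment> \<open>Each bump is \<open>L\<close>-Lipschitz and 1 at its centre, so at distance less
    than \<open>1 / (8 * L)\<close> from the centre it is at least 7/8.\<close>
  have near: "\<exists>n. b n x > 3 / 4" for x
  proof -
    have "1 / (8 * L) > 0" using L by simp
    then obtain U where U: "open U" "x \<in> U" "\<And>q. q \<in> U \<Longrightarrow> reach x q \<and> rdist x q < 1 / (8 * L)"
      using small_neighbourhood by metis
    obtain n where n: "\<rho> n \<in> U" using dense[OF U(1)] U(2) by blast
    have "\<bar>b n x - b n (\<rho> n)\<bar> \<le> L * rdist x (\<rho> n)"
      by (rule slope_lipschitz[OF bL]) (use L U(3)[OF n] in auto)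
    also have "\<dots> \<le> L * (1 / (8 * L))" using L U(3)[OF n] by (intro mult_left_mono) auto
    finally have "\<bar>b n x - 1\<bar> \<le> 1 / 8" using L b1[of n] by simp
    then have "b n x > 3 / 4" by linarith
    then show ?thesis by blast
  qed
  have s_big: "s m x > 5 / 8" if "b n x > 3 / 4" "n < m" for n m x
  proof -
    have "s (Suc n) x \<le> s m x" unfolding s_def using that(2) by (intro smooth_sup_mono[OF \<sigma>n]) simp
    then show ?thesis using smooth_sup_lower[of \<sigma> b n x, OF \<sigma>l] that(1) unfolding s_def by linarith
  qed
  \<comment> \<open>A value of \<open>s\<close> above 5/8 makes the cutoff complete, so on the open
    set where \<open>b n\<close> exceeds 3/4 all later terms vanish. This is the local
    finiteness.\<close>
  have u0: "u m x = 0" if "b n x > 3 / 4" "n < m" for n m x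
    using s_big[OF that] st(5)[of "4 * s m x + (-1)"] unfolding u_def \<psi>_def by simp
  have T_stab: "T m x = T (Suc n) x" if "b n x > 3 / 4" "Suc n \<le> m" for n m x
    unfolding T_def by (rule smooth_sup_const[OF \<sigma>n \<sigma>0]) (use u0[OF that(1)] that(2) in auto)
  \<comment> \<open>The limit defines \<open>h\<close> without a choice of \<open>n\<close>; locally
    it is a finite stage. The factor 8 takes the value 1/8 to 1, and adding 0 produces the form
    expected by \<open>smooth_real_affine\<close>.\<close>
  define h where "h x = st (8 * lim (\<lambda>m. T m x) + 0)" for x
  have h_eq: "h x = st (8 * T (Suc n) x + 0)" if "b n x > 3 / 4" for n x
  proof -
    have "(\<lambda>m. T m x) \<longlonglongrightarrow> T (Suc n) x"
    proof (rule tendsto_eventually)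
      show "\<forall>\<^sub>F m in sequentially. T m x = T (Suc n) x"
        using eventually_ge_at_top[of "Suc n"] by eventually_elim (rule T_stab[OF that])
    qed
    then have "lim (\<lambda>m. T m x) = T (Suc n) x" by (rule limI)
    then show ?thesis unfolding h_def by (rule arg_cong)
  qed
  have open_b: "open {x. b n x > 3 / 4}" for n
  proof -
    have "continuous_on UNIV (b n)" using slope_le_isCont[OF bL] by (simp add: continuous_at_imp_continuous_on)
    from open_Collect_less[OF continuous_on_const this] show ?thesis .
  qed
  have hC: "Ck_map A k h"
  proof (rule Ck_map_local)
    fix x
    obtain n where n: "b n x > 3 / 4" using near by blast
    have "Ck_map A k (\<lambda>x. st (8 * T (Suc n) x + 0))" by (rule Ck_map_compose[OF smooth_real_affine[OF st(1)] TC])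
    then show "\<exists>U g'. open U \<and> x \<in> U \<and> Ck_map A k g' \<and> (\<forall>y\<in>U. h y = g' y)"
      using open_b[of n] n h_eq by (intro exI[of _ "{x. b n x > 3 / 4}"] exI[of _ "\<lambda>x. st (8 * T (Suc n) x + 0)"]) blast
  qed
  have hL: "slope_le h x (8 * K * ?L)" for x
  proof -
    obtain n where n: "b n x > 3 / 4" using near by blast
    have "slope_le (\<lambda>x. st (8 * T (Suc n) x + 0)) x (8 * K * ?L)"
      by (rule slope_le_compose[OF TL, where \<sigma> = "\<lambda>t. st (8 * t + 0)", OF std]) (use st(3) in \<open>simp add: abs_mult\<close>)
    then show ?thesis by (rule slope_le_local[OF _ open_b[of n]]) (use n h_eq in auto)
  qed
  have hP: "h x = 0" if x: "x \<in> P" for x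
  proof -
    have z: "u n x = 0" for n
      using bs[of n x] x unfolding u_def \<psi>_def good_def by force
    obtain n where n: "b n x > 3 / 4" using near by blast
    have "T (Suc n) x = T 0 x" unfolding T_def by (rule smooth_sup_const[OF \<sigma>n \<sigma>0]) (use z in auto)
    then show ?thesis using h_eq[OF n] st(4) by (simp add: T_def)
  qed
  have hQ: "h x = 1" if x: "x \<in> Q" for x
  proof -
    obtain n where n: "b n x > 3 / 4" using near by blast
    have ex: "s (Suc n) x > 1 / 4" using s_big[OF n, of "Suc n"] by simp
    \<comment> \<open>At the first stage above 1/4 the newest bump must itself exceed 1/4, because
      the smooth maximum is at most the true one. Its cutoff sees the previous stage and is still
      inactive.\<close>
    define j where "j = (LEAST j. s j x > 1 / 4)"
    have j: "s j x > 1 / 4" "j \<le> Suc n" unfolding j_def using LeastI[of "\<lambda>j. s j x > 1 / 4", OF ex] Least_le[of "\<lambda>j. s j x > 1 / 4", OF ex] by auto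
    have "j \<noteq> 0" using j(1) by (cases j) (auto simp: s_def)
    then obtain m where m: "j = Suc m" using not0_implies_Suc by blast
    have sm: "s m x \<le> 1 / 4" using not_less_Least[of m "\<lambda>j. s j x > 1 / 4"] m unfolding j_def by force
    have bm: "b m x > 1 / 4"
      using smooth_sup_upper[of \<sigma> b m x, OF \<sigma>u] j(1) sm unfolding m s_def by linarith
    have \<psi>: "\<psi> m x = b m x" using st(4)[of "4 * s m x + (-1)"] sm unfolding \<psi>_def by simp
    have "good m" unfolding good_def
    proof (intro ballI impI, rule ccontr)
      fix p assume p: "p \<in> P" "reach (\<rho> m) p" and "\<not> \<delta> \<le> rdist (\<rho> m) p"
      have r: "reach (\<rho> m) x" "rdist (\<rho> m) x < \<delta>" using bs[of m x] bm by auto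
      have "rdist p x \<le> rdist p (\<rho> m) + rdist (\<rho> m) x" by (rule rdist_triangle[OF reach_sym[OF p(2)] r(1)])
      then have "rdist p x < 2 * \<delta>" using r(2) \<open>\<not> \<delta> \<le> rdist (\<rho> m) p\<close> rdist_sym[of p] by simp
      then show False using sep[OF p(1) x reach_trans[OF reach_sym[OF p(2)] r(1)]] by simp
    qed
    then have "u m x > 1 / 4" using \<psi> bm by (simp add: u_def)
    then have "T (Suc m) x \<ge> 1 / 8" using smooth_sup_lower[of \<sigma> u m x, OF \<sigma>l] unfolding T_def by linarith
    moreover have "T (Suc m) x \<le> T (Suc n) x" unfolding T_def using j(2) m by (intro smooth_sup_mono[OF \<sigma>n]) simp
    ultimately show ?thesis using h_eq[OF n] st(5) by simp
  qed
  show ?thesis using hC hL hP hQ st(6,7) by (intro exI[of _ h]) (auto simp: h_def)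
qed

section \<open>The equivalence\<close>

lemma uniform_bump_at:
  assumes b: "Ck_map A k b" "range b \<subseteq> {0..1}" "b p = 1"
    "\<And>q. ennreal \<delta> \<le> finsler_dist A N p q \<Longrightarrow> b q = 0" "\<And>q. differential_norm A N b q \<le> L"
  shows "bump_at L \<delta> p b"
  unfolding bump_at_def
proof (intro conjI allI impI)
  fix x
  show "slope_le b x L" by (rule Ck_map_slope_le[OF b(1,5)])
  have "b x \<in> {0..1}" using b(2) by blast
  then show "0 \<le> b x" "b x \<le> 1" by auto
  assume "b x \<noteq> 0"
  then have less: "finsler_dist A N p x < ennreal \<delta>" using b(4) not_le by blast
  then show r: "reach p x" by (auto simp: finsler_dist_reach split: if_splits)
  with less show "rdist p x < \<delta>" using rdist_nonneg by (simp add: finsler_dist_reach ennreal_less_iff)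
qed (use b in auto)

lemma Lipschitz_approximation:
  fixes \<rho> :: "nat \<Rightarrow> 'm"
  assumes dense: "\<And>U. open U \<Longrightarrow> U \<noteq> {} \<Longrightarrow> \<exists>n. \<rho> n \<in> U"
    and bumps: "\<And>p \<delta>. 0 < \<delta> \<Longrightarrow> \<delta> < r \<Longrightarrow> \<exists>b. bump_at (R / \<delta>) \<delta> p b" and R: "0 < R" and r: "0 < r"
    and st: "smooth_real st" "\<And>t. (st has_real_derivative st' t) (at t)" "\<And>t. \<bar>st' t\<bar> \<le> K"
      "\<And>t. t \<le> 0 \<Longrightarrow> st t = 0" "\<And>t. 1 \<le> t \<Longrightarrow> st t = 1" "\<And>t. 0 \<le> st t" "\<And>t. st t \<le> 1"
    and F: "is_Lipschitz_const A N UNIV F L" and \<epsilon>: "0 < \<epsilon>"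
  shows "\<exists>g. Ck_map A k g \<and> (\<forall>x. \<bar>F x - g x\<bar> < \<epsilon>) \<and> (\<forall>x. slope_le g x (32 * K * (1 + 4 * K) * R * L))"
proof (cases "L = 0")
  case True
  \<comment> \<open>For \<open>L = 0\<close> the radius \<open>H / (2 * L)\<close> makes no sense;
    but then \<open>F\<close> is locally constant and serves as its own approximation.\<close>
  have const: "\<exists>U. open U \<and> x \<in> U \<and> (\<forall>y\<in>U. F y = F x)" for x
  proof -
    obtain U where U: "open U" "x \<in> U" "\<And>q. q \<in> U \<Longrightarrow> reach x q \<and> rdist x q < 1"
      using small_neighbourhood[of 1] by (metis zero_less_one)
    have "F y = F x" if "y \<in> U" for y
      using F U(3)[OF that] True unfolding is_Lipschitz_const_iff by force
    then show ?thesis using U by blast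
  qed
  have "Ck_map A k F"
    by (rule Ck_map_local) (use const Ck_map_const in blast)
  moreover have "slope_le F x 0" for x
  proof -
    obtain U where "open U" "x \<in> U" "\<forall>y\<in>U. F y = F x" using const by blast
    then show ?thesis using slope_le_local[OF slope_le_const] by blast
  qed
  ultimately show ?thesis using True \<epsilon> by (intro exI[of _ F]) simp
next
  case False
  then have L: "0 < L" and lip: "\<And>p q. reach p q \<Longrightarrow> \<bar>F p - F q\<bar> \<le> L * rdist p q"
    using F unfolding is_Lipschitz_const_iff by auto
  \<comment> \<open>The first bound gives a strict error estimate, the second makes the bump radius
    \<open>H / (2 * L)\<close> less than \<open>r\<close>.\<close>
  define H where "H = min (\<epsilon> / 2) (L * r)"
  have H: "0 < H" "H < \<epsilon>" "H \<le> L * r" using \<epsilon> L r by (auto simp: H_def min_def)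
  define \<delta> where "\<delta> = H / (2 * L)"
  have \<delta>: "0 < \<delta>" "\<delta> < r" "2 * \<delta> = H / L" using H L r by (auto simp: \<delta>_def field_simps)
  have "\<exists>b. bump_at (R / \<delta>) \<delta> (\<rho> n) b" for n using bumps \<delta> by blast
  then obtain b where b: "\<And>n. bump_at (R / \<delta>) \<delta> (\<rho> n) (b n)" by metis
  let ?C = "8 * K * ((1 + 4 * K) * (R / \<delta>))"
  have "\<exists>h. Ck_map A k h \<and> (\<forall>x. slope_le h x ?C) \<and> (\<forall>x. 0 \<le> h x \<and> h x \<le> 1) \<and>
    (\<forall>x\<in>{x. F x \<le> of_int j * H}. h x = 0) \<and> (\<forall>x\<in>{x. (of_int j + 1) * H \<le> F x}. h x = 1)" for j :: int
  proof (rule smooth_urysohn[OF dense b _ _ st])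
    show "0 < R / \<delta>" using R \<delta> by simp
    fix p q assume p: "p \<in> {x. F x \<le> of_int j * H}" and q: "q \<in> {x. (of_int j + 1) * H \<le> F x}" and pq: "reach p q"
    have "H \<le> F q - F p" using p q by (simp add: algebra_simps)
    also have "\<dots> \<le> L * rdist p q" using lip[OF pq] by linarith
    finally show "2 * \<delta> \<le> rdist p q" unfolding \<delta>(3) using L by (simp add: divide_le_eq mult.commute)
  qed
  then obtain h where hC: "\<And>j. Ck_map A k (h j)" and hL: "\<And>j x. slope_le (h j) x ?C"
    and h01: "\<And>j x. 0 \<le> h j x \<and> h j x \<le> 1"
    and h0: "\<And>j x. F x \<le> of_int j * H \<Longrightarrow> h j x = 0" and h1: "\<And>j x. (of_int j + 1) * H \<le> F x \<Longrightarrow> h j x = 1"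
    by (simp only: mem_Collect_eq Ball_def) metis
  \<comment> \<open>The sum over all integer layers is normalised instead of being formed: below the
    layer \<open>j\<close> of \<open>x\<close> each layer contributes a full step, counted from
    level 0, and above it nothing is contributed.\<close>
  define g where "g x = (let j = \<lfloor>F x / H\<rfloor> in H * (of_int j + h j x))" for x
  have fl: "of_int \<lfloor>F x / H\<rfloor> * H \<le> F x" "F x < (of_int \<lfloor>F x / H\<rfloor> + 1) * H" for x
    using mult_right_mono[OF of_int_floor_le[of "F x / H"], of H] mult_strict_right_mono[OF conjunct2[OF floor_correct[of "F x / H"]], of H] H(1)
    by simp_all
  \<comment> \<open>The formula holds on an open strip two layers wide. Such strips also cover the
    points where the floor jumps, so \<open>g\<close> is smooth there.\<close>
  have g_eq: "g x = H * (h j x + h (j - 1) x) + H * (of_int j - 1)"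
    if "(of_int j - 1) * H < F x" "F x < (of_int j + 1) * H" for j x
  proof (cases "of_int j * H \<le> F x")
    case True
    then have j: "\<lfloor>F x / H\<rfloor> = j" using that H(1) by (intro floor_unique) (auto simp: field_simps)
    show ?thesis unfolding g_def Let_def j using h1[of "j - 1" x] True by (simp add: algebra_simps)
  next
    case False
    then have j: "\<lfloor>F x / H\<rfloor> = j - 1" using that H(1) by (intro floor_unique) (auto simp: field_simps)
    show ?thesis unfolding g_def Let_def j using h0[of x j] False by (simp add: algebra_simps)
  qed
  have loc: "\<exists>U j. open U \<and> x \<in> U \<and> (\<forall>y\<in>U. g y = H * (h j y + h (j - 1) y) + H * (of_int j - 1))" for x
  proof -
    define j where "j = \<lfloor>F x / H\<rfloor>"
    let ?U = "{y. (of_int j - 1) * H < F y} \<inter> {y. F y < (of_int j + 1) * H}"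
    have "continuous_on UNIV F" using Lipschitz_isCont[OF F] by (simp add: continuous_at_imp_continuous_on)
    then have "open ?U" by (intro open_Int open_Collect_less continuous_on_const)
    moreover have "x \<in> ?U" using fl[of x] H(1) unfolding j_def[symmetric] by (simp add: algebra_simps)
    ultimately show ?thesis using g_eq[of j] by (intro exI[of _ ?U] exI[of _ j]) auto
  qed
  have "Ck_map A k (\<lambda>y. H * (h j y + h (j - 1) y) + H * (of_int j - 1))" for j
    by (rule Ck_map_add[OF Ck_map_mult[OF Ck_map_const Ck_map_add[OF hC hC]] Ck_map_const])
  then have gC: "Ck_map A k g" using loc by (intro Ck_map_local) meson
  have "slope_le (\<lambda>y. H * (h j y + h (j - 1) y) + H * (of_int j - 1)) x (H * (?C + ?C))" for j x
    by (rule slope_le_compose[OF slope_le_add[OF hL hL], where \<sigma> = "\<lambda>t. H * t + H * (of_int j - 1)" and s = H])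
      (use H in \<open>auto intro!: derivative_eq_intros\<close>)
  \<comment> \<open>Here \<open>1 / \<delta> = 2 * L / H\<close> cancels the scaling by
    \<open>H\<close>, so the bound no longer depends on \<epsilon>.\<close>
  moreover have "H * (?C + ?C) = 32 * K * (1 + 4 * K) * R * L" using H L by (simp add: \<delta>_def field_simps)
  ultimately have sl: "slope_le (\<lambda>y. H * (h j y + h (j - 1) y) + H * (of_int j - 1)) x (32 * K * (1 + 4 * K) * R * L)" for j x
    by metis
  have gL: "slope_le g x (32 * K * (1 + 4 * K) * R * L)" for x
  proof -
    obtain U j where "open U" "x \<in> U" "\<forall>y\<in>U. g y = H * (h j y + h (j - 1) y) + H * (of_int j - 1)" using loc by blast
    then show ?thesis using slope_le_local[OF sl] by blast
  qed
  have "\<bar>F x - g x\<bar> < \<epsilon>" for x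
  proof -
    let ?j = "\<lfloor>F x / H\<rfloor>"
    have "0 \<le> H * h ?j x" "H * h ?j x \<le> H" using h01[of ?j x] H(1) by auto
    moreover have "g x = of_int ?j * H + H * h ?j x" by (simp add: g_def Let_def algebra_simps)
    moreover have "F x < of_int ?j * H + H" using fl(2)[of x] by (simp add: algebra_simps)
    ultimately have "\<bar>F x - g x\<bar> \<le> H" using fl(1)[of x] by linarith
    then show ?thesis using H(2) by linarith
  qed
  then show ?thesis using gC gL by blast
qed

definition smooth_approximation :: "real \<Rightarrow> bool" where
  "smooth_approximation C2 \<longleftrightarrow>
    (\<forall>G (f :: 'm \<Rightarrow> real) \<epsilon>. open G \<and> Lipschitz_map A N G f \<and> 0 < \<epsilon> \<longrightarrow>
       (\<exists>g :: 'm \<Rightarrow> real. Lipschitz_map A N UNIV g \<and> Ck_map A k g \<and>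
          (\<forall>x\<in>G. \<bar>f x - g x\<bar> < \<epsilon>) \<and>
          (\<forall>x. differential_norm A N g x \<le> C2 * Lip A N G f) \<and>
          Lip A N UNIV g \<le> C2 * Lip A N G f))"

text \<open>A step is applied to a rescaled approximation of the distance cone at \<open>p\<close>:
  the approximation has slope at most \<open>C2\<close>, because the cone is 1-Lipschitz, and
  rescaling by \<open>2 / \<delta>\<close> gives the required order of slope.\<close>

lemma bumps_of_approximation:
  assumes C2: "1 \<le> C2" and appr: "smooth_approximation C2"
  shows "uniformly_bumpable A N k"
proof -
  obtain st st' :: "real \<Rightarrow> real" and K where st:
    "smooth_real st" "\<And>t. (st has_real_derivative st' t) (at t)" "\<And>t. \<bar>st' t\<bar> \<le> K"
    and st0: "\<And>t. t \<le> 0 \<Longrightarrow> st t = 0" and st1: "\<And>t. 1 \<le> t \<Longrightarrow> st t = 1"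
    and st01: "\<And>t. 0 \<le> st t" "\<And>t. st t \<le> 1" and K: "1 \<le> K"
    using smooth_step_exists by metis
  have KC: "1 \<le> K * C2" using mult_mono[OF K C2] K by simp
  show ?thesis
    unfolding uniformly_bumpable_def
  \<comment> \<open>Slope \<open>C2\<close> of the approximation, slope \<open>K\<close> of the step
    and the rescaling \<open>2 / \<delta>\<close> multiply to this constant over
    \<open>\<delta>\<close>.\<close>
  proof (rule exI[of _ "2 * (K * C2)"], intro conjI, goal_cases)
    case 1
    show ?case using KC by simp
  next
    case 2
    show ?case
    proof (rule exI[of _ 1], intro conjI allI impI)
      fix p :: 'm and \<delta> :: real assume "0 < \<delta> \<and> \<delta> < 1"
      then have \<delta>: "0 < \<delta>" by blast
      \<comment> \<open>The case distinction matters: for unreachable \<open>q\<close> the default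
        \<open>rdist p q = 0\<close> would put the top of the cone there.\<close>
      define f where "f q = (if reach p q then max 0 (\<delta> - rdist p q) else 0)" for q
      have f1: "is_Lipschitz_const A N UNIV f 1"
        unfolding is_Lipschitz_const_iff
      proof (intro conjI ballI impI)
        fix x y assume xy: "reach x y"
        show "\<bar>f x - f y\<bar> \<le> 1 * rdist x y"
        proof (cases "reach p x")
          case True
          then have y: "reach p y" using reach_trans xy by blast
          show ?thesis
            using rdist_triangle[OF True xy] rdist_triangle[OF y reach_sym[OF xy]] rdist_sym[of x y] True y
            by (auto simp: f_def max_def abs_le_iff)
        next
          case False
          then have "\<not> reach p y" using reach_trans reach_sym[OF xy] by blast
          then show ?thesis using False rdist_nonneg by (simp add: f_def)
        qed
      qed simp
      then have fL: "Lipschitz_map A N UNIV f" unfolding Lipschitz_map_def by blast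
      have "0 < \<delta> / 4" using \<delta> by simp
      from appr[unfolded smooth_approximation_def, rule_format, of UNIV f, OF conjI[OF open_UNIV conjI[OF fL this]]] obtain g where g: "Ck_map A k g" "\<And>x. \<bar>f x - g x\<bar> < \<delta> / 4"
        "\<And>x. differential_norm A N g x \<le> C2 * Lip A N UNIV f" by blast
      have "C2 * Lip A N UNIV f \<le> C2 * 1" using Lip_least(2)[OF fL f1] C2 by (intro mult_left_mono) auto
      then have "differential_norm A N g x \<le> C2" for x using g(3)[of x] by simp
      then have gs: "slope_le g x C2" for x using Ck_map_slope_le[OF g(1)] by blast
      \<comment> \<open>The affine map sends \<open>\<delta> / 4\<close> to 0 and
        \<open>3 * \<delta> / 4\<close> to 1. With an error below \<open>\<delta> / 4\<close>, the
        value of \<open>g\<close> at \<open>p\<close> lies above the upper threshold and its values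
        at distance \<open>\<delta>\<close> or more lie below the lower one.\<close>
      define b where "b x = st (2 / \<delta> * g x + (- 1 / 2))" for x
      have bC: "Ck_map A k b"
        unfolding b_def by (rule Ck_map_compose[OF smooth_real_affine[OF st(1)] g(1)])
      have "slope_le b x (K * (2 / \<delta>) * C2)" for x
        unfolding b_def
      proof (rule slope_le_compose[OF gs, where \<sigma> = "\<lambda>t. st (2 / \<delta> * t + (- 1 / 2))"])
        show "((\<lambda>t. st (2 / \<delta> * t + - 1 / 2)) has_real_derivative st' (2 / \<delta> * g x + - 1 / 2) * (2 / \<delta>)) (at (g x))"
          by (rule DERIV_chain'[OF _ st(2)]) (use \<delta> in \<open>auto intro!: derivative_eq_intros\<close>)
        show "\<bar>st' (2 / \<delta> * g x + - 1 / 2) * (2 / \<delta>)\<bar> \<le> K * (2 / \<delta>)"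
          unfolding abs_mult using st(3) \<delta> K by (intro mult_mono) auto
      qed
      then have "differential_norm A N b x \<le> K * (2 / \<delta>) * C2" for x
        using K C2 \<delta> by (intro differential_norm_le) auto
      then have bn: "differential_norm A N b x \<le> 2 * (K * C2) / \<delta>" for x by (simp add: ac_simps)
      have "f p = \<delta>" using \<delta> by (simp add: f_def reach_refl rdist_refl)
      then have "g p > 3 / 4 * \<delta>" using g(2)[of p] by linarith
      then have bp: "b p = 1" unfolding b_def using \<delta> by (intro st1) (simp add: field_simps)
      have bq: "b q = 0" if "ennreal \<delta> \<le> finsler_dist A N p q" for q
      proof -
        have "f q = 0" using that \<delta> rdist_nonneg[of p q] by (auto simp: f_def finsler_dist_reach ennreal_le_iff)
        then have "g q < \<delta> / 4" using g(2)[of q] by simp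
        then show ?thesis unfolding b_def using \<delta> by (intro st0) (simp add: field_simps)
      qed
      show "\<exists>b. Ck_map A k b \<and> range b \<subseteq> {0..1} \<and> b p = 1 \<and>
          (\<forall>q. ennreal \<delta> \<le> finsler_dist A N p q \<longrightarrow> b q = 0) \<and>
          (\<forall>q. differential_norm A N b q \<le> 2 * (K * C2) / \<delta>)"
        using bC bp bq bn st01 by (intro exI[of _ b]) (auto simp: b_def)
    qed simp
  qed
qed

lemma approximation_of_bumps:
  assumes ub: "uniformly_bumpable A N k" and sep: "separable_space (euclidean :: 'm topology)"
  shows "\<exists>C2\<ge>1. smooth_approximation C2"
proof -
  obtain st st' :: "real \<Rightarrow> real" and K where st:
    "smooth_real st" "\<And>t. (st has_real_derivative st' t) (at t)" "\<And>t. \<bar>st' t\<bar> \<le> K"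
    "\<And>t. t \<le> 0 \<Longrightarrow> st t = 0" "\<And>t. 1 \<le> t \<Longrightarrow> st t = 1"
    "\<And>t. 0 \<le> st t" "\<And>t. st t \<le> 1" and K: "1 \<le> K"
    using smooth_step_exists by metis
  obtain R r where R: "1 < R" "0 < r"
    and bumps: "\<forall>p. \<forall>\<delta>. 0 < \<delta> \<and> \<delta> < r \<longrightarrow>
        (\<exists>b. Ck_map A k b \<and> range b \<subseteq> {0..1} \<and> b p = 1 \<and>
             (\<forall>q. ennreal \<delta> \<le> finsler_dist A N p q \<longrightarrow> b q = 0) \<and>
             (\<forall>q. differential_norm A N b q \<le> R / \<delta>))"
    using ub unfolding uniformly_bumpable_def by blast
  have bump: "\<exists>b. bump_at (R / \<delta>) \<delta> p b" if "0 < \<delta>" "\<delta> < r" for p \<delta>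
    using bumps that uniform_bump_at by meson
  obtain D where D: "countable D" "closure D = (UNIV :: 'm set)"
    using sep unfolding separable_space_def by auto
  then have "D \<noteq> {}" by (metis closure_empty empty_not_UNIV)
  \<comment> \<open>The enumeration repeats points if \<open>D\<close> is finite; repeated centres
    do no harm.\<close>
  have dense: "\<exists>n. from_nat_into D n \<in> U" if "open U" "U \<noteq> {}" for U
  proof -
    have "D \<inter> U \<noteq> {}" using open_Int_closure_eq_empty[OF that(1), of D] D(2) that(2) by auto
    then obtain d where "d \<in> D" "d \<in> U" by blast
    then show ?thesis using from_nat_into_surj[OF D(1)] by metis
  qed
  let ?C = "32 * K * (1 + 4 * K) * R"
  have "1 * 1 * 1 \<le> 32 * K * (1 + 4 * K) * R" using K R by (intro mult_mono) auto
  then have C: "1 \<le> ?C" by simp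
  show ?thesis unfolding smooth_approximation_def
  proof (intro exI[of _ ?C] conjI C allI impI)
    fix G and f :: "'m \<Rightarrow> real" and \<epsilon> :: real
    assume "open G \<and> Lipschitz_map A N G f \<and> 0 < \<epsilon>"
    then have f: "Lipschitz_map A N G f" and \<epsilon>: "0 < \<epsilon>" by auto
    let ?L = "Lip A N G f"
    have fL: "is_Lipschitz_const A N G f ?L" by (rule Lip_least(1)[OF f])
    then have L: "0 \<le> ?C * ?L" using K R unfolding is_Lipschitz_const_def by (intro mult_nonneg_nonneg) auto
    \<comment> \<open>The extension keeps the least constant of \<open>f\<close> on
      \<open>G\<close>, so the slope of the approximation on all of the manifold is measured against
      \<open>Lip A N G f\<close>.\<close>
    obtain F where F: "is_Lipschitz_const A N UNIV F ?L" "\<forall>x\<in>G. F x = f x" using McShane_extension[OF fL] by blast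
    obtain g where g: "Ck_map A k g" "\<And>x. \<bar>F x - g x\<bar> < \<epsilon>" "\<And>x. slope_le g x (?C * ?L)"
      using Lipschitz_approximation[OF dense bump _ R(2) st F(1) \<epsilon>] R(1) by force
    have gL: "is_Lipschitz_const A N UNIV g (?C * ?L)" by (rule slope_is_Lipschitz[OF g(3) L])
    then have gl: "Lipschitz_map A N UNIV g" unfolding Lipschitz_map_def by blast
    have "\<bar>f x - g x\<bar> < \<epsilon>" if "x \<in> G" for x using g(2)[of x] F(2) that by simp
    then show "\<exists>g. Lipschitz_map A N UNIV g \<and> Ck_map A k g \<and> (\<forall>x\<in>G. \<bar>f x - g x\<bar> < \<epsilon>) \<and>
          (\<forall>x. differential_norm A N g x \<le> ?C * ?L) \<and> Lip A N UNIV g \<le> ?C * ?L"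
      using gl g(1) differential_norm_le[OF g(3) L] Lip_least(2)[OF gl gL] by blast
  qed
qed

end

theorem theorem5p2:
  fixes A :: "('m::t2_space, 'x::banach) chart set"
    and N :: "('m, 'x) finsler_structure"
    and k l :: enat
  assumes "NU_finsler_manifold l A N"
    and "separable_space (euclidean :: 'm topology)"
    and "1 \<le> k" and "k \<le> l"
  shows "uniformly_bumpable A N k \<longleftrightarrow>
    (\<exists>C2\<ge>1. \<forall>G (f :: 'm \<Rightarrow> real) \<epsilon>. open G \<and> Lipschitz_map A N G f \<and> 0 < \<epsilon> \<longrightarrow>
       (\<exists>g :: 'm \<Rightarrow> real. Lipschitz_map A N UNIV g \<and> Ck_map A k g \<and>
          (\<forall>x\<in>G. \<bar>f x - g x\<bar> < \<epsilon>) \<and>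
          (\<forall>x. differential_norm A N g x \<le> C2 * Lip A N G f) \<and>
          Lip A N UNIV g \<le> C2 * Lip A N G f))"
proof -
  interpret smooth_finsler A N l k
    using assms by unfold_locales auto
  have "uniformly_bumpable A N k \<longleftrightarrow> (\<exists>C2\<ge>1. smooth_approximation C2)"
    using approximation_of_bumps[OF _ assms(2)] bumps_of_approximation by blast
  then show ?thesis unfolding smooth_approximation_def .
qed

end
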